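(* Let $a,b\in L^1(\mathbb{R})\cap H^1(\mathbb{R})$ and let $\eta>0$ be sufficiently small (depending on the norms of $a$ and $b$). Let $S_a,S_b:B_\eta\subset L^2(\mathbb{R})\to L^2(\mathbb{R})$ be the scattering maps for $i\partial_tu=-\Delta u+a(x)|u|^2u$ and $i\partial_tu=-\Delta u+b(x)|u|^2u$, respectively, and define \[ \|S_a-S_b\|:=\sup\Bigl\{\frac{\|S_a(\varphi)-S_b(\varphi)\|_{L^2}}{\|\varphi\|_{L^2}}:\varphi\in B_\eta\setminus\{0\}\Bigr\}. \] If $\|S_a-S_b\|\ge0$ is sufficiently small, i.e. $0\le\|S_a-S_b\|\le\delta$ for some $\delta>0$ depending only on $\eta$ and the norms of $a$ and $b$, then \[ \|a-b\|_{L^\infty(\mathbb{R})}\le C\,\biggl|\log\biggl(\frac{\|S_a-S_b\|}{1+\|a\|_{L^1\cap H^1}^2+\|b\|_{L^1\cap H^1}^2}\biggr)\biggr|^{-1}, \] where $C$ depends only on the $L^1$ and $H^1$ norms of $a$ and $b$, and the right-hand side is interpreted as $0$ when $\|S_a-S_b\|=0$.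
   Context: All equations are posed on $(t,x)\in\mathbb{R}\times\mathbb{R}$ (one space dimension, $\Delta=\partial_x^2$). $B_\eta=\{f\in L^2(\mathbb{R}):\|f\|_{L^2}<\eta\}$, and $\|a\|_{L^1\cap H^1}=\|a\|_{L^1}+\|a\|_{H^1}$. $e^{it\Delta}$ is the free Schrödinger propagator, the Fourier multiplier operator with symbol $e^{-it\xi^2}$. Scattering map: for $a\in L^1(\mathbb{R})$ there is a small $\eta>0$ such that for every $u_0\in B_\eta\subset L^2(\mathbb{R})$ there exist a unique global solution $u$ to $i\partial_tu=-\Delta u+a(x)|u|^2u$ with $u|_{t=0}=u_0$ and a function $u_+\in L^2(\mathbb{R})$ with $\lim_{t\to\infty}\|u(t)-e^{it\Delta}u_+\|_{L^2}=0$. Solutions are understood via the Duhamel formula $u(t)=e^{it\Delta}u_0-i\int_0^te^{i(t-s)\Delta}[a|u|^2u(s)]\,ds$ in $C_tL^2_x\cap L_t^4L_x^\infty$. The scattering map is $S_a(u_0):=u_+$. *)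

theory Defs
  imports "HOL-Analysis.Analysis" "HOL-Probability.Essential_Supremum"
begin

section \<open>The Hilbert space of square integrable functions on the line\<close>

definition lsq :: "(real \<Rightarrow> complex) \<Rightarrow> bool" where
  "lsq f \<longleftrightarrow> f \<in> borel_measurable lborel \<and> integrable lborel (\<lambda>x. (cmod (f x))\<^sup>2)"

lemma lsq_measurable [measurable_dest]: "lsq f \<Longrightarrow> f \<in> borel_measurable lborel"
  by (simp add: lsq_def)

lemma lsq_integrable: "lsq f \<Longrightarrow> integrable lborel (\<lambda>x. (cmod (f x))\<^sup>2)"
  by (simp add: lsq_def)

lemma lsq_zero [simp]: "lsq (\<lambda>x. 0)"
  by (simp add: lsq_def)

lemma lsq_bound:
  assumes "f \<in> borel_measurable lborel" "lsq g" "\<And>x. cmod (f x) \<le> cmod (g x)"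
  shows "lsq f"
  unfolding lsq_def
proof
  show "integrable lborel (\<lambda>x. (cmod (f x))\<^sup>2)"
    by (rule Bochner_Integration.integrable_bound[OF lsq_integrable[OF assms(2)]])
       (use assms in \<open>auto intro!: power_mono\<close>)
qed fact

lemma lsq_add:
  assumes "lsq f" "lsq g"
  shows "lsq (\<lambda>x. f x + g x)"
  unfolding lsq_def
proof
  note [measurable] = lsq_measurable[OF assms(1)] lsq_measurable[OF assms(2)]
  show "(\<lambda>x. f x + g x) \<in> borel_measurable lborel" by measurable
  have le: "(cmod (f x + g x))\<^sup>2 \<le> 2 * (cmod (f x))\<^sup>2 + 2 * (cmod (g x))\<^sup>2" for x
  proof -
    have "(cmod (f x + g x))\<^sup>2 \<le> (cmod (f x) + cmod (g x))\<^sup>2"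
      by (intro power_mono norm_triangle_ineq) auto
    also have "\<dots> \<le> 2 * (cmod (f x))\<^sup>2 + 2 * (cmod (g x))\<^sup>2"
      using sum_squares_bound[of "cmod (f x)" "cmod (g x)"] by (simp add: power2_sum)
    finally show ?thesis .
  qed
  show "integrable lborel (\<lambda>x. (cmod (f x + g x))\<^sup>2)"
    by (rule Bochner_Integration.integrable_bound
          [where f = "\<lambda>x. 2 * (cmod (f x))\<^sup>2 + 2 * (cmod (g x))\<^sup>2"])
       (use assms le in \<open>auto simp: lsq_def\<close>)
qed

lemma lsq_cmult: "lsq f \<Longrightarrow> lsq (\<lambda>x. c * f x)"
  unfolding lsq_def by (auto simp: norm_mult power_mult_distrib)

lemma lsq_uminus: "lsq f \<Longrightarrow> lsq (\<lambda>x. - f x)"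
  unfolding lsq_def by simp

lemma lsq_diff: "lsq f \<Longrightarrow> lsq g \<Longrightarrow> lsq (\<lambda>x. f x - g x)"
  using lsq_add[OF _ lsq_uminus, of f g] by simp

lemma lsq_inner_integrable:
  assumes "lsq f" "lsq g"
  shows "integrable lborel (\<lambda>x. inner (f x) (g x))"
proof (rule Bochner_Integration.integrable_bound)
  note [measurable] = lsq_measurable[OF assms(1)] lsq_measurable[OF assms(2)]
  show "integrable lborel (\<lambda>x. (cmod (f x))\<^sup>2 + (cmod (g x))\<^sup>2)"
    using assms by (auto simp: lsq_def)
  show "(\<lambda>x. inner (f x) (g x)) \<in> borel_measurable lborel" by measurable
  have "\<bar>inner (f x) (g x)\<bar> \<le> (cmod (f x))\<^sup>2 + (cmod (g x))\<^sup>2" for x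
  proof -
    have "\<bar>inner (f x) (g x)\<bar> \<le> cmod (f x) * cmod (g x)"
      by (rule Cauchy_Schwarz_ineq2)
    moreover have "0 \<le> cmod (f x) * cmod (g x)" by simp
    ultimately show ?thesis
      using sum_squares_bound[of "cmod (f x)" "cmod (g x)"] by linarith
  qed
  then show "AE x in lborel. norm (inner (f x) (g x)) \<le> norm ((cmod (f x))\<^sup>2 + (cmod (g x))\<^sup>2)"
    by simp
qed

quotient_type L2 = "real \<Rightarrow> complex" /
  partial: "\<lambda>f g. lsq f \<and> lsq g \<and> (AE x in lborel. f x = g x)"
proof (rule part_equivpI)
  show "\<exists>f. lsq f \<and> lsq f \<and> (AE x in lborel. f x = f x)"
    by (rule exI[of _ "\<lambda>x. 0"]) simp
  show "symp (\<lambda>f g. lsq f \<and> lsq g \<and> (AE x in lborel. f x = g x))"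
    by (rule sympI) (simp add: eq_commute)
  show "transp (\<lambda>f g. lsq f \<and> lsq g \<and> (AE x in lborel. f x = g x))"
  proof (rule transpI)
    fix f g h :: "real \<Rightarrow> complex"
    assume fg: "lsq f \<and> lsq g \<and> (AE x in lborel. f x = g x)"
      and gh: "lsq g \<and> lsq h \<and> (AE x in lborel. g x = h x)"
    from fg gh have "AE x in lborel. f x = g x" "AE x in lborel. g x = h x" by auto
    then have "AE x in lborel. f x = h x" by eventually_elim simp
    with fg gh show "lsq f \<and> lsq h \<and> (AE x in lborel. f x = h x)" by simp
  qed
qed

instantiation L2 :: real_vector
begin

lift_definition zero_L2 :: L2 is "\<lambda>x. 0" by simp
lift_definition plus_L2 :: "L2 \<Rightarrow> L2 \<Rightarrow> L2" is "\<lambda>f g x. f x + g x" by (auto intro: lsq_add)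
lift_definition uminus_L2 :: "L2 \<Rightarrow> L2" is "\<lambda>f x. - f x" by (auto intro: lsq_uminus)
lift_definition minus_L2 :: "L2 \<Rightarrow> L2 \<Rightarrow> L2" is "\<lambda>f g x. f x - g x" by (auto intro: lsq_diff)
lift_definition scaleR_L2 :: "real \<Rightarrow> L2 \<Rightarrow> L2" is "\<lambda>r f x. of_real r * f x"
  by (auto intro: lsq_cmult)

instance
proof
  fix f g h :: L2 and r s :: real
  show "f + g + h = f + (g + h)"
    by transfer (simp add: lsq_add add.assoc)
  show "f + g = g + f"
    by transfer (simp add: lsq_add add.commute)
  show "0 + f = f"
    by transfer simp
  show "- f + f = 0"
    by transfer simp
  show "f - g = f + - g"
    by transfer (simp add: lsq_add lsq_diff lsq_uminus)
  show "r *\<^sub>R (f + g) = r *\<^sub>R f + r *\<^sub>R g"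
    by transfer (simp add: lsq_add lsq_cmult distrib_left)
  show "(r + s) *\<^sub>R f = r *\<^sub>R f + s *\<^sub>R f"
    by transfer (simp add: lsq_add lsq_cmult lsq_cmult[of _ "of_real r + of_real s"] distrib_right)
  show "r *\<^sub>R s *\<^sub>R f = (r * s) *\<^sub>R f"
    by transfer (simp add: lsq_cmult lsq_cmult[of _ "of_real r * of_real s"] mult.assoc[symmetric])
  show "1 *\<^sub>R f = f"
    by transfer simp
qed

end

instantiation L2 :: real_inner
begin

lift_definition inner_L2 :: "L2 \<Rightarrow> L2 \<Rightarrow> real" is "\<lambda>f g. LINT x|lborel. inner (f x) (g x)"
proof -
  fix f f' g g' :: "real \<Rightarrow> complex"
  assume f: "lsq f \<and> lsq f' \<and> (AE x in lborel. f x = f' x)"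
    and g: "lsq g \<and> lsq g' \<and> (AE x in lborel. g x = g' x)"
  show "(LINT x|lborel. inner (f x) (g x)) = (LINT x|lborel. inner (f' x) (g' x))"
  proof (rule integral_cong_AE)
    show "(\<lambda>x. inner (f x) (g x)) \<in> borel_measurable lborel"
      by (rule borel_measurable_integrable[OF lsq_inner_integrable]) (use f g in auto)
    show "(\<lambda>x. inner (f' x) (g' x)) \<in> borel_measurable lborel"
      by (rule borel_measurable_integrable[OF lsq_inner_integrable]) (use f g in auto)
    show "AE x in lborel. inner (f x) (g x) = inner (f' x) (g' x)"
      using f g by auto
  qed
qed

definition norm_L2 :: "L2 \<Rightarrow> real" where "norm_L2 f = sqrt (inner f f)"
definition sgn_L2 :: "L2 \<Rightarrow> L2" where "sgn_L2 f = f /\<^sub>R norm f"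
definition dist_L2 :: "L2 \<Rightarrow> L2 \<Rightarrow> real" where "dist_L2 f g = norm (f - g)"
definition uniformity_L2 :: "(L2 \<times> L2) filter" where
  "uniformity_L2 = (INF e\<in>{0<..}. principal {(f, g). dist f g < e})"
definition open_L2 :: "L2 set \<Rightarrow> bool" where
  "open_L2 U \<longleftrightarrow> (\<forall>f\<in>U. eventually (\<lambda>(f', g). f' = f \<longrightarrow> g \<in> U) uniformity)"

instance
proof
  fix f g h :: L2 and r :: real
  show "inner f g = inner g f"
    by transfer (simp add: inner_commute)
  show "inner (f + g) h = inner f h + inner g h"
    by transfer (simp add: inner_add_left lsq_inner_integrable)
  show "inner (r *\<^sub>R f) g = r * inner f g"
    by transfer (simp only: scaleR_conv_of_real[symmetric] inner_scaleR_left integral_mult_right_zero)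
  show "0 \<le> inner f f"
    by transfer simp
  show "(inner f f = 0) = (f = 0)"
  proof transfer
    fix f :: "real \<Rightarrow> complex"
    assume "lsq f \<and> lsq f \<and> (AE x in lborel. f x = f x)"
    then have f: "lsq f" by simp
    have "(LINT x|lborel. inner (f x) (f x)) = 0 \<longleftrightarrow> (AE x in lborel. inner (f x) (f x) = 0)"
      by (rule integral_nonneg_eq_0_iff_AE) (use f in \<open>auto intro: lsq_inner_integrable\<close>)
    then show "((LINT x|lborel. inner (f x) (f x)) = 0) =
        (lsq f \<and> lsq (\<lambda>x. 0) \<and> (AE x in lborel. f x = 0))"
      using f by simp
  qed
  show "norm f = sqrt (inner f f)" by (rule norm_L2_def)
qed (rule sgn_L2_def dist_L2_def uniformity_L2_def open_L2_def)+

end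

text \<open>The class of a function, with the usual convention \<open>0\<close> outside the square integrable ones.\<close>

definition to_L2 :: "(real \<Rightarrow> complex) \<Rightarrow> L2" where
  "to_L2 f = (if lsq f then abs_L2 f else 0)"

lemma lsq_rep_L2 [simp]: "lsq (rep_L2 f)"
  using Quotient3_rep_reflp[OF Quotient3_L2, of f] by blast

lemma to_L2_rep [simp]: "to_L2 (rep_L2 f) = f"
  by (simp add: to_L2_def Quotient3_abs_rep[OF Quotient3_L2])

lemma to_L2_eq_iff:
  assumes "lsq f" "lsq g"
  shows "to_L2 f = to_L2 g \<longleftrightarrow> (AE x in lborel. f x = g x)"
  using assms Quotient3_rel[OF Quotient3_L2, of f g] by (simp add: to_L2_def)

lemma rep_to_L2: "lsq f \<Longrightarrow> AE x in lborel. rep_L2 (to_L2 f) x = f x"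
  using to_L2_eq_iff[of "rep_L2 (to_L2 f)" f] by simp

lemma to_L2_zero [simp]: "to_L2 (\<lambda>x. 0) = 0"
  by (simp add: to_L2_def zero_L2_def)

lemma to_L2_add: "lsq f \<Longrightarrow> lsq g \<Longrightarrow> to_L2 f + to_L2 g = to_L2 (\<lambda>x. f x + g x)"
  by (simp add: to_L2_def plus_L2.abs_eq lsq_add)

lemma to_L2_diff: "lsq f \<Longrightarrow> lsq g \<Longrightarrow> to_L2 f - to_L2 g = to_L2 (\<lambda>x. f x - g x)"
  by (simp add: to_L2_def minus_L2.abs_eq lsq_diff)

lemma to_L2_scaleR: "lsq f \<Longrightarrow> r *\<^sub>R to_L2 f = to_L2 (\<lambda>x. of_real r * f x)"
  by (simp add: to_L2_def scaleR_L2.abs_eq lsq_cmult)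

lemma norm_to_L2: "lsq f \<Longrightarrow> norm (to_L2 f) = sqrt (LINT x|lborel. (cmod (f x))\<^sup>2)"
  unfolding norm_L2_def by (simp add: to_L2_def inner_L2.abs_eq power2_norm_eq_inner)

lemma norm_to_L2_nn:
  assumes "lsq f"
  shows "ennreal ((norm (to_L2 f))\<^sup>2) = (\<integral>\<^sup>+x. ennreal ((cmod (f x))\<^sup>2) \<partial>lborel)"
  using assms by (simp add: norm_to_L2 nn_integral_eq_integral lsq_integrable)

lemma ennreal_finite_cases: "s \<noteq> \<infinity> \<Longrightarrow> \<exists>C. s = ennreal C \<and> 0 \<le> C"
  by (cases s) auto

lemma ennreal_term_le_suminf: "(s k :: ennreal) \<le> (\<Sum>k. s k)"
  using sum_le_suminf[of s "{k}"] by simp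

instance L2 :: banach
proof
  fix X :: "nat \<Rightarrow> L2"
  assume X: "Cauchy X"
  have "\<exists>N. \<forall>m\<ge>N. \<forall>n\<ge>N. dist (X m) (X n) < (1/4)^k" for k
    using X unfolding Cauchy_def by simp
  then obtain N where N: "\<And>k m n. m \<ge> N k \<Longrightarrow> n \<ge> N k \<Longrightarrow> dist (X m) (X n) < (1/4)^k"
    by metis
  define r where "r k = (\<Sum>i\<le>k. N i) + k" for k
  have r: "strict_mono r"
    unfolding strict_mono_Suc_iff r_def by simp
  have rN: "N k \<le> r m" if "k \<le> m" for k m
  proof -
    have "N k \<le> (\<Sum>i\<le>m. N i)" by (rule member_le_sum) (use that in auto)
    then show ?thesis by (simp add: r_def)
  qed
  define f where "f k = rep_L2 (X (r k))" for k
  have f [simp]: "lsq (f k)" for k by (simp add: f_def)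
  have fX: "to_L2 (f k) = X (r k)" for k by (simp add: f_def)
  have meas [measurable]: "f k \<in> borel_measurable borel" for k
    using lsq_measurable[OF f[of k]] by simp
  have dist: "(\<integral>\<^sup>+x. ennreal ((cmod (f m x - f k x))\<^sup>2) \<partial>lborel) \<le> ennreal ((1/16)^k)"
    if "k \<le> m" for k m
  proof -
    have "norm (to_L2 (\<lambda>x. f m x - f k x)) < (1/4)^k"
      using N[of k "r m" "r k"] rN[of k m] rN[of k k] that
      by (simp add: dist_norm fX flip: to_L2_diff)
    then have "(norm (to_L2 (\<lambda>x. f m x - f k x)))\<^sup>2 \<le> ((1/4)^k)\<^sup>2"
      by (intro power_mono) auto
    also have "((1/4)^k)\<^sup>2 = ((1/16)^k :: real)"
      by (simp add: power2_eq_square flip: power_mult_distrib)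
    finally show ?thesis
      by (subst norm_to_L2_nn[symmetric]) (auto intro: lsq_diff ennreal_leI)
  qed
  have "(\<integral>\<^sup>+x. (\<Sum>k. ennreal (4^k * (cmod (f (Suc k) x - f k x))\<^sup>2)) \<partial>lborel)
      = (\<Sum>k. \<integral>\<^sup>+x. ennreal (4^k * (cmod (f (Suc k) x - f k x))\<^sup>2) \<partial>lborel)"
    by (rule nn_integral_suminf) measurable
  also have "\<dots> \<le> (\<Sum>k. ennreal ((1/4)^k))"
  proof (rule suminf_le)
    fix k
    have "(\<integral>\<^sup>+x. ennreal (4^k * (cmod (f (Suc k) x - f k x))\<^sup>2) \<partial>lborel)
        = ennreal (4^k) * (\<integral>\<^sup>+x. ennreal ((cmod (f (Suc k) x - f k x))\<^sup>2) \<partial>lborel)"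
      by (subst nn_integral_cmult[symmetric]) (auto simp: ennreal_mult)
    also have "\<dots> \<le> ennreal (4^k) * ennreal ((1/16)^k)"
      by (intro mult_left_mono dist) auto
    also have "\<dots> = ennreal ((1/4)^k)"
      by (simp flip: ennreal_mult power_mult_distrib)
    finally show "(\<integral>\<^sup>+x. ennreal (4^k * (cmod (f (Suc k) x - f k x))\<^sup>2) \<partial>lborel)
      \<le> ennreal ((1/4)^k)" .
  qed auto
  also have "\<dots> = ennreal (\<Sum>k. (1/4)^k)"
    by (rule suminf_ennreal2) auto
  also have "\<dots> < \<infinity>" by simp
  finally have fin: "(\<integral>\<^sup>+x. (\<Sum>k. ennreal (4^k * (cmod (f (Suc k) x - f k x))\<^sup>2)) \<partial>lborel) \<noteq> \<infinity>"
    by simp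
  have "AE x in lborel. (\<Sum>k. ennreal (4^k * (cmod (f (Suc k) x - f k x))\<^sup>2)) \<noteq> \<infinity>"
  proof (rule nn_integral_PInf_AE)
    show "(\<lambda>x. \<Sum>k. ennreal (4^k * (cmod (f (Suc k) x - f k x))\<^sup>2)) \<in> borel_measurable lborel"
      by (intro borel_measurable_suminf_order) measurable
  qed (rule fin)
  then have conv: "AE x in lborel. convergent (\<lambda>k. f k x)"
  proof eventually_elim
    case (elim x)
    then obtain C where C: "(\<Sum>k. ennreal (4^k * (cmod (f (Suc k) x - f k x))\<^sup>2)) = ennreal C" "0 \<le> C"
      using ennreal_finite_cases by blast
    have "cmod (f (Suc k) x - f k x) \<le> sqrt C * (1/2)^k" for k
    proof -
      have "ennreal (4^k * (cmod (f (Suc k) x - f k x))\<^sup>2)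
          \<le> (\<Sum>k. ennreal (4^k * (cmod (f (Suc k) x - f k x))\<^sup>2))"
        by (rule ennreal_term_le_suminf)
      then have "ennreal (4^k * (cmod (f (Suc k) x - f k x))\<^sup>2) \<le> ennreal C"
        by (simp only: C(1))
      then have "4^k * (cmod (f (Suc k) x - f k x))\<^sup>2 \<le> C"
        using C(2) by (simp add: ennreal_le_iff)
      moreover have "(4::real)^k = (2^k)\<^sup>2"
        by (simp add: power2_eq_square flip: power_mult_distrib)
      ultimately have "(2^k * cmod (f (Suc k) x - f k x))\<^sup>2 \<le> C"
        by (simp add: power_mult_distrib)
      then have "2^k * cmod (f (Suc k) x - f k x) \<le> sqrt C"
        by (rule real_le_rsqrt)
      then show ?thesis
        by (simp add: field_simps)
    qed
    note le = this
    have "summable (\<lambda>k. sqrt C * (1/2::real)^k)"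
      by (intro summable_mult summable_geometric) simp
    then have "summable (\<lambda>k. f (Suc k) x - f k x)"
      by (rule summable_comparison_test'[where N = 0]) (rule le)
    then have "convergent (\<lambda>n. \<Sum>k<n. f (Suc k) x - f k x)"
      by (rule summable_iff_convergent[THEN iffD1])
    then have "convergent (\<lambda>n. f n x - f 0 x)"
      by (simp only: sum_lessThan_telescope[of "\<lambda>n. f n x"])
    then have "convergent (\<lambda>n. (f n x - f 0 x) + f 0 x)"
      by (intro convergent_add convergent_const)
    then show ?case by simp
  qed
  define g where "g x = lim (\<lambda>k. f k x)" for x
  have g_meas [measurable]: "g \<in> borel_measurable borel"
    unfolding g_def by (rule borel_measurable_lim_metric) measurable
  have gf: "(\<integral>\<^sup>+x. ennreal ((cmod (g x - f k x))\<^sup>2) \<partial>lborel) \<le> ennreal ((1/16)^k)" for k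
  proof -
    have "(\<integral>\<^sup>+x. ennreal ((cmod (g x - f k x))\<^sup>2) \<partial>lborel)
        = (\<integral>\<^sup>+x. liminf (\<lambda>m. ennreal ((cmod (f m x - f k x))\<^sup>2)) \<partial>lborel)"
    proof (rule nn_integral_cong_AE)
      show "AE x in lborel. ennreal ((cmod (g x - f k x))\<^sup>2)
          = liminf (\<lambda>m. ennreal ((cmod (f m x - f k x))\<^sup>2))"
        using conv
      proof eventually_elim
        case (elim x)
        then have "(\<lambda>m. f m x) \<longlonglongrightarrow> g x"
          by (simp add: g_def convergent_LIMSEQ_iff)
        then have "(\<lambda>m. ennreal ((cmod (f m x - f k x))\<^sup>2)) \<longlonglongrightarrow> ennreal ((cmod (g x - f k x))\<^sup>2)"
          by (intro tendsto_intros)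
        then show ?case
          by (rule lim_imp_Liminf[symmetric, rotated]) simp
      qed
    qed
    also have "\<dots> \<le> liminf (\<lambda>m. \<integral>\<^sup>+x. ennreal ((cmod (f m x - f k x))\<^sup>2) \<partial>lborel)"
      by (rule nn_integral_liminf) measurable
    also have "\<dots> \<le> ennreal ((1/16)^k)"
    proof (rule Liminf_le)
      show "\<forall>\<^sub>F m in sequentially.
          (\<integral>\<^sup>+x. ennreal ((cmod (f m x - f k x))\<^sup>2) \<partial>lborel) \<le> ennreal ((1/16)^k)"
        using eventually_ge_at_top[of k] by eventually_elim (rule dist)
    qed simp
    finally show ?thesis .
  qed
  have lsq_gf: "lsq (\<lambda>x. g x - f k x)" for k
  proof -
    have "integrable lborel (\<lambda>x. (cmod (g x - f k x))\<^sup>2)"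
      by (rule integrableI_bounded) (use le_less_trans[OF gf[of k]] in auto)
    then show ?thesis by (simp add: lsq_def)
  qed
  have g: "lsq g"
    using lsq_add[OF lsq_gf[of 0] f[of 0]] by simp
  have le: "norm (X (r k) - to_L2 g) \<le> (1/4)^k" for k
  proof -
    have "ennreal ((norm (to_L2 g - X (r k)))\<^sup>2) \<le> ennreal ((1/16)^k)"
      using gf[of k] norm_to_L2_nn[OF lsq_gf[of k]] g by (simp flip: fX add: to_L2_diff)
    then have "(norm (to_L2 g - X (r k)))\<^sup>2 \<le> (1/16)^k"
      by (simp add: ennreal_le_iff)
    also have "(1/16)^k = (((1/4)^k)\<^sup>2 :: real)"
      by (simp add: power2_eq_square flip: power_mult_distrib)
    finally have "norm (to_L2 g - X (r k)) \<le> (1/4)^k"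
      by (rule power2_le_imp_le) simp
    then show ?thesis by (simp add: norm_minus_commute)
  qed
  have "(\<lambda>k. X (r k) - to_L2 g) \<longlonglongrightarrow> 0"
    by (rule Lim_null_comparison[OF always_eventually[OF allI[OF le]]])
       (intro LIMSEQ_power_zero, simp)
  then have "(X \<circ> r) \<longlonglongrightarrow> to_L2 g"
    by (simp add: LIM_zero_iff o_def)
  then show "convergent X"
    using Cauchy_converges_subseq[OF X r] convergentI by blast
qed

lemma second_countable_of_dense:
  fixes D :: "'a::metric_space set"
  assumes D: "countable D" and dense: "\<And>x e. e > 0 \<Longrightarrow> \<exists>d\<in>D. dist d x < e"
  shows "\<exists>B :: 'a set set. countable B \<and> open = generate_topology B"
proof (intro exI conjI)
  let ?B = "(\<lambda>(d, n). ball d (1 / real (Suc n))) ` (D \<times> (UNIV :: nat set))"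
  show "countable ?B" using D by auto
  have "topological_basis ?B"
  proof (rule topological_basisI)
    fix U and x :: 'a
    assume "open U" "x \<in> U"
    then obtain e where e: "e > 0" "ball x e \<subseteq> U" by (auto simp: open_contains_ball)
    obtain n where n: "1 / real (Suc n) < e / 2"
      using e(1) nat_approx_posE[of "e / 2"] by auto
    obtain d where d: "d \<in> D" "dist d x < 1 / real (Suc n)"
      using dense[of "1 / real (Suc n)" x] by auto
    have "ball d (1 / real (Suc n)) \<subseteq> ball x e"
    proof
      fix y assume "y \<in> ball d (1 / real (Suc n))"
      then have "dist d y < 1 / real (Suc n)" by simp
      moreover have "dist x y \<le> dist d x + dist d y"
        using dist_triangle[of x y d] by (simp add: dist_commute)
      ultimately show "y \<in> ball x e" using d n by simp
    qed
    then show "\<exists>B'\<in>?B. x \<in> B' \<and> B' \<subseteq> U"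
      using d e by (intro bexI[of _ "ball d (1 / real (Suc n))"]) auto
  qed auto
  then show "open = generate_topology ?B" by (rule topological_basis_imp_subbasis)
qed

lemma to_L2_dominated_convergence:
  fixes f :: "real \<Rightarrow> complex" and s :: "nat \<Rightarrow> real \<Rightarrow> complex"
  assumes w: "lsq w"
    and s: "\<And>i. s i \<in> borel_measurable lborel" "\<And>i x. cmod (s i x) \<le> cmod (w x)"
    and f: "f \<in> borel_measurable lborel" and lim: "\<And>x. (\<lambda>i. s i x) \<longlonglongrightarrow> f x"
  shows "lsq f" "\<And>i. lsq (s i)" "(\<lambda>i. to_L2 (s i)) \<longlonglongrightarrow> to_L2 f"
proof -
  have fw: "cmod (f x) \<le> cmod (w x)" for x
    by (rule LIMSEQ_le_const2[OF tendsto_norm[OF lim]]) (use s(2) in auto)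
  show lf: "lsq f" using lsq_bound[OF f w fw] .
  show ls: "lsq (s i)" for i using lsq_bound[OF s(1) w s(2)] .
  have "(\<lambda>i. LINT x|lborel. (cmod (s i x - f x))\<^sup>2) \<longlonglongrightarrow> (LINT x|(lborel :: real measure). (0::real))"
  proof (rule integral_dominated_convergence[where w = "\<lambda>x. 4 * (cmod (w x))\<^sup>2"])
    show "(\<lambda>x. (cmod (s i x - f x))\<^sup>2) \<in> borel_measurable lborel" for i
      using s(1)[of i] f by measurable
    show "integrable lborel (\<lambda>x. 4 * (cmod (w x))\<^sup>2)"
      using lsq_integrable[OF w] by simp
    show "AE x in lborel. (\<lambda>i. (cmod (s i x - f x))\<^sup>2) \<longlonglongrightarrow> 0"
    proof (rule AE_I2)
      fix x
      have "(\<lambda>i. (cmod (s i x - f x))\<^sup>2) \<longlonglongrightarrow> (cmod (f x - f x))\<^sup>2"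
        by (intro tendsto_intros lim)
      then show "(\<lambda>i. (cmod (s i x - f x))\<^sup>2) \<longlonglongrightarrow> 0" by simp
    qed
    show "AE x in lborel. norm ((cmod (s i x - f x))\<^sup>2) \<le> 4 * (cmod (w x))\<^sup>2" for i
    proof (rule AE_I2)
      fix x
      have "cmod (s i x - f x) \<le> 2 * cmod (w x)"
        using norm_triangle_ineq4[of "s i x" "f x"] s(2)[of i x] fw[of x] by linarith
      then have "(cmod (s i x - f x))\<^sup>2 \<le> (2 * cmod (w x))\<^sup>2"
        by (intro power_mono) auto
      then show "norm ((cmod (s i x - f x))\<^sup>2) \<le> 4 * (cmod (w x))\<^sup>2"
        by (simp add: power_mult_distrib)
    qed
  qed simp
  then have "(\<lambda>i. sqrt (LINT x|lborel. (cmod (s i x - f x))\<^sup>2)) \<longlonglongrightarrow> sqrt 0"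
    by (intro tendsto_real_sqrt) simp
  moreover have "norm (to_L2 (s i) - to_L2 f) = sqrt (LINT x|lborel. (cmod (s i x - f x))\<^sup>2)" for i
    by (simp only: to_L2_diff[OF ls lf] norm_to_L2[OF lsq_diff[OF ls lf]])
  ultimately have "(\<lambda>i. norm (to_L2 (s i) - to_L2 f)) \<longlonglongrightarrow> 0" by simp
  then show "(\<lambda>i. to_L2 (s i)) \<longlonglongrightarrow> to_L2 f"
    using tendsto_norm_zero_iff LIM_zero_iff by blast
qed

lemma countable_Int_stable_borel_generator:
  "\<exists>E :: real set set. countable E \<and> Int_stable E \<and> UNIV \<in> E \<and> sets borel = sigma_sets UNIV E"
proof -
  obtain B :: "real set set" where B: "countable B" "topological_basis B"
    using ex_countable_basis by blast
  define E where "E = Inter ` {F. finite F \<and> F \<subseteq> B}"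
  have "countable E"
    unfolding E_def using countable_Collect_finite_subset[OF B(1)] by auto
  moreover have "Int_stable E"
    unfolding Int_stable_def E_def
  proof safe
    fix F G assume "finite F" "F \<subseteq> B" "finite G" "G \<subseteq> B"
    then show "\<Inter>F \<inter> \<Inter>G \<in> Inter ` {F. finite F \<and> F \<subseteq> B}"
      by (intro image_eqI[of _ _ "F \<union> G"]) auto
  qed
  moreover have "UNIV \<in> E"
    unfolding E_def by (rule image_eqI[of _ _ "{}"]) auto
  moreover have "sets borel = sigma_sets UNIV E"
  proof
    have BE: "B \<subseteq> E"
      unfolding E_def by (auto intro: image_eqI[of _ _ "{S}" for S])
    have "sets borel = sigma_sets UNIV B"
      using borel_eq_countable_basis[OF B] by (metis sets_measure_of top_greatest Pow_UNIV)
    then show "sets borel \<subseteq> sigma_sets UNIV E"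
      using sigma_sets_mono'[OF BE] by simp
    have "\<Inter>F \<in> sets borel" if "finite F" "F \<subseteq> B" for F
    proof -
      have "open (\<Inter>F)"
        using that topological_basis_open[OF B(2)] by (intro open_Inter) auto
      then show ?thesis by simp
    qed
    then have "E \<subseteq> sets borel" by (auto simp: E_def)
    then show "sigma_sets UNIV E \<subseteq> sets borel"
      using sets.sigma_sets_subset[of E borel] by simp
  qed
  ultimately show ?thesis by blast
qed

lemma lsq_indicator:
  assumes "A \<in> sets borel"
  shows "lsq (\<lambda>x. c * indicator (A \<inter> {- real n<..<real n}) x)"
proof -
  have A: "A \<inter> {- real n<..<real n} \<in> sets lborel" using assms by simp
  have "emeasure lborel (A \<inter> {- real n<..<real n}) \<le> emeasure lborel {- real n<..<real n}"
    by (rule emeasure_mono) auto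
  also have "\<dots> < \<infinity>" by simp
  finally have "integrable lborel (indicator (A \<inter> {- real n<..<real n}) :: real \<Rightarrow> real)"
    using A by (simp add: integrable_indicator_iff)
  then have "integrable lborel (\<lambda>x. (cmod c)\<^sup>2 * indicator (A \<inter> {- real n<..<real n}) x)"
    by (rule integrable_mult_right)
  moreover have "(cmod (c * indicator (A \<inter> {- real n<..<real n}) x))\<^sup>2
      = (cmod c)\<^sup>2 * indicator (A \<inter> {- real n<..<real n}) x" for x
    by (simp add: indicator_def)
  ultimately have "integrable lborel (\<lambda>x. (cmod (c * indicator (A \<inter> {- real n<..<real n}) x))\<^sup>2)"
    by simp
  moreover have "(\<lambda>x. c * indicator (A \<inter> {- real n<..<real n}) x) \<in> borel_measurable lborel"
    using A by (intro borel_measurable_times borel_measurable_indicator) auto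
  ultimately show ?thesis by (simp only: lsq_def simp_thms)
qed

instance L2 :: second_countable_topology
proof
  obtain E :: "real set set" where E: "countable E" "Int_stable E" "UNIV \<in> E"
    and borel_E: "sets borel = sigma_sets UNIV E"
    using countable_Int_stable_borel_generator by blast
  define T where "T A n c = to_L2 (\<lambda>x. c * indicator (A \<inter> {- real n<..<real n}) x)" for A n c
  define G where "G = (\<lambda>(A, n, c). T A n c) ` (E \<times> (UNIV :: nat set) \<times> {1, \<i>})"
  define D where "D = (\<lambda>xs. \<Sum>(q, g)\<leftarrow>xs. real_of_rat q *\<^sub>R g) ` lists (UNIV \<times> G)"
  have "countable G" unfolding G_def using E(1) by auto
  then have "countable D" unfolding D_def by (intro countable_image countable_lists) auto
  have D_ex: "\<exists>xs\<in>lists (UNIV \<times> G). x = (\<Sum>(q, g)\<leftarrow>xs. real_of_rat q *\<^sub>R g)" if "x \<in> D" for x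
    using that unfolding D_def by (rule imageE) (rule bexI)
  have D0: "0 \<in> D" unfolding D_def by (rule image_eqI[of _ _ "[]"]) auto
  have D_add: "x + y \<in> D" if xy: "x \<in> D" "y \<in> D" for x y
  proof -
    obtain xs ys where "xs \<in> lists (UNIV \<times> G)" "x = (\<Sum>(q, g)\<leftarrow>xs. real_of_rat q *\<^sub>R g)"
      "ys \<in> lists (UNIV \<times> G)" "y = (\<Sum>(q, g)\<leftarrow>ys. real_of_rat q *\<^sub>R g)"
      using D_ex[OF xy(1)] D_ex[OF xy(2)] by blast
    then show ?thesis unfolding D_def by (intro image_eqI[of _ _ "xs @ ys"]) auto
  qed
  have D_scale: "real_of_rat q *\<^sub>R x \<in> D" if x: "x \<in> D" for x q
  proof -
    obtain xs where xs: "xs \<in> lists (UNIV \<times> G)" "x = (\<Sum>(q, g)\<leftarrow>xs. real_of_rat q *\<^sub>R g)"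
      using D_ex[OF x] by blast
    have "real_of_rat q *\<^sub>R (\<Sum>(q, g)\<leftarrow>xs. real_of_rat q *\<^sub>R g)
        = (\<Sum>(q, g)\<leftarrow>map (\<lambda>(p, g). (q * p, g)) xs. real_of_rat q *\<^sub>R g)"
      by (induction xs) (auto simp: scaleR_add_right of_rat_mult)
    moreover have "map (\<lambda>(p, g). (q * p, g)) xs \<in> lists (UNIV \<times> G)"
      using xs(1) by auto
    ultimately show ?thesis unfolding D_def xs(2) by (rule image_eqI)
  qed
  have GD: "g \<in> D" if "g \<in> G" for g
    unfolding D_def by (rule image_eqI[of _ _ "[(1, g)]"]) (use that in auto)
  let ?C = "closure D"
  have C_add: "x + y \<in> ?C" if xy: "x \<in> ?C" "y \<in> ?C" for x y
  proof -
    obtain u v where "\<And>n. u n \<in> D" "u \<longlonglongrightarrow> x" "\<And>n. v n \<in> D" "v \<longlonglongrightarrow> y"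
      using xy unfolding closure_sequential by blast
    then show ?thesis
      unfolding closure_sequential
      by (intro exI[of _ "\<lambda>n. u n + v n"]) (auto intro: D_add tendsto_add)
  qed
  have C_scale: "r *\<^sub>R x \<in> ?C" if x: "x \<in> ?C" for x r
  proof -
    obtain u where u: "\<And>n. u n \<in> D" "u \<longlonglongrightarrow> x"
      using x unfolding closure_sequential by blast
    have "r \<in> closure \<rat>" by (simp add: Rats_closure_real)
    then obtain q where q: "\<And>n. q n \<in> \<rat>" "q \<longlonglongrightarrow> r"
      unfolding closure_sequential by blast
    have "q n *\<^sub>R u n \<in> D" for n
      using q(1)[of n] D_scale[OF u(1)] by (auto elim!: Rats_cases)
    moreover have "(\<lambda>n. q n *\<^sub>R u n) \<longlonglongrightarrow> r *\<^sub>R x"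
      by (intro tendsto_scaleR q u)
    ultimately show ?thesis
      unfolding closure_sequential by (intro exI[of _ "\<lambda>n. q n *\<^sub>R u n"]) simp
  qed
  have C_lim: "x \<in> ?C" if "\<And>n. u n \<in> ?C" "u \<longlonglongrightarrow> x" for u x
    using closed_sequentially[OF closed_closure that] .
  have C0: "0 \<in> ?C" using D0 closure_subset by blast
  have T_C: "T A n c \<in> ?C" if A: "A \<in> sets borel" and c: "c \<in> {1, \<i>}" for A n c
  proof -
    have "E \<subseteq> Pow UNIV" "A \<in> sigma_sets UNIV E" using A borel_E by simp_all
    with E(2) show ?thesis
    proof (induction A rule: sigma_sets_induct_disjoint)
      case (basic A)
      then have "T A n c \<in> G" unfolding G_def using c by (auto intro!: image_eqI[of _ _ "(A, n, c)"])
      then show ?case using GD closure_subset by blast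
    next
      case empty
      then show ?case by (simp add: T_def C0)
    next
      case (compl A)
      have A: "A \<in> sets borel" using compl borel_E by simp
      have U: "(UNIV :: real set) \<in> sets borel" by simp
      have "T UNIV n c - T A n c = T (UNIV - A) n c"
        unfolding T_def to_L2_diff[OF lsq_indicator[OF U] lsq_indicator[OF A]]
        by (rule arg_cong[where f = to_L2]) (auto simp: indicator_def fun_eq_iff)
      then have "T (UNIV - A) n c = T UNIV n c + (-1) *\<^sub>R T A n c" by simp
      moreover have "T UNIV n c \<in> ?C"
      proof -
        have "T UNIV n c \<in> G"
          unfolding G_def using c E(3) by (auto intro!: image_eqI[of _ _ "(UNIV, n, c)"])
        then show ?thesis using GD closure_subset by blast
      qed
      ultimately show ?case using C_add C_scale compl.IH by metis
    next
      case (union A)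
      have A: "A i \<in> sets borel" for i using union borel_E by auto
      have UA: "(\<Union>i<k. A i) \<in> sets borel" for k using A by auto
      have fin: "T (\<Union>i<k. A i) n c \<in> ?C" for k
      proof (induction k)
        case 0
        then show ?case by (simp add: T_def C0)
      next
        case (Suc k)
        have "A i \<inter> A k = {}" if "i < k" for i
          using disjoint_family_onD[OF union(1), of i k] that by simp
        then have disj: "(\<Union>i<k. A i) \<inter> A k = {}" by blast
        have "T (\<Union>i<Suc k. A i) n c = T (\<Union>i<k. A i) n c + T (A k) n c"
          unfolding T_def to_L2_add[OF lsq_indicator[OF UA] lsq_indicator[OF A]]
          by (rule arg_cong[where f = to_L2])
             (use disj in \<open>auto simp: indicator_def fun_eq_iff lessThan_Suc\<close>)
        then show ?case using C_add Suc union by simp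
      qed
      have "(\<lambda>k. T (\<Union>i<k. A i) n c) \<longlonglongrightarrow> T (\<Union>i. A i) n c"
        unfolding T_def
      proof (rule to_L2_dominated_convergence(3)[OF lsq_indicator[of UNIV]])
        show "(\<lambda>x. c * indicator ((\<Union>i<k. A i) \<inter> {- real n<..<real n}) x) \<in> borel_measurable lborel" for k
          by (rule lsq_measurable[OF lsq_indicator[OF UA]])
        have "(\<Union>i. A i) \<in> sets borel" using A by auto
        then show "(\<lambda>x. c * indicator ((\<Union>i. A i) \<inter> {- real n<..<real n}) x) \<in> borel_measurable lborel"
          by (rule lsq_measurable[OF lsq_indicator])
        show "cmod (c * indicator ((\<Union>i<k. A i) \<inter> {- real n<..<real n}) x)
            \<le> cmod (c * indicator (UNIV \<inter> {- real n<..<real n}) x)" for k x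
          by (auto simp: indicator_def)
        fix x
        show "(\<lambda>k. c * indicator ((\<Union>i<k. A i) \<inter> {- real n<..<real n}) x)
            \<longlonglongrightarrow> c * indicator ((\<Union>i. A i) \<inter> {- real n<..<real n}) x"
        proof (cases "x \<in> (\<Union>i. A i)")
          case True
          then obtain i where i: "x \<in> A i" by blast
          show ?thesis
            by (rule tendsto_eventually, rule eventually_mono[OF eventually_gt_at_top[of i]])
               (use i in \<open>auto simp: indicator_def\<close>)
        next
          case False
          then show ?thesis by (simp add: indicator_def)
        qed
      qed simp
      then show ?case using C_lim[of "\<lambda>k. T (\<Union>i<k. A i) n c"] fin by blast
    qed
  qed
  have T_C': "T A n c \<in> ?C" if A: "A \<in> sets borel" for A n c
  proof -
    have "T A n c = Re c *\<^sub>R T A n 1 + Im c *\<^sub>R T A n \<i>"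
      unfolding T_def to_L2_scaleR[OF lsq_indicator[OF A]]
        to_L2_add[OF lsq_cmult[OF lsq_indicator[OF A]] lsq_cmult[OF lsq_indicator[OF A]]]
      by (rule arg_cong[where f = to_L2])
         (auto simp: indicator_def fun_eq_iff complex_eq_iff)
    then show ?thesis using C_add C_scale T_C[OF A] by simp
  qed
  have all: "to_L2 f \<in> ?C" if f: "lsq f" for f
  proof -
    obtain s where s: "\<And>i. simple_function lborel (s i)" "\<And>x. (\<lambda>i. s i x) \<longlonglongrightarrow> f x"
      "\<And>i x. cmod (s i x) \<le> 2 * cmod (f x)"
      using borel_measurable_implies_sequence_metric[OF lsq_measurable[OF f], of 0] by auto
    define I where "I n = {- real n<..<real n}" for n
    define s' where "s' i x = s i x * indicator (I i) x" for i x
    have s_meas: "s i \<in> borel_measurable lborel" for i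
      by (rule borel_measurable_simple_function[OF s(1)])
    have s'_meas: "s' i \<in> borel_measurable lborel" for i
      unfolding s'_def I_def using s_meas by measurable
    have "to_L2 (s' i) \<in> ?C" for i
    proof -
      have fin: "finite (range (s i))"
        using simple_functionD(1)[OF s(1)[of i]] by simp
      have A: "s i -` {y} \<in> sets borel" for y
        using simple_functionD(2)[OF s(1)[of i], of "{y}"] by simp
      have "lsq (\<lambda>x. \<Sum>y\<in>Y. y * indicator (s i -` {y} \<inter> I i) x) \<and>
          to_L2 (\<lambda>x. \<Sum>y\<in>Y. y * indicator (s i -` {y} \<inter> I i) x) \<in> ?C" if "finite Y" for Y
        using that
      proof induction
        case empty
        then show ?case by (simp add: C0)
      next
        case (insert y Y)
        have l: "lsq (\<lambda>x. y * indicator (s i -` {y} \<inter> I i) x)"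
          unfolding I_def by (rule lsq_indicator[OF A])
        have t: "to_L2 (\<lambda>x. y * indicator (s i -` {y} \<inter> I i) x) \<in> ?C"
          using T_C'[OF A] unfolding I_def T_def .
        have IH: "lsq (\<lambda>x. \<Sum>y\<in>Y. y * indicator (s i -` {y} \<inter> I i) x)"
          "to_L2 (\<lambda>x. \<Sum>y\<in>Y. y * indicator (s i -` {y} \<inter> I i) x) \<in> ?C"
          using insert.IH by blast+
        show ?case
          unfolding sum.insert[OF insert.hyps] to_L2_add[OF l IH(1), symmetric]
          using lsq_add[OF l IH(1)] C_add[OF t IH(2)] by blast
      qed
      from this[OF fin] have "to_L2 (\<lambda>x. \<Sum>y\<in>range (s i). y * indicator (s i -` {y} \<inter> I i) x) \<in> ?C"
        by simp
      moreover have "(\<Sum>y\<in>range (s i). y * indicator (s i -` {y} \<inter> I i) x) = s' i x" for x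
      proof -
        have "(\<Sum>y\<in>range (s i). y * indicator (s i -` {y} \<inter> I i) x)
            = (\<Sum>y\<in>range (s i). if y = s i x then s' i x else 0)"
          by (rule sum.cong) (auto simp: s'_def indicator_def)
        then show ?thesis using fin by simp
      qed
      ultimately show ?thesis by simp
    qed
    moreover have "(\<lambda>i. to_L2 (s' i)) \<longlonglongrightarrow> to_L2 f"
    proof (rule to_L2_dominated_convergence(3)[OF lsq_cmult[OF f, of 2]])
      show "cmod (s' i x) \<le> cmod (2 * f x)" for i x
        using s(3)[of i x] by (auto simp: s'_def indicator_def norm_mult)
      show "(\<lambda>i. s' i x) \<longlonglongrightarrow> f x" for x
      proof (rule Lim_transform_eventually[OF s(2)])
        obtain n where "\<bar>x\<bar> < real n" using reals_Archimedean2 by blast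
        then show "\<forall>\<^sub>F i in sequentially. s i x = s' i x"
          by (intro eventually_mono[OF eventually_ge_at_top[of n]])
             (auto simp: s'_def I_def indicator_def)
      qed
    qed (rule s'_meas lsq_measurable[OF f])+
    ultimately show ?thesis using C_lim[of "\<lambda>i. to_L2 (s' i)"] by blast
  qed
  have "\<exists>d\<in>D. dist d x < e" if "e > 0" for x e
    using all[of "rep_L2 x"] that by (auto simp: closure_approachable)
  then show "\<exists>B :: L2 set set. countable B \<and> open = generate_topology B"
    by (rule second_countable_of_dense[OF \<open>countable D\<close>])
qed

lift_definition scaleC_L2 :: "complex \<Rightarrow> L2 \<Rightarrow> L2" is "\<lambda>c f x. c * f x"
  by (auto intro: lsq_cmult)

section \<open>Function spaces and the free propagator\<close>

definition L1_norm :: "(real \<Rightarrow> complex) \<Rightarrow> real" where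
  "L1_norm f = (LINT x|lborel. cmod (f x))"

definition Linf_norm :: "(real \<Rightarrow> complex) \<Rightarrow> ennreal" where
  "Linf_norm f = esssup lborel (\<lambda>x. ennreal (cmod (f x)))"

text \<open>
  The unitary Fourier--Plancherel transform, as the \<open>L\<^sup>2\<close>-limit of the transforms of the truncations
  of \<open>f\<close> to \<open>[-n, n]\<close> (which are integrable).
\<close>

definition fourier_L2 :: "L2 \<Rightarrow> L2" where
  "fourier_L2 f = lim (\<lambda>n::nat. to_L2 (\<lambda>\<xi>.
     complex_of_real (1 / sqrt (2 * pi)) *
     (LINT x:{- real n..real n}|lborel. exp (- \<i> * complex_of_real (x * \<xi>)) * rep_L2 f x)))"

text \<open>Only used for bounded measurable symbols; \<open>THE\<close> inverts the Fourier transform.\<close>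

definition fourier_multiplier :: "(real \<Rightarrow> complex) \<Rightarrow> L2 \<Rightarrow> L2" where
  "fourier_multiplier m f =
     (THE g. fourier_L2 g = to_L2 (\<lambda>\<xi>. m \<xi> * rep_L2 (fourier_L2 f) \<xi>))"

definition schroedinger :: "real \<Rightarrow> L2 \<Rightarrow> L2" where
  "schroedinger t = fourier_multiplier (\<lambda>\<xi>. exp (- \<i> * complex_of_real (t * \<xi>\<^sup>2)))"

text \<open>
  The Sobolev space \<open>H\<^sup>1\<close> through the weight \<open>(1 + \<xi>\<^sup>2)\<^sup>1\<^sup>/\<^sup>2\<close>. Since the Fourier transform above is
  unitary, \<open>H1_norm a\<close> is the square root of \<open>\<parallel>a\<parallel>\<^sup>2 + \<parallel>a'\<parallel>\<^sup>2\<close> (norms in \<open>L\<^sup>2\<close>, weak derivative).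
\<close>

definition H1_weighted :: "(real \<Rightarrow> complex) \<Rightarrow> real \<Rightarrow> complex" where
  "H1_weighted a \<xi> = complex_of_real (sqrt (1 + \<xi>\<^sup>2)) * rep_L2 (fourier_L2 (to_L2 a)) \<xi>"

definition in_H1 :: "(real \<Rightarrow> complex) \<Rightarrow> bool" where
  "in_H1 a \<longleftrightarrow> lsq a \<and> lsq (H1_weighted a)"

definition H1_norm :: "(real \<Rightarrow> complex) \<Rightarrow> real" where
  "H1_norm a = norm (to_L2 (H1_weighted a))"

definition L1_H1 :: "(real \<Rightarrow> complex) set" where
  "L1_H1 = {a. integrable lborel a \<and> in_H1 a}"

definition L1_H1_norm :: "(real \<Rightarrow> complex) \<Rightarrow> real" where
  "L1_H1_norm a = L1_norm a + H1_norm a"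

section \<open>The nonlinear equation and its scattering map\<close>

definition cubic :: "(real \<Rightarrow> complex) \<Rightarrow> L2 \<Rightarrow> L2" where
  "cubic a v = to_L2 (\<lambda>x. a x * complex_of_real ((cmod (rep_L2 v x))\<^sup>2) * rep_L2 v x)"

text \<open>
  Global Duhamel solutions of \<open>i u\<^sub>t = - u\<^sub>x\<^sub>x + a |u|\<^sup>2 u\<close>, \<open>u(0) = u\<^sub>0\<close>, in \<open>C\<^sub>t L\<^sup>2\<^sub>x \<inter> L\<^sup>4\<^sub>t L\<^sup>\<infinity>\<^sub>x\<close>. The
  Duhamel integral is a Bochner integral in \<open>L\<^sup>2\<close>. This is the right reading for bounded \<open>a\<close>, in
  particular for \<open>a\<close> in \<open>H\<^sup>1\<close>: as \<open>u(s)\<close> is bounded for almost every \<open>s\<close>, \<open>a |u|\<^sup>2 u(s)\<close> is then in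
  \<open>L\<^sup>2\<close> for almost every \<open>s\<close>, with locally integrable norm. (For merely integrable \<open>a\<close> it need not
  be in \<open>L\<^sup>2\<close>.)
\<close>

definition nls_solution :: "(real \<Rightarrow> complex) \<Rightarrow> L2 \<Rightarrow> (real \<Rightarrow> L2) \<Rightarrow> bool" where
  "nls_solution a u0 u \<longleftrightarrow>
     continuous_on UNIV u \<and>
     (\<integral>\<^sup>+t. (Linf_norm (rep_L2 (u t))) ^ 4 \<partial>lborel) < \<infinity> \<and>
     (\<forall>t. interval_lebesgue_integrable lborel 0 (ereal t)
            (\<lambda>s. schroedinger (t - s) (cubic a (u s))) \<and>
          u t = schroedinger t u0 -
            scaleC_L2 \<i> (LBINT s=0..ereal t. schroedinger (t - s) (cubic a (u s))))"

definition nls_flow :: "(real \<Rightarrow> complex) \<Rightarrow> L2 \<Rightarrow> real \<Rightarrow> L2" where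
  "nls_flow a u0 = (THE u. nls_solution a u0 u)"

text \<open>
  A total function; it is the scattering map on small balls \<open>ball 0 \<eta>\<close>, where the global solution
  and its scattering state exist and are unique.
\<close>

definition scattering_map :: "(real \<Rightarrow> complex) \<Rightarrow> L2 \<Rightarrow> L2" where
  "scattering_map a u0 =
     (THE u_plus. ((\<lambda>t. norm (nls_flow a u0 t - schroedinger t u_plus)) \<longlongrightarrow> 0) at_top)"

definition scattering_dist :: "real \<Rightarrow> (real \<Rightarrow> complex) \<Rightarrow> (real \<Rightarrow> complex) \<Rightarrow> ennreal" where
  "scattering_dist \<eta> a b =
     (SUP \<phi>\<in>ball 0 \<eta> - {0}.
        ennreal (norm (scattering_map a \<phi> - scattering_map b \<phi>) / norm \<phi>))"

end

theory Submission
  imports Defs "HOL-Probability.Probability"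
begin

text \<open>
  The maps are tested on the Gaussian packets \<open>\<phi>\<close> of amplitude one and width \<open>\<sigma> = \<surd>\<tau>\<close> centred at \<open>x\<^sub>0\<close>. Their
  free evolution \<open>v(t)\<close> is explicit and satisfies \<open>\<bar>v(t)\<bar> \<lesssim> (\<tau> / (\<tau> + \<bar>t\<bar>))\<^sup>1\<^sup>/\<^sup>2\<close>. Together with the dispersive
  estimate this decay closes a Picard iteration in a weighted \<open>L\<^sup>\<infinity>\<close> space without Strichartz estimates, as soon
  as \<open>\<sigma> \<parallel>a\<parallel>\<^sub>1\<close> is small, and it shows that the Born approximation
  \<open>\<langle>S\<^sub>a \<phi> - \<phi>, \<phi>\<rangle> = - \<i> \<integral>\<^sub>0\<^sup>\<infinity> \<integral> a \<bar>v\<bar>\<^sup>4 dx dt\<close> holds up to \<open>O(\<parallel>a\<parallel>\<^sub>1\<^sup>2 \<sigma>\<^sup>3)\<close>. For fixed \<open>t\<close>, \<open>\<bar>v(t)\<bar>\<^sup>4\<close> is a Gaussian of width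
  about \<open>\<sigma> + \<bar>t\<bar> / \<sigma>\<close>; since \<open>c = a - b\<close> is Hoelder continuous, the times \<open>\<tau> < t < \<sigma>\<close> contribute
  \<open>c(x\<^sub>0) \<sigma>\<^sup>3 ln (1 / \<sigma>)\<close>, and all errors are \<open>O(\<sigma>\<^sup>3)\<close>. Hence \<open>\<bar>c(x\<^sub>0)\<bar> ln (1 / \<tau>) \<lesssim> 1 + \<parallel>S\<^sub>a - S\<^sub>b\<parallel> / \<tau>\<close>, and one
  chooses \<open>\<tau> = \<parallel>S\<^sub>a - S\<^sub>b\<parallel>\<close>, or lets \<open>\<tau>\<close> tend to \<open>0\<close> if the maps agree.
\<close>

section \<open>The space of square integrable functions\<close>

text \<open>The packets have squared norm of order \<open>\<tau>^(1/2)\<close>, so maps at distance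
  \<open>D\<close> change the pairing by \<open>D \<tau>^(1/2)\<close>; this stays below the errors
  \<open>\<tau>^(3/2)\<close> as long as \<open>D \<le> \<tau>\<close>. The gain over these errors
  is a logarithm because the mass of \<open>|v(s)|^4\<close> is comparable to
  \<open>\<tau>^(3/2) / s\<close> between \<open>\<tau>\<close> and \<open>\<tau>^(1/2)\<close>. At
  the upper end the packet has width of order one: before it the oscillation of \<open>c\<close>
  across the packet is an integrable error, after it the L1 norm of \<open>c\<close> and the decay
  of \<open>|v|^4\<close> take over. The scattering map is built from definite descriptions. Testing
  it requires existence and uniqueness of the flow in the whole solution class, where a competitor
  obeys no weighted bound, and uniqueness of the asymptotic state. Existence comes from the
  contraction, uniqueness from a Gronwall argument in L2. The coefficients are complex while the
  inner product on \<open>L2\<close> is real; pairing with unimodular multiples of the packet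
  recovers real and imaginary parts.\<close>

lemma inner_to_L2:
  "lsq f \<Longrightarrow> lsq g \<Longrightarrow> inner (to_L2 f) (to_L2 g) = (LINT x|lborel. inner (f x) (g x))"
  by (simp add: to_L2_def inner_L2.abs_eq)

lemma norm_to_L2_sq: "lsq f \<Longrightarrow> (norm (to_L2 f))\<^sup>2 = (LINT x|lborel. (cmod (f x))\<^sup>2)"
  by (simp add: norm_to_L2)

lemma to_L2_eqI: "lsq f \<Longrightarrow> lsq g \<Longrightarrow> AE x in lborel. f x = g x \<Longrightarrow> to_L2 f = to_L2 g"
  by (simp add: to_L2_eq_iff)

lemma L2_cases: obtains f where "lsq f" "x = to_L2 f"
  using lsq_rep_L2 to_L2_rep by metis

lemma rep_L2_measurable [measurable]: "rep_L2 x \<in> borel_measurable borel"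
  using lsq_measurable[OF lsq_rep_L2[of x]] by simp

lemma borel_measurable_cnj [measurable (raw)]:
  "f \<in> borel_measurable M \<Longrightarrow> (\<lambda>x. cnj (f x)) \<in> borel_measurable M"
  by (erule measurable_compose) (intro borel_measurable_continuous_onI continuous_intros)

text \<open>Bounded multipliers on classes cover Fourier multipliers, complex scalars (constant
  symbol) and regularized symbols, so that continuity, adjoints and composition are proved
  once.\<close>

definition L2_mult :: "(real \<Rightarrow> complex) \<Rightarrow> L2 \<Rightarrow> L2" where
  "L2_mult m x = to_L2 (\<lambda>\<xi>. m \<xi> * rep_L2 x \<xi>)"

lemma lsq_mult:
  assumes "m \<in> borel_measurable borel" "\<And>x. cmod (m x) \<le> B" "lsq f"
  shows "lsq (\<lambda>x. m x * f x)"
proof (rule lsq_bound)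
  note [measurable] = assms(1) lsq_measurable[OF assms(3)]
  show "(\<lambda>x. m x * f x) \<in> borel_measurable lborel" by measurable
  show "lsq (\<lambda>x. of_real B * f x)" by (rule lsq_cmult[OF assms(3)])
  fix x
  have "0 \<le> B" using assms(2)[of 0] norm_ge_zero order_trans by blast
  then show "cmod (m x * f x) \<le> cmod (of_real B * f x)"
    using assms(2)[of x] by (simp add: norm_mult mult_right_mono)
qed

lemma L2_mult_to_L2:
  assumes "m \<in> borel_measurable borel" "\<And>x. cmod (m x) \<le> B" "lsq f"
  shows "L2_mult m (to_L2 f) = to_L2 (\<lambda>x. m x * f x)"
  unfolding L2_mult_def
  by (rule to_L2_eqI) (use lsq_mult[OF assms(1,2)] assms rep_to_L2[OF assms(3)] in auto)

lemma L2_mult_add: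
  assumes "m \<in> borel_measurable borel" "\<And>x. cmod (m x) \<le> B"
  shows "L2_mult m (x + y) = L2_mult m x + L2_mult m y"
proof -
  obtain f g where f: "lsq f" "x = to_L2 f" "lsq g" "y = to_L2 g" by (meson L2_cases)
  show ?thesis
    by (simp add: f to_L2_add lsq_add L2_mult_to_L2[OF assms] lsq_mult[OF assms] distrib_left)
qed

lemma L2_mult_scaleR:
  assumes "m \<in> borel_measurable borel" "\<And>x. cmod (m x) \<le> B"
  shows "L2_mult m (r *\<^sub>R x) = r *\<^sub>R L2_mult m x"
proof -
  obtain f where f: "lsq f" "x = to_L2 f" by (meson L2_cases)
  show ?thesis
    by (simp add: f to_L2_scaleR L2_mult_to_L2[OF assms] lsq_cmult lsq_mult[OF assms] mult.left_commute)
qed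

lemma L2_mult_norm_le:
  assumes "m \<in> borel_measurable borel" "\<And>x. cmod (m x) \<le> B"
  shows "norm (L2_mult m x) \<le> B * norm x"
proof -
  obtain f where f: "lsq f" "x = to_L2 f" by (meson L2_cases)
  have B: "0 \<le> B" using assms(2)[of 0] norm_ge_zero order_trans by blast
  have "(norm (L2_mult m x))\<^sup>2 = (LINT x|lborel. (cmod (m x * f x))\<^sup>2)"
    by (simp add: f L2_mult_to_L2[OF assms] norm_to_L2_sq lsq_mult[OF assms])
  also have "\<dots> \<le> (LINT x|lborel. B\<^sup>2 * (cmod (f x))\<^sup>2)"
    using f(1) lsq_mult[OF assms f(1)] assms(2)
    by (intro integral_mono) (auto intro!: mult_right_mono power_mono simp: lsq_def norm_mult power_mult_distrib)
  also have "\<dots> = (B * norm x)\<^sup>2" using f by (simp add: norm_to_L2_sq power_mult_distrib)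
  finally show ?thesis by (rule power2_le_imp_le) (use B in simp)
qed

lemma L2_mult_norm_eq:
  assumes "m \<in> borel_measurable borel" "\<And>x. cmod (m x) = B"
  shows "norm (L2_mult m x) = B * norm x"
proof -
  obtain f where f: "lsq f" "x = to_L2 f" by (meson L2_cases)
  have B: "0 \<le> B" using assms(2)[of 0] norm_ge_zero by metis
  have m: "cmod (m x) \<le> B" for x using assms by simp
  have "(norm (L2_mult m x))\<^sup>2 = (LINT x|lborel. (cmod (m x * f x))\<^sup>2)"
    by (simp add: f L2_mult_to_L2[OF assms(1) m] norm_to_L2_sq lsq_mult[OF assms(1) m])
  also have "\<dots> = (B * norm x)\<^sup>2" using f assms(2) by (simp add: norm_to_L2_sq power_mult_distrib norm_mult)
  finally show ?thesis by (rule power2_eq_imp_eq) (use B in auto)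
qed

lemma bounded_linear_L2_mult:
  assumes "m \<in> borel_measurable borel" "\<And>x. cmod (m x) \<le> B"
  shows "bounded_linear (L2_mult m)"
  by (rule bounded_linear_intro[where K = B])
     (use L2_mult_add[OF assms] L2_mult_scaleR[OF assms] L2_mult_norm_le[OF assms] in \<open>auto simp: mult.commute\<close>)

lemma L2_mult_L2_mult:
  assumes "m \<in> borel_measurable borel" "\<And>x. cmod (m x) \<le> B"
    "n \<in> borel_measurable borel" "\<And>x. cmod (n x) \<le> B'"
  shows "L2_mult m (L2_mult n x) = L2_mult (\<lambda>\<xi>. m \<xi> * n \<xi>) x"
proof -
  obtain f where f: "lsq f" "x = to_L2 f" by (meson L2_cases)
  have mn: "(\<lambda>\<xi>. m \<xi> * n \<xi>) \<in> borel_measurable borel" using assms(1,3) by measurable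
  have b: "cmod (m x * n x) \<le> B * B'" for x
    unfolding norm_mult using assms(2,4)[of x] norm_ge_zero order_trans by (intro mult_mono) blast+
  show ?thesis
    by (simp add: f L2_mult_to_L2[OF assms(1,2)] L2_mult_to_L2[OF assms(3,4)] L2_mult_to_L2[OF mn b]
        lsq_mult[OF assms(3,4)] mult.assoc)
qed

lemma L2_mult_one: "L2_mult (\<lambda>\<xi>. 1) x = x"
  by (simp add: L2_mult_def)

lemma scaleC_L2_eq: "scaleC_L2 c x = L2_mult (\<lambda>\<xi>. c) x"
proof -
  obtain f where f: "lsq f" "x = to_L2 f" by (meson L2_cases)
  have "scaleC_L2 c x = to_L2 (\<lambda>x. c * f x)"
    using f by (simp add: to_L2_def scaleC_L2.abs_eq lsq_cmult)
  then show ?thesis using L2_mult_to_L2[of "\<lambda>_. c" "cmod c" f] f by simp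
qed

lemma L2_mult_inner:
  assumes "m \<in> borel_measurable borel" "\<And>x. cmod (m x) \<le> B"
  shows "inner (L2_mult m x) y = inner x (L2_mult (\<lambda>\<xi>. cnj (m \<xi>)) y)"
proof -
  obtain f g where f: "lsq f" "x = to_L2 f" "lsq g" "y = to_L2 g" by (meson L2_cases)
  have m: "(\<lambda>x. cnj (m x)) \<in> borel_measurable borel" "\<And>x. cmod (cnj (m x)) \<le> B"
    using assms by (auto intro: borel_measurable_cnj)
  have "inner (a * u) v = inner u (cnj a * v)" for a u v :: complex
    by (simp add: inner_complex_def algebra_simps)
  then show ?thesis
    by (simp add: f L2_mult_to_L2[OF assms] L2_mult_to_L2[OF m] inner_to_L2 lsq_mult[OF assms] lsq_mult[OF m])
qed

text \<open>Dominated convergence: a common bound and pointwise convergence of the symbols give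
  strong convergence of the operators. This yields time continuity of the free flow and removes the
  heat regularization.\<close>

lemma L2_mult_tendsto:
  fixes m :: "nat \<Rightarrow> real \<Rightarrow> complex"
  assumes m: "\<And>n. m n \<in> borel_measurable borel" "\<And>n x. cmod (m n x) \<le> B"
    and l: "l \<in> borel_measurable borel" "\<And>x. (\<lambda>n. m n x) \<longlonglongrightarrow> l x"
  shows "(\<lambda>n. L2_mult (m n) x) \<longlonglongrightarrow> L2_mult l x"
proof -
  obtain f where f: "lsq f" "x = to_L2 f" by (meson L2_cases)
  have fm [measurable]: "f \<in> borel_measurable borel" using lsq_measurable[OF f(1)] by simp
  have B: "0 \<le> B" using m(2)[of 0 0] norm_ge_zero order_trans by blast
  have lB: "cmod (l x) \<le> B" for x
    by (rule LIMSEQ_le_const2[OF tendsto_norm[OF l(2)]]) (use m(2) in auto)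
  have "(\<lambda>n. to_L2 (\<lambda>x. m n x * f x)) \<longlonglongrightarrow> to_L2 (\<lambda>x. l x * f x)"
  proof (rule to_L2_dominated_convergence(3)[OF lsq_cmult[OF f(1), of "of_real B"]])
    show "(\<lambda>x. m n x * f x) \<in> borel_measurable lborel" for n using m(1)[of n] by measurable
    show "(\<lambda>x. l x * f x) \<in> borel_measurable lborel" using l by measurable
    show "cmod (m n x * f x) \<le> cmod (of_real B * f x)" for n x
      using m(2)[of n x] B by (simp add: norm_mult mult_right_mono)
    show "(\<lambda>n. m n x * f x) \<longlonglongrightarrow> l x * f x" for x by (intro tendsto_intros l)
  qed
  then show ?thesis by (simp add: f L2_mult_to_L2[OF m(1,2)] L2_mult_to_L2[OF l(1) lB])
qed

text \<open>Two cases matter: \<open>c = 1\<close> gives translations, and \<open>t = 0\<close>,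
  \<open>c = -1\<close> gives the reflection that turns the Fourier transform into its
  inverse.\<close>

definition L2_affine :: "real \<Rightarrow> real \<Rightarrow> L2 \<Rightarrow> L2" where
  "L2_affine t c x = to_L2 (\<lambda>s. rep_L2 x (t + c * s))"

lemma lsq_affine:
  assumes "c \<noteq> 0" "lsq f"
  shows "lsq (\<lambda>s. f (t + c * s))"
proof -
  have [measurable]: "f \<in> borel_measurable borel" using lsq_measurable[OF assms(2)] by simp
  have "integrable lborel (\<lambda>s. (cmod (f (t + c * s)))\<^sup>2)"
    using lborel_integrable_real_affine[OF lsq_integrable[OF assms(2)] assms(1)] by simp
  then show ?thesis by (simp add: lsq_def)
qed

lemma L2_affine_to_L2:
  assumes "c \<noteq> 0" "lsq f"
  shows "L2_affine t c (to_L2 f) = to_L2 (\<lambda>s. f (t + c * s))"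
proof -
  have [measurable]: "f \<in> borel_measurable borel" using lsq_measurable[OF assms(2)] by simp
  have "AE x in lborel. rep_L2 (to_L2 f) (t + c * x) = f (t + c * x)"
    by (rule AE_borel_affine[OF assms(1) _ rep_to_L2[OF assms(2)]]) measurable
  then show ?thesis unfolding L2_affine_def by (intro to_L2_eqI lsq_affine assms lsq_rep_L2)
qed

lemma L2_affine_add:
  assumes "c \<noteq> 0" shows "L2_affine t c (x + y) = L2_affine t c x + L2_affine t c y"
proof -
  obtain f g where f: "lsq f" "x = to_L2 f" "lsq g" "y = to_L2 g" by (meson L2_cases)
  show ?thesis by (simp add: f to_L2_add lsq_add L2_affine_to_L2 lsq_affine assms)
qed

lemma L2_affine_scaleR:
  assumes "c \<noteq> 0" shows "L2_affine t c (r *\<^sub>R x) = r *\<^sub>R L2_affine t c x"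
proof -
  obtain f where f: "lsq f" "x = to_L2 f" by (meson L2_cases)
  show ?thesis by (simp add: f to_L2_scaleR lsq_cmult L2_affine_to_L2 lsq_affine assms)
qed

lemma L2_affine_inner:
  assumes "\<bar>c\<bar> = 1"
  shows "inner (L2_affine t c x) (L2_affine t c y) = inner x y"
proof -
  obtain f g where f: "lsq f" "x = to_L2 f" "lsq g" "y = to_L2 g" by (meson L2_cases)
  have c: "c \<noteq> 0" using assms by auto
  show ?thesis
    using lborel_integral_real_affine[OF c, of "\<lambda>x. inner (f x) (g x)" t] assms
    by (simp add: f L2_affine_to_L2 c inner_to_L2 lsq_affine)
qed

lemma L2_affine_norm: "\<bar>c\<bar> = 1 \<Longrightarrow> norm (L2_affine t c x) = norm x"
  by (simp add: norm_eq_sqrt_inner L2_affine_inner)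

lemma L2_affine_diff:
  assumes "c \<noteq> 0" shows "L2_affine t c (x - y) = L2_affine t c x - L2_affine t c y"
  using L2_affine_add[OF assms, of t "x - y" y] by simp

lemma lsq_indicator_Ioo: "lsq (\<lambda>x. c * indicator {a<..<b} x)" for a b :: real
proof -
  obtain n :: nat where n: "\<bar>a\<bar> + \<bar>b\<bar> < real n" using reals_Archimedean2 by blast
  have "{a<..<b} \<inter> {- real n<..<real n} = {a<..<b}" using n by auto
  then show ?thesis using lsq_indicator[of "{a<..<b}" c n] by simp
qed

text \<open>Dynkin's pi-lambda theorem carries \<open>P\<close> from intervals to bounded Borel
  sets, closure under sums to simple functions, and dominated convergence to all classes.\<close>

lemma L2_induct [consumes 0, case_names add lim interval]:
  assumes P_add: "\<And>x y. P x \<Longrightarrow> P y \<Longrightarrow> P (x + y)"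
    and P_lim: "\<And>u x. (\<And>n::nat. P (u n)) \<Longrightarrow> u \<longlonglongrightarrow> x \<Longrightarrow> P x"
    and P_box: "\<And>c a b. P (to_L2 (\<lambda>x. c * indicator {a<..<b} x))"
  shows "P x"
proof -
  define T where "T A n c = to_L2 (\<lambda>x. c * indicator (A \<inter> {- real n<..<real n}) x)" for A n c
  have P0: "P 0" using P_box[of 0 0 0] by simp
  let ?E = "range (\<lambda>(a, b). {a<..<b :: real})"
  have borel_E: "sets borel = sigma_sets UNIV ?E"
    unfolding borel_eq_box box_real by (simp add: sets_measure_of)
  have Pow_E: "?E \<subseteq> Pow UNIV" by simp
  have "Int_stable ?E"
    unfolding Int_stable_def by (auto simp: image_iff)
  have PT: "P (T A n c)" if "A \<in> sets borel" for A n c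
    using \<open>Int_stable ?E\<close> Pow_E that[unfolded borel_E]
  proof (induction arbitrary: c rule: sigma_sets_induct_disjoint)
    case (basic A)
    then obtain a b where "A = {a<..<b}" by auto
    then show ?case using P_box[of c "max a (- real n)" "min b (real n)"] by (simp add: T_def Int_greaterThanLessThan)
  next
    case empty
    then show ?case by (simp add: T_def P0)
  next
    case (compl A)
    have A: "A \<in> sets borel" using compl borel_E by simp
    have sets_UNIV: "UNIV \<in> sets (borel :: real measure)" by simp
    \<comment> \<open>No closure under differences is assumed. The complement is reached by adding
      the multiple with coefficient \<open>- c\<close>, which is why the induction leaves
      \<open>c\<close> arbitrary.\<close>
    have "T (UNIV - A) n c = T UNIV n c + T A n (- c)"
      unfolding T_def to_L2_add[OF lsq_indicator[OF sets_UNIV] lsq_indicator[OF A]]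
      by (rule arg_cong[where f = to_L2]) (auto simp: indicator_def fun_eq_iff)
    moreover have "P (T UNIV n c)" using P_box[of c "- real n" "real n"] by (simp add: T_def)
    ultimately show ?case using P_add compl.IH by simp
  next
    case (union A)
    have A: "A i \<in> sets borel" for i using union borel_E by auto
    have UA: "(\<Union>i<k. A i) \<in> sets borel" for k using A by auto
    have fin: "P (T (\<Union>i<k. A i) n c)" for k
    proof (induction k)
      case 0
      then show ?case by (simp add: T_def P0)
    next
      case (Suc k)
      have "A i \<inter> A k = {}" if "i < k" for i
        using disjoint_family_onD[OF union(1), of i k] that by simp
      then have disj: "x \<notin> A k" if "x \<in> A i" "i < k" for x i using that by blast
      have "T (\<Union>i<Suc k. A i) n c = T (\<Union>i<k. A i) n c + T (A k) n c"
        unfolding T_def to_L2_add[OF lsq_indicator[OF UA] lsq_indicator[OF A]]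
        by (rule arg_cong[where f = to_L2]) (auto simp: indicator_def fun_eq_iff lessThan_Suc dest: disj)
      then show ?case using P_add Suc union by simp
    qed
    have "(\<lambda>k. T (\<Union>i<k. A i) n c) \<longlonglongrightarrow> T (\<Union>i. A i) n c"
      unfolding T_def
    proof (rule to_L2_dominated_convergence(3)[OF lsq_indicator[of UNIV c n]])
      show "(\<lambda>x. c * indicator ((\<Union>i<k. A i) \<inter> {- real n<..<real n}) x) \<in> borel_measurable lborel" for k
        using A by (intro lsq_measurable lsq_indicator) auto
      show "(\<lambda>x. c * indicator ((\<Union>i. A i) \<inter> {- real n<..<real n}) x) \<in> borel_measurable lborel"
        using A by (intro lsq_measurable lsq_indicator) auto
      show "(\<lambda>k. c * indicator ((\<Union>i<k. A i) \<inter> {- real n<..<real n}) x)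
          \<longlonglongrightarrow> c * indicator ((\<Union>i. A i) \<inter> {- real n<..<real n}) x" for x
      proof (cases "x \<in> (\<Union>i. A i)")
        case True
        then obtain i where "x \<in> A i" by blast
        then show ?thesis
          by (intro tendsto_eventually eventually_mono[OF eventually_gt_at_top[of i]]) (auto simp: indicator_def)
      qed (simp add: indicator_def)
    qed (auto simp: indicator_def)
    then show ?case by (rule P_lim[OF fin])
  qed
  obtain f where f: "lsq f" "x = to_L2 f" by (meson L2_cases)
  obtain s where s: "\<And>i. simple_function lborel (s i)" "\<And>x. (\<lambda>i. s i x) \<longlonglongrightarrow> f x"
    "\<And>i x. cmod (s i x) \<le> 2 * cmod (f x)"
    using borel_measurable_implies_sequence_metric[OF lsq_measurable[OF f(1)], of 0] by auto
  define s' where "s' i x = s i x * indicator {- real i<..<real i} x" for i x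
  have "P (to_L2 (s' i))" for i
  proof -
    have fin: "finite (range (s i))" using simple_functionD(1)[OF s(1)[of i]] by simp
    have A: "s i -` {y} \<in> sets borel" for y using simple_functionD(2)[OF s(1)[of i], of "{y}"] by simp
    let ?g = "\<lambda>Y x. \<Sum>y\<in>Y. y * indicator (s i -` {y} \<inter> {- real i<..<real i}) x"
    have "lsq (?g Y) \<and> P (to_L2 (?g Y))" if "finite Y" for Y
      using that
    proof induction
      case (insert y Y)
      have l: "lsq (\<lambda>x. y * indicator (s i -` {y} \<inter> {- real i<..<real i}) x)" by (rule lsq_indicator[OF A])
      have t: "P (to_L2 (\<lambda>x. y * indicator (s i -` {y} \<inter> {- real i<..<real i}) x))"
        using PT[OF A] unfolding T_def .
      have IH: "lsq (?g Y)" "P (to_L2 (?g Y))" using insert.IH by blast+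
      show ?case
        unfolding sum.insert[OF insert.hyps] to_L2_add[OF l IH(1), symmetric]
        using lsq_add[OF l IH(1)] P_add[OF t IH(2)] by blast
    qed (simp add: P0)
    moreover have "?g (range (s i)) = s' i"
    proof
      fix x
      have "?g (range (s i)) x = (\<Sum>y\<in>range (s i). if y = s i x then s' i x else 0)"
        by (rule sum.cong) (auto simp: s'_def indicator_def)
      then show "?g (range (s i)) x = s' i x" using fin by simp
    qed
    ultimately show ?thesis using fin by metis
  qed
  moreover have "(\<lambda>i. to_L2 (s' i)) \<longlonglongrightarrow> to_L2 f"
  proof (rule to_L2_dominated_convergence(3)[OF lsq_cmult[OF f(1), of 2]])
    have [measurable]: "s i \<in> borel_measurable borel" for i
      using borel_measurable_simple_function[OF s(1)[of i]] by simp
    show "s' i \<in> borel_measurable lborel" for i unfolding s'_def by measurable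
    show "cmod (s' i x) \<le> cmod (2 * f x)" for i x
      using s(3)[of i x] by (auto simp: s'_def indicator_def norm_mult)
    show "(\<lambda>i. s' i x) \<longlonglongrightarrow> f x" for x
    proof (rule Lim_transform_eventually[OF s(2)])
      obtain n where "\<bar>x\<bar> < real n" using reals_Archimedean2 by blast
      then show "\<forall>\<^sub>F i in sequentially. s i x = s' i x"
        by (intro eventually_mono[OF eventually_ge_at_top[of n]]) (auto simp: s'_def indicator_def)
    qed
  qed (rule lsq_measurable[OF f(1)])
  ultimately show ?thesis unfolding f(2) by (rule P_lim)
qed

text \<open>Translations are isometries, so convergence at 0 passes to L2 limits by a three-epsilon
  argument; only intervals need a computation.\<close>

lemma L2_shift_continuous: "((\<lambda>z. L2_affine z 1 x) \<longlongrightarrow> x) (at 0)"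
proof (induction x rule: L2_induct)
  case (add x y)
  then show ?case using tendsto_add[OF add] by (simp add: L2_affine_add)
next
  case (lim u x)
  show ?case
  proof (rule tendstoI)
    fix e :: real assume e: "e > 0"
    have "\<forall>\<^sub>F n in sequentially. dist (u n) x < e / 3" using tendstoD[OF lim(2), of "e/3"] e by simp
    then obtain n where n: "dist (u n) x < e / 3" by (auto simp: eventually_sequentially)
    have "\<forall>\<^sub>F z in at 0. dist (L2_affine z 1 (u n)) (u n) < e / 3" using tendstoD[OF lim(1), of "e/3" n] e by simp
    then show "\<forall>\<^sub>F z in at 0. dist (L2_affine z 1 x) x < e"
    proof eventually_elim
      case (elim z)
      have "dist (L2_affine z 1 x) (L2_affine z 1 (u n)) = dist (u n) x"
        by (simp add: dist_norm L2_affine_norm flip: L2_affine_diff) (rule norm_minus_commute)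
      then show ?case
        using elim n dist_triangle[of "L2_affine z 1 x" x "L2_affine z 1 (u n)"]
          dist_triangle[of "L2_affine z 1 (u n)" x "u n"] by linarith
    qed
  qed
next
  case (interval c a b)
  let ?f = "\<lambda>x. c * indicator {a<..<b} x"
  \<comment> \<open>An interval and its translate by \<open>z\<close> differ only within distance
    \<open>|z|\<close> of the two endpoints, hence on a set of measure at most
    \<open>4 |z|\<close>.\<close>
  have *: "norm (L2_affine z 1 (to_L2 ?f) - to_L2 ?f) \<le> sqrt ((cmod c)\<^sup>2 * (4 * \<bar>z\<bar>))" for z
  proof (rule real_le_rsqrt)
    let ?S = "{a - \<bar>z\<bar>..a + \<bar>z\<bar>} \<union> {b - \<bar>z\<bar>..b + \<bar>z\<bar>}"
    have l: "lsq (\<lambda>s. ?f (z + 1 * s))" by (rule lsq_affine[OF _ lsq_indicator_Ioo]) simp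
    have i: "integrable lborel (\<lambda>s. (cmod c)\<^sup>2 * (indicator {a - \<bar>z\<bar>..a + \<bar>z\<bar>} s + indicator {b - \<bar>z\<bar>..b + \<bar>z\<bar>} s) :: real)"
      by simp
    have "(norm (L2_affine z 1 (to_L2 ?f) - to_L2 ?f))\<^sup>2 = (LINT s|lborel. (cmod (?f (z + 1 * s) - ?f s))\<^sup>2)"
      using l by (simp add: L2_affine_to_L2 lsq_indicator_Ioo to_L2_diff norm_to_L2_sq lsq_diff)
    also have "\<dots> \<le> (LINT s|lborel. (cmod c)\<^sup>2 * (indicator {a - \<bar>z\<bar>..a + \<bar>z\<bar>} s + indicator {b - \<bar>z\<bar>..b + \<bar>z\<bar>} s))"
      using l by (intro integral_mono lsq_integrable lsq_diff lsq_indicator_Ioo i) (auto simp: indicator_def)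
    also have "\<dots> = (cmod c)\<^sup>2 * (4 * \<bar>z\<bar>)" by simp
    finally show "(norm (L2_affine z 1 (to_L2 ?f) - to_L2 ?f))\<^sup>2 \<le> (cmod c)\<^sup>2 * (4 * \<bar>z\<bar>)" .
  qed
  have "((\<lambda>z. sqrt ((cmod c)\<^sup>2 * (4 * \<bar>z\<bar>))) \<longlongrightarrow> sqrt ((cmod c)\<^sup>2 * (4 * \<bar>0\<bar>))) (at 0)" by (intro tendsto_intros)
  then have "((\<lambda>z. L2_affine z 1 (to_L2 ?f) - to_L2 ?f) \<longlongrightarrow> 0) (at 0)"
    by (intro Lim_null_comparison[OF always_eventually[OF allI[OF *]]]) simp
  then show ?case by (simp add: LIM_zero_iff)
qed

section \<open>The Plancherel theorem\<close>

lemma integrable_mult_bounded: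
  fixes f m :: "'a \<Rightarrow> complex"
  assumes "m \<in> borel_measurable M" "\<And>x. cmod (m x) \<le> B" "integrable M f"
  shows "integrable M (\<lambda>x. m x * f x)"
proof (rule Bochner_Integration.integrable_bound)
  note [measurable] = assms(1) borel_measurable_integrable[OF assms(3)]
  show "integrable M (\<lambda>x. B * cmod (f x))" using assms(3) by simp
  show "(\<lambda>x. m x * f x) \<in> borel_measurable M" by measurable
  show "AE x in M. norm (m x * f x) \<le> norm (B * cmod (f x))"
  proof (rule AE_I2)
    fix x
    have "cmod (m x * f x) \<le> B * cmod (f x)" unfolding norm_mult by (rule mult_right_mono[OF assms(2)]) simp
    then show "norm (m x * f x) \<le> norm (B * cmod (f x))" by simp
  qed
qed

text \<open>A bounded kernel times two integrable factors is absolutely integrable on the plane.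
  This is the source of the multiplication formula, on which Plancherel, inversion and the
  dispersive estimate rest.\<close>

lemma Fubini_mult_bounded:
  fixes f g :: "real \<Rightarrow> complex" and k :: "real \<Rightarrow> real \<Rightarrow> complex"
  assumes f: "integrable lborel f" and g: "integrable lborel g"
    and k: "(\<lambda>(x, y). k x y) \<in> borel_measurable (lborel \<Otimes>\<^sub>M lborel)" "\<And>x y. cmod (k x y) \<le> B"
  shows "(LINT y|lborel. (LINT x|lborel. k x y * f x) * g y) = (LINT x|lborel. f x * (LINT y|lborel. k x y * g y))"
proof -
  note [measurable] = borel_measurable_integrable[OF f] borel_measurable_integrable[OF g] k(1)
  have k1: "k x \<in> borel_measurable lborel" for x using measurable_Pair2[OF k(1), of x] by simp
  have B: "0 \<le> B" using k(2)[of 0 0] norm_ge_zero order_trans by blast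
  have int: "integrable (lborel \<Otimes>\<^sub>M lborel) (\<lambda>(x, y). k x y * f x * g y)"
  proof (rule lborel_pair.Fubini_integrable)
    show "(\<lambda>(x, y). k x y * f x * g y) \<in> borel_measurable (lborel \<Otimes>\<^sub>M lborel)" by measurable
    have i: "integrable lborel (\<lambda>y. k x y * f x * g y)" for x
      using integrable_mult_right[OF integrable_mult_bounded[OF k1 k(2) g], of "f x" x] by (simp add: mult_ac)
    then show "AE x in lborel. integrable lborel (\<lambda>y. case (x, y) of (x, y) \<Rightarrow> k x y * f x * g y)" by simp
    show "integrable lborel (\<lambda>x. LINT y|lborel. norm (case (x, y) of (x, y) \<Rightarrow> k x y * f x * g y))"
    proof (rule Bochner_Integration.integrable_bound)
      show "integrable lborel (\<lambda>x. B * (LINT y|lborel. cmod (g y)) * cmod (f x))" using f by simp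
      show "(\<lambda>x. LINT y|lborel. norm (case (x, y) of (x, y) \<Rightarrow> k x y * f x * g y)) \<in> borel_measurable lborel" by measurable
      have "(LINT y|lborel. cmod (k x y * f x * g y)) \<le> B * (LINT y|lborel. cmod (g y)) * cmod (f x)" for x
      proof -
        have "(LINT y|lborel. cmod (k x y * f x * g y)) \<le> (LINT y|lborel. B * cmod (f x) * cmod (g y))"
          using k(2) by (intro integral_mono integrable_norm i integrable_mult_right g)
            (auto simp: norm_mult intro!: mult_right_mono)
        then show ?thesis by (simp add: mult_ac)
      qed
      moreover have "0 \<le> (LINT y|lborel. cmod (k x y * f x * g y))" for x by (rule integral_nonneg_AE) simp
      ultimately show "AE x in lborel. norm (LINT y|lborel. norm (case (x, y) of (x, y) \<Rightarrow> k x y * f x * g y))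
          \<le> norm (B * (LINT y|lborel. cmod (g y)) * cmod (f x))"
        by (intro AE_I2) (simp, meson abs_ge_self order_trans)
    qed
  qed
  have "(LINT y|lborel. (LINT x|lborel. k x y * f x) * g y) = (LINT y|lborel. LINT x|lborel. k x y * f x * g y)" by simp
  also have "\<dots> = (LINT x|lborel. LINT y|lborel. k x y * f x * g y)" by (rule lborel_pair.Fubini_integral[OF int])
  also have "\<dots> = (LINT x|lborel. LINT y|lborel. f x * (k x y * g y))" by (simp only: mult_ac)
  finally show ?thesis by simp
qed

section \<open>The Fourier integral on integrable functions\<close>

definition ft :: "(real \<Rightarrow> complex) \<Rightarrow> real \<Rightarrow> complex" where
  "ft f \<xi> = complex_of_real (1 / sqrt (2 * pi)) * (LINT x|lborel. exp (- \<i> * complex_of_real (x * \<xi>)) * f x)"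

lemma norm_exp_i [simp]: "cmod (exp (- (\<i> * complex_of_real x))) = 1" "cmod (iexp x) = 1"
  by (simp_all add: norm_exp_eq_Re)

lemma norm_exp_i' [simp]:
  "cmod (exp (- (\<i> * (complex_of_real x * complex_of_real y)))) = 1"
  "cmod (exp (\<i> * (complex_of_real x * complex_of_real y))) = 1"
  by (simp_all add: norm_exp_eq_Re)

lemma integrable_ft:
  "integrable lborel f \<Longrightarrow> integrable lborel (\<lambda>x. exp (- \<i> * complex_of_real (x * \<xi>)) * f x)"
  by (rule integrable_mult_bounded[where B = 1]) auto

lemma ft_bound: "integrable lborel f \<Longrightarrow> cmod (ft f \<xi>) \<le> L1_norm f"
proof -
  assume f: "integrable lborel f"
  have "cmod (ft f \<xi>) \<le> 1 * cmod (LINT x|lborel. exp (- \<i> * complex_of_real (x * \<xi>)) * f x)"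
    unfolding ft_def norm_mult
  proof (rule mult_right_mono)
    have "1 \<le> sqrt (2 * pi)" using pi_gt3 by simp
    then show "cmod (complex_of_real (1 / sqrt (2 * pi))) \<le> 1" by (simp add: norm_divide)
  qed simp
  also have "\<dots> \<le> (LINT x|lborel. cmod (exp (- \<i> * complex_of_real (x * \<xi>)) * f x))"
    using integral_norm_bound by simp
  also have "\<dots> = L1_norm f" by (simp add: norm_mult L1_norm_def)
  finally show ?thesis .
qed

lemma ft_measurable [measurable]:
  assumes "integrable lborel f" shows "ft f \<in> borel_measurable borel"
proof -
  note [measurable] = borel_measurable_integrable[OF assms]
  have "(\<lambda>\<xi>. LINT x|lborel. exp (- \<i> * complex_of_real (x * \<xi>)) * f x) \<in> borel_measurable lborel"
    by (rule lborel.borel_measurable_lebesgue_integral) measurable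
  then show ?thesis unfolding ft_def by measurable
qed

lemma ft_add: "integrable lborel f \<Longrightarrow> integrable lborel g \<Longrightarrow> ft (\<lambda>x. f x + g x) = (\<lambda>\<xi>. ft f \<xi> + ft g \<xi>)"
  unfolding ft_def by (simp add: distrib_left integrable_ft[simplified])

lemma ft_diff: "integrable lborel f \<Longrightarrow> integrable lborel g \<Longrightarrow> ft (\<lambda>x. f x - g x) = (\<lambda>\<xi>. ft f \<xi> - ft g \<xi>)"
  unfolding ft_def by (simp add: right_diff_distrib integrable_ft[simplified])

lemma ft_cmult: "ft (\<lambda>x. c * f x) = (\<lambda>\<xi>. c * ft f \<xi>)"
  unfolding ft_def by (simp add: mult.left_commute)

lemma ft_cnj: "ft (\<lambda>x. cnj (f x)) \<xi> = cnj (ft f (- \<xi>))"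
proof -
  have "cnj (LINT x|lborel. exp (- \<i> * complex_of_real (x * - \<xi>)) * f x)
      = (LINT x|lborel. cnj (exp (- \<i> * complex_of_real (x * - \<xi>)) * f x))" by (rule Bochner_Integration.integral_cnj[symmetric])
  then show ?thesis unfolding ft_def by (simp add: exp_cnj)
qed

lemma ft_multiplication:
  assumes "integrable lborel f" "integrable lborel g"
  shows "(LINT x|lborel. ft f x * g x) = (LINT x|lborel. f x * ft g x)"
proof -
  have "(LINT y|lborel. (LINT x|lborel. exp (- \<i> * complex_of_real (x * y)) * f x) * g y)
      = (LINT x|lborel. f x * (LINT y|lborel. exp (- \<i> * complex_of_real (x * y)) * g y))"
  proof (rule Fubini_mult_bounded[OF assms, of "\<lambda>x y. exp (- \<i> * complex_of_real (x * y))" 1])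
    show "(\<lambda>(x, y). exp (- \<i> * complex_of_real (x * y))) \<in> borel_measurable (lborel \<Otimes>\<^sub>M lborel)"
      by measurable
  qed simp
  then have "complex_of_real (1 / sqrt (2 * pi)) * (LINT y|lborel. (LINT x|lborel. exp (- \<i> * complex_of_real (x * y)) * f x) * g y)
     = complex_of_real (1 / sqrt (2 * pi)) * (LINT x|lborel. f x * (LINT y|lborel. exp (- \<i> * complex_of_real (x * y)) * g y))" by simp
  then show ?thesis unfolding ft_def
    by (simp only: integral_mult_right_zero[symmetric] mult.assoc mult.left_commute mult.commute)
qed

section \<open>Gaussian Fourier integrals and the regularized Plancherel identity\<close>

lemma integrable_exp_std_normal:
  "integrable lborel (\<lambda>x. iexp (t * x) * complex_of_real (std_normal_density x))"
  by (rule integrable_mult_bounded[where B = 1]) (auto simp: complex_of_real_integrable_eq)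

text \<open>Read off from the characteristic function of the standard normal law.\<close>

lemma integral_exp_std_normal:
  "(LINT x|lborel. iexp (t * x) * complex_of_real (std_normal_density x))
     = complex_of_real (sqrt (2 * pi) * std_normal_density t)"
proof -
  have "char std_normal_distribution t = (LINT x|lborel. complex_of_real (std_normal_density x) * iexp (t * x))"
    unfolding char_def by (subst integral_density) (auto simp: scaleR_conv_of_real)
  then show ?thesis
    unfolding char_std_normal_distribution by (simp add: std_normal_density_def mult.commute)
qed

lemma integral_exp_gaussian:
  assumes "s > 0"
  shows "integrable lborel (\<lambda>x. iexp (t * x) * complex_of_real (exp (- (s * x)\<^sup>2 / 2)))"
    and "(LINT x|lborel. iexp (t * x) * complex_of_real (exp (- (s * x)\<^sup>2 / 2)))
     = complex_of_real (2 * pi / s * std_normal_density (t / s))"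
proof -
  let ?h = "\<lambda>x. complex_of_real (sqrt (2 * pi)) * (iexp (t / s * x) * complex_of_real (std_normal_density x))"
  have eq: "?h (0 + s * x) = iexp (t * x) * complex_of_real (exp (- (s * x)\<^sup>2 / 2))" for x
    using assms by (simp add: std_normal_density_def)
  have i: "integrable lborel ?h" by (intro integrable_mult_right integrable_exp_std_normal)
  show "integrable lborel (\<lambda>x. iexp (t * x) * complex_of_real (exp (- (s * x)\<^sup>2 / 2)))"
    using lborel_integrable_real_affine[OF i, of s 0] assms by (simp only: eq)
  have "integral\<^sup>L lborel ?h = complex_of_real (sqrt (2 * pi) * sqrt (2 * pi) * std_normal_density (t / s))"
    unfolding integral_mult_right_zero integral_exp_std_normal by (simp only: of_real_mult mult.assoc)
  moreover have "integral\<^sup>L lborel ?h = \<bar>s\<bar> *\<^sub>R (LINT x|lborel. ?h (0 + s * x))"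
    by (rule lborel_integral_real_affine) (use assms in simp)
  ultimately show "(LINT x|lborel. iexp (t * x) * complex_of_real (exp (- (s * x)\<^sup>2 / 2)))
     = complex_of_real (2 * pi / s * std_normal_density (t / s))"
    unfolding eq using assms by (simp add: scaleR_conv_of_real field_simps)
qed

lemma lsq_norm_mult_integrable:
  assumes "lsq f" "lsq g" shows "integrable lborel (\<lambda>x. cmod (f x) * cmod (g x))"
proof (rule Bochner_Integration.integrable_bound)
  note [measurable] = lsq_measurable[OF assms(1)] lsq_measurable[OF assms(2)]
  show "integrable lborel (\<lambda>x. (cmod (f x))\<^sup>2 + (cmod (g x))\<^sup>2)" using assms by (auto simp: lsq_def)
  show "(\<lambda>x. cmod (f x) * cmod (g x)) \<in> borel_measurable lborel" by measurable
  have "cmod (f x) * cmod (g x) \<le> (cmod (f x))\<^sup>2 + (cmod (g x))\<^sup>2" for x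
  proof -
    have "0 \<le> cmod (f x) * cmod (g x)" by simp
    then show ?thesis using sum_squares_bound[of "cmod (f x)" "cmod (g x)"] by linarith
  qed
  then show "AE x in lborel. norm (cmod (f x) * cmod (g x)) \<le> norm ((cmod (f x))\<^sup>2 + (cmod (g x))\<^sup>2)" by simp
qed

text \<open>Cauchy-Schwarz for the classes of \<open>|f|\<close> and \<open>|g|\<close>; the inner
  product of \<open>f\<close> and \<open>g\<close> themselves could lose mass by cancellation of
  phases.\<close>

lemma lsq_norm_mult_le:
  assumes "lsq f" "lsq g" shows "(LINT x|lborel. cmod (f x) * cmod (g x)) \<le> norm (to_L2 f) * norm (to_L2 g)"
proof -
  have l: "lsq (\<lambda>x. complex_of_real (cmod (h x)))" if "lsq h" for h
    using that lsq_measurable[OF that] by (simp add: lsq_def)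
  have "inner (to_L2 (\<lambda>x. complex_of_real (cmod (f x)))) (to_L2 (\<lambda>x. complex_of_real (cmod (g x))))
      = (LINT x|lborel. cmod (f x) * cmod (g x))"
    by (simp add: inner_to_L2 l assms inner_complex_def)
  moreover have "norm (to_L2 (\<lambda>x. complex_of_real (cmod (h x)))) = norm (to_L2 h)" if "lsq h" for h
    using that l[OF that] by (simp add: norm_to_L2)
  ultimately show ?thesis
    using assms norm_cauchy_schwarz[of "to_L2 (\<lambda>x. complex_of_real (cmod (f x)))" "to_L2 (\<lambda>x. complex_of_real (cmod (g x)))"] by simp
qed

text \<open>The Gaussian factor makes \<open>ft f\<close> integrable against \<open>cnj (ft f)\<close>, so that the multiplication
  formula applies twice; it turns into an average of translates of \<open>f\<close>.\<close>

lemma ft_gaussian_regularized: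
  assumes f: "integrable lborel f" "lsq f" and s: "s > 0"
  shows "integrable lborel (\<lambda>\<xi>. (cmod (ft f \<xi>))\<^sup>2 * exp (- (s * \<xi>)\<^sup>2 / 2))"
    and "(LINT \<xi>|lborel. (cmod (ft f \<xi>))\<^sup>2 * exp (- (s * \<xi>)\<^sup>2 / 2))
      = (LINT z|lborel. std_normal_density z * inner (to_L2 f) (L2_affine (s * z) 1 (to_L2 f)))"
proof -
  note [measurable] = borel_measurable_integrable[OF f(1)]
  define E where "E \<xi> = complex_of_real (exp (- (s * \<xi>)\<^sup>2 / 2))" for \<xi>
  define h where "h \<xi> = cnj (ft f \<xi>) * E \<xi>" for \<xi>
  define G where "G x = (LINT z|lborel. complex_of_real (std_normal_density z) * f (x + s * z))" for x
  have E: "integrable lborel (\<lambda>\<xi>. iexp (t * \<xi>) * E \<xi>)" for t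
    unfolding E_def by (rule integral_exp_gaussian(1)[OF s])
  from E[of 0] have E0: "integrable lborel E" by simp
  have ft_m [measurable]: "ft f \<in> borel_measurable borel" by (rule ft_measurable[OF f(1)])
  have h: "integrable lborel h"
    unfolding h_def by (rule integrable_mult_bounded[OF _ _ E0, of _ "L1_norm f"]) (use ft_bound[OF f(1)] in auto)
  have eq: "ft f \<xi> * h \<xi> = complex_of_real ((cmod (ft f \<xi>))\<^sup>2 * exp (- (s * \<xi>)\<^sup>2 / 2))" for \<xi>
    by (simp add: h_def E_def mult.assoc[symmetric] flip: complex_norm_square)
  have "integrable lborel (\<lambda>\<xi>. ft f \<xi> * h \<xi>)"
    by (rule integrable_mult_bounded[OF _ ft_bound[OF f(1)] h]) measurable
  then show "integrable lborel (\<lambda>\<xi>. (cmod (ft f \<xi>))\<^sup>2 * exp (- (s * \<xi>)\<^sup>2 / 2))"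
    unfolding eq by (simp only: complex_of_real_integrable_eq)
  \<comment> \<open>Conjugation reflects the frequency; the multiplication formula moves the
    transform from \<open>cnj f\<close> to the modulated Gaussian, whose transform is a Gaussian of
    width \<open>s\<close> centred at \<open>x\<close>; and \<open>y = x + s z\<close> rescales it
    to the standard normal law.\<close>
  have ft_h: "ft h x = cnj (G x)" for x
  proof -
    have fc: "integrable lborel (\<lambda>x. cnj (f x))" using f by simp
    have "(LINT \<xi>|lborel. exp (- \<i> * complex_of_real (\<xi> * x)) * h \<xi>)
        = (LINT \<xi>|lborel. ft (\<lambda>y. cnj (f y)) (- \<xi>) * (exp (- \<i> * complex_of_real (\<xi> * x)) * E \<xi>))"
      by (simp add: h_def ft_cnj mult_ac)
    also have "\<dots> = (LINT \<xi>|lborel. ft (\<lambda>y. cnj (f y)) \<xi> * (iexp (x * \<xi>) * E \<xi>))"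
      by (subst lborel_integral_real_affine[where c = "-1" and t = 0]) (auto simp: E_def mult_ac)
    also have "\<dots> = (LINT y|lborel. cnj (f y) * ft (\<lambda>\<xi>. iexp (x * \<xi>) * E \<xi>) y)"
      by (rule ft_multiplication[OF fc E])
    also have "\<dots> = (LINT y|lborel. cnj (f y) * complex_of_real (sqrt (2 * pi) / s * std_normal_density ((y - x) / s)))"
    proof (rule Bochner_Integration.integral_cong[OF refl])
      fix y
      have "(LINT \<xi>|lborel. exp (- \<i> * complex_of_real (\<xi> * y)) * (iexp (x * \<xi>) * E \<xi>))
          = (LINT \<xi>|lborel. iexp ((x - y) * \<xi>) * E \<xi>)"
      proof (rule Bochner_Integration.integral_cong[OF refl])
        fix \<xi>
        have "exp (- \<i> * complex_of_real (\<xi> * y)) * iexp (x * \<xi>)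
            = iexp ((x - y) * \<xi>)"
          unfolding mult_exp_exp by (rule arg_cong[where f = exp]) (simp add: algebra_simps)
        then show "exp (- \<i> * complex_of_real (\<xi> * y)) * (iexp (x * \<xi>) * E \<xi>)
            = iexp ((x - y) * \<xi>) * E \<xi>"
          by (simp only: mult.assoc[symmetric])
      qed
      also have "\<dots> = complex_of_real (2 * pi / s * std_normal_density ((y - x) / s))"
        unfolding E_def integral_exp_gaussian(2)[OF s]
        by (simp add: std_normal_density_def power_divide power2_commute)
      finally have "ft (\<lambda>\<xi>. iexp (x * \<xi>) * E \<xi>) y
          = complex_of_real (1 / sqrt (2 * pi) * (2 * pi / s * std_normal_density ((y - x) / s)))"
        unfolding ft_def by simp
      also have "1 / sqrt (2 * pi) * (2 * pi / s * std_normal_density ((y - x) / s)) = sqrt (2 * pi) / s * std_normal_density ((y - x) / s)"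
      proof -
        have "2 * pi / sqrt (2 * pi) = sqrt (2 * pi)" by (rule real_div_sqrt) simp
        moreover have "1 / sqrt (2 * pi) * (2 * pi / s * std_normal_density ((y - x) / s))
            = 2 * pi / sqrt (2 * pi) / s * std_normal_density ((y - x) / s)" by simp
        ultimately show ?thesis by (simp only:)
      qed
      finally show "cnj (f y) * ft (\<lambda>\<xi>. iexp (x * \<xi>) * E \<xi>) y
          = cnj (f y) * complex_of_real (sqrt (2 * pi) / s * std_normal_density ((y - x) / s))" by simp
    qed
    also have "\<dots> = \<bar>s\<bar> *\<^sub>R (LINT z|lborel. cnj (f (x + s * z)) * complex_of_real (sqrt (2 * pi) / s * std_normal_density (((x + s * z) - x) / s)))"
      by (rule lborel_integral_real_affine) (use s in simp)
    also have "\<dots> = (LINT z|lborel. complex_of_real (sqrt (2 * pi)) * cnj (complex_of_real (std_normal_density z) * f (x + s * z)))"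
      unfolding integral_scaleR_right[symmetric] using s by (simp add: scaleR_conv_of_real mult_ac)
    also have "\<dots> = complex_of_real (sqrt (2 * pi)) * cnj (G x)"
      unfolding G_def integral_mult_right_zero Bochner_Integration.integral_cnj ..
    finally show ?thesis unfolding ft_def by simp
  qed
  have G_b: "cmod (cnj (G x)) \<le> L1_norm h" for x unfolding ft_h[symmetric] by (rule ft_bound[OF h])
  have cG_m: "(\<lambda>x. cnj (G x)) \<in> borel_measurable borel" using ft_measurable[OF h] by (simp add: ft_h[abs_def])
  have int_fG: "integrable lborel (\<lambda>x. cnj (G x) * f x)"
    by (rule integrable_mult_bounded[OF _ G_b f(1)]) (use cG_m in simp)
  have sh: "lsq (\<lambda>x. f (s * z + 1 * x))" for z by (rule lsq_affine[OF _ f(2)]) simp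
  have sh': "lsq (\<lambda>x. f (x + s * z))" for z using sh[of z] by (simp add: add.commute)
  have nsh: "norm (to_L2 (\<lambda>x. f (x + s * z))) = norm (to_L2 f)" for z
    using L2_affine_norm[of 1 "s * z" "to_L2 f"] L2_affine_to_L2[OF _ f(2), of 1 "s * z"] by (simp add: add.commute)
  have inn: "(LINT x|lborel. inner (f x) (f (x + s * z))) = inner (to_L2 f) (L2_affine (s * z) 1 (to_L2 f))" for z
    using L2_affine_to_L2[OF _ f(2), of 1 "s * z"] inner_to_L2[OF f(2) sh[of z]] by (simp add: add.commute)
  let ?K = "\<lambda>z x. std_normal_density z * inner (f x) (f (x + s * z))"
  \<comment> \<open>Translates have the norm of \<open>f\<close>, so Cauchy-Schwarz in
    \<open>x\<close> leaves a multiple of the normal density as integrable majorant in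
    \<open>z\<close>.\<close>
  have intK: "integrable (lborel \<Otimes>\<^sub>M lborel) (\<lambda>(z, x). ?K z x)"
  proof (rule lborel_pair.Fubini_integrable)
    show m: "(\<lambda>(z, x). ?K z x) \<in> borel_measurable (lborel \<Otimes>\<^sub>M lborel)" by measurable
    have i: "integrable lborel (\<lambda>x. ?K z x)" for z
      by (rule integrable_mult_right[OF lsq_inner_integrable[OF f(2) sh']])
    then show "AE z in lborel. integrable lborel (\<lambda>x. case (z, x) of (z, x) \<Rightarrow> ?K z x)" by simp
    show "integrable lborel (\<lambda>z. LINT x|lborel. norm (case (z, x) of (z, x) \<Rightarrow> ?K z x))"
    proof (rule Bochner_Integration.integrable_bound)
      show "integrable lborel (\<lambda>z. std_normal_density z * (norm (to_L2 f))\<^sup>2)" by simp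
      show "(\<lambda>z. LINT x|lborel. norm (case (z, x) of (z, x) \<Rightarrow> ?K z x)) \<in> borel_measurable lborel"
        using m by measurable
      have "(LINT x|lborel. \<bar>?K z x\<bar>) \<le> std_normal_density z * (norm (to_L2 f))\<^sup>2" for z
      proof -
        have "(LINT x|lborel. \<bar>?K z x\<bar>) \<le> (LINT x|lborel. std_normal_density z * (cmod (f x) * cmod (f (x + s * z))))"
          using i[of z] lsq_norm_mult_integrable[OF f(2) sh'[of z]]
          by (intro integral_mono integrable_abs integrable_mult_right)
             (auto simp: abs_mult normal_density_nonneg intro!: mult_left_mono Cauchy_Schwarz_ineq2)
        also have "\<dots> \<le> std_normal_density z * (norm (to_L2 f) * norm (to_L2 (\<lambda>x. f (x + s * z))))"
          unfolding integral_mult_right_zero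
          by (intro mult_left_mono lsq_norm_mult_le f sh') (simp add: normal_density_nonneg)
        finally show ?thesis by (simp add: nsh power2_eq_square)
      qed
      then show "AE z in lborel. norm (LINT x|lborel. norm (case (z, x) of (z, x) \<Rightarrow> ?K z x))
          \<le> norm (std_normal_density z * (norm (to_L2 f))\<^sup>2)"
        by (auto simp: integral_nonneg_AE normal_density_nonneg)
    qed
  qed
  have G_int: "integrable lborel (\<lambda>z. complex_of_real (std_normal_density z) * f (x + s * z))" for x
  proof (rule integrable_mult_bounded[where B = 1])
    show "integrable lborel (\<lambda>z. f (x + s * z))" using lborel_integrable_real_affine[OF f(1)] s by simp
    show "cmod (complex_of_real (std_normal_density z)) \<le> 1" for z
    proof -
      have "1 \<le> sqrt (2 * pi)" using pi_gt3 by simp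
      moreover have "exp (- (z\<^sup>2 / 2)) \<le> 1" by simp
      ultimately have "exp (- (z\<^sup>2 / 2)) \<le> sqrt (2 * pi)" by (rule order_trans[rotated])
      then show ?thesis unfolding std_normal_density_def by (simp add: norm_mult norm_divide)
    qed
  qed measurable
  have "complex_of_real (LINT \<xi>|lborel. (cmod (ft f \<xi>))\<^sup>2 * exp (- (s * \<xi>)\<^sup>2 / 2)) = (LINT \<xi>|lborel. ft f \<xi> * h \<xi>)"
    by (simp only: eq integral_complex_of_real)
  also have "\<dots> = (LINT x|lborel. f x * ft h x)" by (rule ft_multiplication[OF f(1) h])
  also have "\<dots> = (LINT x|lborel. cnj (G x) * f x)" by (simp add: ft_h mult.commute)
  finally have "(LINT \<xi>|lborel. (cmod (ft f \<xi>))\<^sup>2 * exp (- (s * \<xi>)\<^sup>2 / 2)) = Re (LINT x|lborel. cnj (G x) * f x)"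
    by (metis Re_complex_of_real)
  also have "\<dots> = (LINT x|lborel. inner (f x) (G x))"
    by (subst integral_Re[OF int_fG, symmetric]) (simp add: inner_complex_def algebra_simps)
  also have "\<dots> = (LINT x|lborel. LINT z|lborel. ?K z x)"
  proof (rule Bochner_Integration.integral_cong[OF refl])
    fix x
    have "inner (f x) (G x) = (LINT z|lborel. inner (f x) (complex_of_real (std_normal_density z) * f (x + s * z)))"
      unfolding G_def by (subst integral_inner_right) (use G_int in auto)
    also have "\<dots> = (LINT z|lborel. ?K z x)"
      by (simp only: scaleR_conv_of_real[symmetric] inner_scaleR_right)
    finally show "inner (f x) (G x) = (LINT z|lborel. ?K z x)" .
  qed
  also have "\<dots> = (LINT z|lborel. LINT x|lborel. ?K z x)" by (rule lborel_pair.Fubini_integral[OF intK])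
  also have "\<dots> = (LINT z|lborel. std_normal_density z * inner (to_L2 f) (L2_affine (s * z) 1 (to_L2 f)))"
    by (simp add: inn)
  finally show "(LINT \<xi>|lborel. (cmod (ft f \<xi>))\<^sup>2 * exp (- (s * \<xi>)\<^sup>2 / 2))
      = (LINT z|lborel. std_normal_density z * inner (to_L2 f) (L2_affine (s * z) 1 (to_L2 f)))" .
qed


text \<open>Let \<open>s\<close> tend to 0 in \<open>ft_gaussian_regularized\<close>. The left side
  increases to the integral of \<open>|ft f|^2\<close>; the right side converges to the squared norm
  of \<open>f\<close> because translations are continuous in L2. Monotone convergence then gives
  square integrability and the value of the norm together.\<close>

lemma plancherel_L1_L2:
  assumes f: "integrable lborel f" "lsq f"
  shows "lsq (ft f)" "norm (to_L2 (ft f)) = norm (to_L2 f)"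
proof -
  note ft_m [measurable] = ft_measurable[OF f(1)]
  let ?F = "to_L2 f"
  define s where "s n = inverse (real (Suc n))" for n
  have s: "s n > 0" for n by (simp add: s_def)
  have s0: "s \<longlonglongrightarrow> 0" unfolding s_def by (rule LIMSEQ_inverse_real_of_nat)
  have s_dec: "s n \<le> s m" if "m \<le> n" for m n using that by (simp add: s_def le_imp_inverse_le)
  let ?a = "\<lambda>n \<xi>. (cmod (ft f \<xi>))\<^sup>2 * exp (- (s n * \<xi>)\<^sup>2 / 2)"
  have "(\<lambda>n. LINT z|lborel. std_normal_density z * inner ?F (L2_affine (s n * z) 1 ?F))
      \<longlonglongrightarrow> (LINT z|lborel. std_normal_density z * (norm ?F)\<^sup>2)"
  proof (rule integral_dominated_convergence[where w = "\<lambda>z. std_normal_density z * (norm ?F)\<^sup>2"])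
    show "AE z in lborel. (\<lambda>n. std_normal_density z * inner ?F (L2_affine (s n * z) 1 ?F))
        \<longlonglongrightarrow> std_normal_density z * (norm ?F)\<^sup>2"
    proof (rule AE_I2)
      fix z
      have "(\<lambda>n. s n * z) \<longlonglongrightarrow> 0" using tendsto_mult_left_zero[OF s0] by simp
      moreover have "isCont (\<lambda>y. L2_affine y 1 ?F) 0"
        using L2_shift_continuous[of ?F] by (simp add: isCont_def L2_affine_def)
      ultimately have "(\<lambda>n. L2_affine (s n * z) 1 ?F) \<longlonglongrightarrow> L2_affine 0 1 ?F"
        by (rule isCont_tendsto_compose[rotated])
      then have "(\<lambda>n. L2_affine (s n * z) 1 ?F) \<longlonglongrightarrow> ?F" by (simp add: L2_affine_def)
      then have "(\<lambda>n. std_normal_density z * inner ?F (L2_affine (s n * z) 1 ?F)) \<longlonglongrightarrow> std_normal_density z * inner ?F ?F"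
        by (intro tendsto_intros)
      then show "(\<lambda>n. std_normal_density z * inner ?F (L2_affine (s n * z) 1 ?F)) \<longlonglongrightarrow> std_normal_density z * (norm ?F)\<^sup>2"
        by (simp add: power2_norm_eq_inner)
    qed
    have "\<bar>inner ?F (L2_affine (s n * z) 1 ?F)\<bar> \<le> (norm ?F)\<^sup>2" for n z
      using Cauchy_Schwarz_ineq2[of ?F "L2_affine (s n * z) 1 ?F"] by (simp add: L2_affine_norm power2_eq_square)
    then show "AE z in lborel. norm (std_normal_density z * inner ?F (L2_affine (s n * z) 1 ?F))
        \<le> std_normal_density z * (norm ?F)\<^sup>2" for n
      by (intro AE_I2) (auto simp: abs_mult normal_density_nonneg intro!: mult_left_mono)
    show "(\<lambda>z. std_normal_density z * inner ?F (L2_affine (s n * z) 1 ?F)) \<in> borel_measurable lborel" for n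
    proof -
      \<comment> \<open>Continuity at 0 spreads to every \<open>y\<close> by the group law of
        translations; it provides measurability in \<open>z\<close>.\<close>
      have "continuous_on UNIV (\<lambda>y. L2_affine y 1 ?F)"
      proof (rule continuous_at_imp_continuous_on, rule ballI)
        fix y
        have eq: "L2_affine y 1 (L2_affine z 1 x) = L2_affine (y + z) 1 x" for y z x
        proof -
          obtain f where f: "lsq f" "x = to_L2 f" by (meson L2_cases)
          show ?thesis using lsq_affine[OF _ f(1), of 1 z]
            by (simp add: f L2_affine_to_L2) (simp add: add_ac)
        qed
        have "((\<lambda>h. L2_affine h 1 (L2_affine y 1 ?F)) \<longlongrightarrow> L2_affine y 1 ?F) (at 0)" by (rule L2_shift_continuous)
        then have "((\<lambda>h. L2_affine (y + h) 1 ?F) \<longlongrightarrow> L2_affine y 1 ?F) (at 0)" by (simp add: eq add.commute)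
        then show "isCont (\<lambda>y. L2_affine y 1 ?F) y" by (simp add: isCont_iff)
      qed
      then have [measurable]: "(\<lambda>y. L2_affine y 1 ?F) \<in> borel_measurable borel" by (rule borel_measurable_continuous_onI)
      show ?thesis by measurable
    qed
  qed simp_all
  then have lim: "(\<lambda>n. LINT \<xi>|lborel. ?a n \<xi>) \<longlonglongrightarrow> (norm ?F)\<^sup>2"
    unfolding ft_gaussian_regularized(2)[OF f s] by simp
  have *: "AE x in lborel. mono (\<lambda>n. ?a n x)"
  proof (intro AE_I2 monoI mult_left_mono)
    fix x :: real and m n :: nat assume "m \<le> n"
    then have "(s n * x)\<^sup>2 \<le> (s m * x)\<^sup>2"
      unfolding power_mult_distrib using s[of n] by (intro mult_right_mono power_mono s_dec) auto
    then show "exp (- (s m * x)\<^sup>2 / 2) \<le> exp (- (s n * x)\<^sup>2 / 2)" by simp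
  qed simp
  have **: "AE x in lborel. (\<lambda>n. ?a n x) \<longlonglongrightarrow> (cmod (ft f x))\<^sup>2"
  proof (rule AE_I2)
    fix x
    have "(\<lambda>n. ?a n x) \<longlonglongrightarrow> (cmod (ft f x))\<^sup>2 * exp (- (0 * x)\<^sup>2 / 2)" by (intro tendsto_intros s0) simp
    then show "(\<lambda>n. ?a n x) \<longlonglongrightarrow> (cmod (ft f x))\<^sup>2" by simp
  qed
  have "integrable lborel (\<lambda>x. (cmod (ft f x))\<^sup>2)"
    by (rule integral_monotone_convergence_nonneg(1)[OF ft_gaussian_regularized(1)[OF f s] * _ ** lim]) auto
  then show l: "lsq (ft f)" by (simp add: lsq_def)
  have "(LINT x|lborel. (cmod (ft f x))\<^sup>2) = (norm ?F)\<^sup>2"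
    by (rule integral_monotone_convergence_nonneg(2)[OF ft_gaussian_regularized(1)[OF f s] * _ ** lim]) auto
  then show "norm (to_L2 (ft f)) = norm ?F" using l by (simp add: norm_to_L2)
qed

section \<open>Extension of the transform to all of L2\<close>

definition L2_cut :: "nat \<Rightarrow> (real \<Rightarrow> complex) \<Rightarrow> real \<Rightarrow> complex" where
  "L2_cut n f x = indicator {- real n..real n} x *\<^sub>R f x"

lemma lsq_cut: "lsq f \<Longrightarrow> lsq (L2_cut n f)"
proof (rule lsq_bound)
  assume f: "lsq f"
  then show "lsq f" .
  note [measurable] = lsq_measurable[OF f]
  show "L2_cut n f \<in> borel_measurable lborel" unfolding L2_cut_def by measurable
qed (simp add: L2_cut_def indicator_def)

lemma integrable_cut: "lsq f \<Longrightarrow> integrable lborel (L2_cut n f)"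
proof (rule Bochner_Integration.integrable_bound)
  assume f: "lsq f"
  note [measurable] = lsq_measurable[OF f]
  show "L2_cut n f \<in> borel_measurable lborel" unfolding L2_cut_def by measurable
  show "integrable lborel (\<lambda>x. indicator {- real n..real n} x + (cmod (f x))\<^sup>2)"
    using lsq_integrable[OF f] by (intro Bochner_Integration.integrable_add) auto
  have "cmod (L2_cut n f x) \<le> indicator {- real n..real n} x + (cmod (f x))\<^sup>2" for x
  proof -
    have "0 \<le> (cmod (f x) - 1)\<^sup>2" by simp
    then have "2 * cmod (f x) \<le> 1 + (cmod (f x))\<^sup>2" by (simp add: power2_diff)
    then have "cmod (f x) \<le> 1 + (cmod (f x))\<^sup>2" using zero_le_power2[of "cmod (f x)"] by linarith
    then show ?thesis by (auto simp: L2_cut_def indicator_def)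
  qed
  then show "AE x in lborel. norm (L2_cut n f x) \<le> norm (indicator {- real n..real n} x + (cmod (f x))\<^sup>2 :: real)"
    by (auto simp: indicator_def)
qed

lemma L2_cut_tendsto: "lsq f \<Longrightarrow> (\<lambda>n. to_L2 (L2_cut n f)) \<longlonglongrightarrow> to_L2 f"
proof (rule to_L2_dominated_convergence(3))
  assume f: "lsq f"
  show "lsq f" by fact
  show "L2_cut n f \<in> borel_measurable lborel" for n by (rule lsq_measurable[OF lsq_cut[OF f]])
  show "f \<in> borel_measurable lborel" by (rule lsq_measurable[OF f])
  show "(\<lambda>n. L2_cut n f x) \<longlonglongrightarrow> f x" for x
  proof (rule tendsto_eventually)
    obtain n where "\<bar>x\<bar> < real n" using reals_Archimedean2 by blast
    then show "\<forall>\<^sub>F i in sequentially. L2_cut i f x = f x"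
      by (intro eventually_mono[OF eventually_ge_at_top[of n]]) (auto simp: L2_cut_def indicator_def)
  qed
qed (simp add: L2_cut_def indicator_def)

lemma fourier_L2_altdef: "fourier_L2 x = lim (\<lambda>n. to_L2 (ft (L2_cut n (rep_L2 x))))"
  unfolding fourier_L2_def ft_def L2_cut_def set_lebesgue_integral_def by simp

text \<open>The isometry on integrable, square integrable functions makes the transforms of the
  truncations Cauchy, so the \<open>lim\<close> in the definition of \<open>fourier_L2\<close>
  exists, and it makes the limit independent of the approximating sequence. The algebraic rules
  below are read off along such sequences.\<close>

lemma fourier_L2_tendsto:
  assumes u: "\<And>n. integrable lborel (u n)" "\<And>n. lsq (u n)" and x: "(\<lambda>n. to_L2 (u n)) \<longlonglongrightarrow> x"
  shows "(\<lambda>n. to_L2 (ft (u n))) \<longlonglongrightarrow> fourier_L2 x"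
proof -
  have d: "norm (to_L2 (ft f) - to_L2 (ft g)) = norm (to_L2 f - to_L2 g)"
    if "integrable lborel f" "lsq f" "integrable lborel g" "lsq g" for f g
  proof -
    have "to_L2 (ft f) - to_L2 (ft g) = to_L2 (ft (\<lambda>x. f x - g x))"
      using that by (simp add: to_L2_diff plancherel_L1_L2 ft_diff)
    then show ?thesis using that by (simp add: plancherel_L1_L2 lsq_diff to_L2_diff)
  qed
  let ?X = "\<lambda>n. to_L2 (ft (L2_cut n (rep_L2 x)))"
  let ?Y = "\<lambda>n. to_L2 (L2_cut n (rep_L2 x))"
  have Y: "?Y \<longlonglongrightarrow> x" using L2_cut_tendsto[of "rep_L2 x"] by simp
  have "Cauchy ?Y" by (rule LIMSEQ_imp_Cauchy[OF Y])
  then have "Cauchy ?X" unfolding Cauchy_def dist_norm by (simp add: d integrable_cut lsq_cut)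
  then have X: "?X \<longlonglongrightarrow> fourier_L2 x"
    unfolding fourier_L2_altdef by (simp add: Cauchy_convergent_iff convergent_LIMSEQ_iff)
  have "(\<lambda>n. to_L2 (u n) - ?Y n) \<longlonglongrightarrow> 0" using tendsto_diff[OF x Y] by simp
  then have "(\<lambda>n. to_L2 (ft (u n)) - ?X n) \<longlonglongrightarrow> 0"
    by (simp flip: tendsto_norm_zero_iff[of "\<lambda>n. to_L2 (ft (u n)) - ?X n"] tendsto_norm_zero_iff[of "\<lambda>n. to_L2 (u n) - ?Y n"]
        add: d u integrable_cut lsq_cut)
  from tendsto_add[OF this X] show ?thesis by simp
qed

lemma fourier_L2_to_L2:
  "integrable lborel f \<Longrightarrow> lsq f \<Longrightarrow> fourier_L2 (to_L2 f) = to_L2 (ft f)"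
  using fourier_L2_tendsto[of "\<lambda>_. f" "to_L2 f"] by (simp add: LIMSEQ_const_iff)

lemma L2_approx:
  obtains u where "\<And>n::nat. integrable lborel (u n)" "\<And>n. lsq (u n)" "(\<lambda>n. to_L2 (u n)) \<longlonglongrightarrow> x"
  using that[of "\<lambda>n. L2_cut n (rep_L2 x)"] L2_cut_tendsto[of "rep_L2 x"] by (simp add: integrable_cut lsq_cut)

lemma fourier_L2_add: "fourier_L2 (x + y) = fourier_L2 x + fourier_L2 y"
proof -
  obtain u where u: "\<And>n::nat. integrable lborel (u n)" "\<And>n. lsq (u n)" "(\<lambda>n. to_L2 (u n)) \<longlonglongrightarrow> x" by (rule L2_approx[of x]) (rule that)
  obtain v where v: "\<And>n::nat. integrable lborel (v n)" "\<And>n. lsq (v n)" "(\<lambda>n. to_L2 (v n)) \<longlonglongrightarrow> y" by (rule L2_approx[of y]) (rule that)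
  have "(\<lambda>n. to_L2 (ft (\<lambda>x. u n x + v n x))) \<longlonglongrightarrow> fourier_L2 (x + y)"
    by (rule fourier_L2_tendsto) (use u v tendsto_add[OF u(3) v(3)] in \<open>auto simp: to_L2_add lsq_add\<close>)
  moreover have "(\<lambda>n. to_L2 (ft (u n)) + to_L2 (ft (v n))) \<longlonglongrightarrow> fourier_L2 x + fourier_L2 y"
    by (intro tendsto_add fourier_L2_tendsto u v)
  ultimately show ?thesis
    using u v by (simp add: to_L2_add plancherel_L1_L2 ft_add LIMSEQ_unique)
qed

lemma fourier_L2_norm [simp]: "norm (fourier_L2 x) = norm x"
proof -
  obtain u where u: "\<And>n::nat. integrable lborel (u n)" "\<And>n. lsq (u n)" "(\<lambda>n. to_L2 (u n)) \<longlonglongrightarrow> x" by (rule L2_approx[of x]) (rule that)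
  have "(\<lambda>n. norm (to_L2 (ft (u n)))) \<longlonglongrightarrow> norm (fourier_L2 x)" by (intro tendsto_norm fourier_L2_tendsto u)
  moreover have "(\<lambda>n. norm (to_L2 (u n))) \<longlonglongrightarrow> norm x" by (intro tendsto_norm u)
  ultimately show ?thesis using u by (simp add: plancherel_L1_L2 LIMSEQ_unique)
qed

lemma fourier_L2_scaleC: "fourier_L2 (scaleC_L2 c x) = scaleC_L2 c (fourier_L2 x)"
proof -
  obtain u where u: "\<And>n::nat. integrable lborel (u n)" "\<And>n. lsq (u n)" "(\<lambda>n. to_L2 (u n)) \<longlonglongrightarrow> x" by (rule L2_approx[of x]) (rule that)
  have bl: "bounded_linear (scaleC_L2 c)"
    unfolding scaleC_L2_eq[abs_def] by (rule bounded_linear_L2_mult[where B = "cmod c"]) auto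
  have sc: "scaleC_L2 c (to_L2 f) = to_L2 (\<lambda>x. c * f x)" if "lsq f" for f
    unfolding scaleC_L2_eq by (rule L2_mult_to_L2[where B = "cmod c"]) (use that in auto)
  have "(\<lambda>n. to_L2 (ft (\<lambda>x. c * u n x))) \<longlonglongrightarrow> fourier_L2 (scaleC_L2 c x)"
    by (rule fourier_L2_tendsto) (use u bounded_linear.tendsto[OF bl u(3)] in \<open>auto simp: sc lsq_cmult\<close>)
  moreover have "(\<lambda>n. scaleC_L2 c (to_L2 (ft (u n)))) \<longlonglongrightarrow> scaleC_L2 c (fourier_L2 x)"
    by (intro bounded_linear.tendsto[OF bl] fourier_L2_tendsto u)
  ultimately show ?thesis
    using u by (simp add: sc plancherel_L1_L2 ft_cmult LIMSEQ_unique)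
qed

lemma bounded_linear_fourier_L2: "bounded_linear fourier_L2"
proof (rule bounded_linear_intro[where K = 1])
  have sc: "scaleC_L2 (of_real r) y = r *\<^sub>R y" for y r
    unfolding scaleC_L2_eq using L2_mult_to_L2[of "\<lambda>_. of_real r" "\<bar>r\<bar>" "rep_L2 y"] to_L2_scaleR[of "rep_L2 y" r] by simp
  show "fourier_L2 (r *\<^sub>R x) = r *\<^sub>R fourier_L2 x" for r x
    using fourier_L2_scaleC[of "of_real r" x] by (simp add: sc)
qed (auto simp: fourier_L2_add)

section \<open>Adjoint and inverse of the transform\<close>

lemma isometry_inner:
  fixes T :: "'a::real_inner \<Rightarrow> 'b::real_inner"
  assumes "\<And>x y. T (x + y) = T x + T y" "\<And>x. norm (T x) = norm x"
  shows "inner (T x) (T y) = inner x y"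
  using assms(2)[of "x + y"] assms(2)[of x] assms(2)[of y] unfolding assms(1)
  by (simp add: dot_norm)

lemma fourier_L2_inner [simp]: "inner (fourier_L2 x) (fourier_L2 y) = inner x y"
  by (rule isometry_inner) (simp_all add: fourier_L2_add)

text \<open>The transform followed by a reflection. That this is the inverse will follow from
  adjointness, not from an inversion integral.\<close>

definition fourier_inv :: "L2 \<Rightarrow> L2" where
  "fourier_inv x = L2_affine 0 (-1) (fourier_L2 x)"

lemma fourier_inv_to_L2:
  "integrable lborel f \<Longrightarrow> lsq f \<Longrightarrow> fourier_inv (to_L2 f) = to_L2 (\<lambda>x. ft f (- x))"
  unfolding fourier_inv_def by (simp add: fourier_L2_to_L2 L2_affine_to_L2 plancherel_L1_L2)

lemma fourier_inv_norm [simp]: "norm (fourier_inv x) = norm x"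
  by (simp add: fourier_inv_def L2_affine_norm)

lemma fourier_inv_add: "fourier_inv (x + y) = fourier_inv x + fourier_inv y"
  by (simp add: fourier_inv_def fourier_L2_add L2_affine_add)

lemma fourier_inv_scaleR: "fourier_inv (r *\<^sub>R x) = r *\<^sub>R fourier_inv x"
  by (simp add: fourier_inv_def linear_simps(5)[OF bounded_linear_fourier_L2] L2_affine_scaleR)

lemma bounded_linear_fourier_inv: "bounded_linear fourier_inv"
  by (rule bounded_linear_intro[where K = 1]) (auto simp: fourier_inv_add fourier_inv_scaleR)

text \<open>On a dense class this is the multiplication formula for \<open>f\<close> and
  \<open>cnj g\<close>, since the real inner product is the real part of the integral of
  \<open>f\<close> times \<open>cnj g\<close>; the conjugation produces the reflection in
  \<open>fourier_inv\<close>.\<close>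

lemma fourier_L2_adjoint: "inner (fourier_L2 x) y = inner x (fourier_inv y)"
proof -
  obtain u where u: "\<And>n::nat. integrable lborel (u n)" "\<And>n. lsq (u n)" "(\<lambda>n. to_L2 (u n)) \<longlonglongrightarrow> x" by (rule L2_approx[of x]) (rule that)
  obtain v where v: "\<And>n::nat. integrable lborel (v n)" "\<And>n. lsq (v n)" "(\<lambda>n. to_L2 (v n)) \<longlonglongrightarrow> y" by (rule L2_approx[of y]) (rule that)
  have eq: "inner (to_L2 (ft f)) (to_L2 g) = inner (to_L2 f) (fourier_inv (to_L2 g))"
    if f: "integrable lborel f" "lsq f" and g: "integrable lborel g" "lsq g" for f g
  proof -
    have gc: "integrable lborel (\<lambda>x. cnj (g x))" using g by simp
    have l: "lsq (\<lambda>x. ft g (- x))"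
      using lsq_affine[of "-1" "ft g" 0] plancherel_L1_L2(1)[OF g] by simp
    have i1: "integrable lborel (\<lambda>x. ft f x * cnj (g x))"
      by (rule integrable_mult_bounded[OF _ ft_bound[OF f(1)] gc]) (use ft_measurable[OF f(1)] in simp)
    have i2: "integrable lborel (\<lambda>x. ft (\<lambda>x. cnj (g x)) x * f x)"
      by (rule integrable_mult_bounded[OF _ ft_bound[OF gc] f(1)]) (use ft_measurable[OF gc] in simp)
    have "inner (to_L2 (ft f)) (to_L2 g) = Re (LINT x|lborel. ft f x * cnj (g x))"
      by (subst integral_Re[OF i1, symmetric]) (simp add: inner_to_L2 plancherel_L1_L2 f g inner_complex_def)
    also have "\<dots> = Re (LINT x|lborel. ft (\<lambda>x. cnj (g x)) x * f x)"
      using ft_multiplication[OF f(1) gc] by (simp add: mult.commute)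
    also have "\<dots> = inner (to_L2 f) (fourier_inv (to_L2 g))"
      by (subst integral_Re[OF i2, symmetric])
         (simp add: inner_to_L2 fourier_inv_to_L2 f g l inner_complex_def ft_cnj mult.commute)
    finally show ?thesis .
  qed
  have "(\<lambda>n. inner (to_L2 (ft (u n))) (to_L2 (v n))) \<longlonglongrightarrow> inner (fourier_L2 x) y"
    by (intro tendsto_inner fourier_L2_tendsto u v)
  moreover have "(\<lambda>n. inner (to_L2 (u n)) (fourier_inv (to_L2 (v n)))) \<longlonglongrightarrow> inner x (fourier_inv y)"
    by (intro tendsto_inner bounded_linear.tendsto[OF bounded_linear_fourier_inv] u v)
  ultimately show ?thesis using u v by (simp add: eq LIMSEQ_unique)
qed

text \<open>An isometry followed by its adjoint is the identity. As \<open>fourier_inv\<close> is an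
  isometry as well, the same argument gives the other composition and with it surjectivity.\<close>

lemma fourier_inv_fourier [simp]: "fourier_inv (fourier_L2 x) = x"
proof -
  have "inner y (fourier_inv (fourier_L2 x)) = inner y x" for y by (simp flip: fourier_L2_adjoint)
  then show ?thesis by (metis vector_eq_ldot)
qed

lemma fourier_fourier_inv [simp]: "fourier_L2 (fourier_inv x) = x"
proof -
  have i: "inner (fourier_inv x) (fourier_inv y) = inner x y" for x y
    by (rule isometry_inner) (simp_all add: fourier_inv_add)
  have "inner (fourier_L2 (fourier_inv x)) y = inner x y" for y by (simp add: fourier_L2_adjoint i)
  then show ?thesis by (metis vector_eq_rdot)
qed

section \<open>The Schroedinger group\<close>

lemma scaleC_to_L2: "lsq f \<Longrightarrow> scaleC_L2 c (to_L2 f) = to_L2 (\<lambda>x. c * f x)"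
  unfolding scaleC_L2_eq by (rule L2_mult_to_L2[where B = "cmod c"]) auto

lemma bounded_linear_scaleC_L2: "bounded_linear (scaleC_L2 c)"
  unfolding scaleC_L2_eq[abs_def] by (rule bounded_linear_L2_mult[where B = "cmod c"]) auto

lemma norm_scaleC_L2 [simp]: "norm (scaleC_L2 c x) = cmod c * norm x"
  unfolding scaleC_L2_eq by (rule L2_mult_norm_eq) auto

definition schroedinger_symbol :: "real \<Rightarrow> real \<Rightarrow> complex" where
  "schroedinger_symbol t \<xi> = exp (- \<i> * complex_of_real (t * \<xi>\<^sup>2))"

lemma schroedinger_symbol_measurable [measurable]: "schroedinger_symbol t \<in> borel_measurable borel"
  unfolding schroedinger_symbol_def by measurable

lemma norm_schroedinger_symbol [simp]: "cmod (schroedinger_symbol t \<xi>) = 1"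
  by (simp add: schroedinger_symbol_def norm_exp_eq_Re)

text \<open>This discharges the \<open>THE\<close> in \<open>fourier_multiplier\<close>:
  surjectivity of the transform supplies a preimage, injectivity makes it unique.\<close>

lemma schroedinger_altdef:
  "schroedinger t x = fourier_inv (L2_mult (schroedinger_symbol t) (fourier_L2 x))"
  unfolding schroedinger_def fourier_multiplier_def
proof (rule the_equality)
  show "fourier_L2 (fourier_inv (L2_mult (schroedinger_symbol t) (fourier_L2 x)))
      = to_L2 (\<lambda>\<xi>. exp (- \<i> * complex_of_real (t * \<xi>\<^sup>2)) * rep_L2 (fourier_L2 x) \<xi>)"
    by (simp add: L2_mult_def schroedinger_symbol_def)
  fix g assume "fourier_L2 g = to_L2 (\<lambda>\<xi>. exp (- \<i> * complex_of_real (t * \<xi>\<^sup>2)) * rep_L2 (fourier_L2 x) \<xi>)"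
  then have "fourier_L2 g = L2_mult (schroedinger_symbol t) (fourier_L2 x)"
    by (simp add: L2_mult_def schroedinger_symbol_def)
  then show "g = fourier_inv (L2_mult (schroedinger_symbol t) (fourier_L2 x))"
    by (metis fourier_inv_fourier)
qed

lemma bounded_linear_schroedinger: "bounded_linear (schroedinger t)"
  unfolding schroedinger_altdef[abs_def]
  by (intro bounded_linear_compose[OF bounded_linear_fourier_inv]
      bounded_linear_compose[OF bounded_linear_L2_mult[where B = 1] bounded_linear_fourier_L2]) auto

lemma norm_schroedinger [simp]: "norm (schroedinger t x) = norm x"
  unfolding schroedinger_altdef by (simp add: L2_mult_norm_eq[where B = 1])

lemma schroedinger_schroedinger [simp]: "schroedinger s (schroedinger t x) = schroedinger (s + t) x"
proof -
  have "schroedinger_symbol s \<xi> * schroedinger_symbol t \<xi> = schroedinger_symbol (s + t) \<xi>" for \<xi>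
    unfolding schroedinger_symbol_def mult_exp_exp by (rule arg_cong[where f = exp]) (simp add: algebra_simps)
  then show ?thesis
    unfolding schroedinger_altdef by (simp add: L2_mult_L2_mult[where B = 1 and B' = 1])
qed

lemma schroedinger_0 [simp]: "schroedinger 0 x = x"
proof -
  have "schroedinger_symbol 0 = (\<lambda>\<xi>. 1)" by (simp add: schroedinger_symbol_def fun_eq_iff)
  then show ?thesis unfolding schroedinger_altdef by (simp add: L2_mult_one)
qed

lemma schroedinger_add: "schroedinger t (x + y) = schroedinger t x + schroedinger t y"
  by (rule linear_simps(1)[OF bounded_linear_schroedinger])

lemma schroedinger_diff: "schroedinger t (x - y) = schroedinger t x - schroedinger t y"
  by (rule linear_simps(2)[OF bounded_linear_schroedinger])

lemma schroedinger_inner: "inner (schroedinger t x) y = inner x (schroedinger (- t) y)"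
proof -
  have "inner (schroedinger t u) (schroedinger t v) = inner u v" for u v
    by (rule isometry_inner) (simp_all add: schroedinger_add)
  from this[of x "schroedinger (- t) y"] show ?thesis by simp
qed

lemma fourier_inv_scaleC: "fourier_inv (scaleC_L2 c x) = scaleC_L2 c (fourier_inv x)"
  by (metis fourier_L2_scaleC fourier_fourier_inv fourier_inv_fourier)

lemma schroedinger_scaleC: "schroedinger t (scaleC_L2 c x) = scaleC_L2 c (schroedinger t x)"
proof -
  have "L2_mult (schroedinger_symbol t) (scaleC_L2 c y) = scaleC_L2 c (L2_mult (schroedinger_symbol t) y)" for y
    using L2_mult_L2_mult[of "schroedinger_symbol t" 1 "\<lambda>_. c" "cmod c" y]
      L2_mult_L2_mult[of "\<lambda>_. c" "cmod c" "schroedinger_symbol t" 1 y]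
    by (simp add: scaleC_L2_eq mult.commute)
  then show ?thesis unfolding schroedinger_altdef by (simp add: fourier_L2_scaleC fourier_inv_scaleC)
qed

lemma continuous_schroedinger: "continuous_on A (\<lambda>t. schroedinger t x)"
proof -
  have "isCont (\<lambda>t. schroedinger t x) t" for t
    unfolding continuous_at_sequentially o_def
  proof (intro allI impI)
    fix u assume u: "u \<longlonglongrightarrow> t"
    have "(\<lambda>n. L2_mult (schroedinger_symbol (u n)) (fourier_L2 x)) \<longlonglongrightarrow> L2_mult (schroedinger_symbol t) (fourier_L2 x)"
      by (rule L2_mult_tendsto[where B = 1]) (use u in \<open>auto simp: schroedinger_symbol_def intro!: tendsto_intros\<close>)
    then show "(\<lambda>n. schroedinger (u n) x) \<longlonglongrightarrow> schroedinger t x"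
      unfolding schroedinger_altdef by (rule bounded_linear.tendsto[OF bounded_linear_fourier_inv])
  qed
  then show ?thesis by (simp add: continuous_at_imp_continuous_on)
qed

text \<open>Strong continuity handles the fixed vector \<open>f t\<close>, unitarity the increment
  \<open>f s - f t\<close>.\<close>

lemma continuous_schroedinger_apply:
  fixes f :: "real \<Rightarrow> L2"
  assumes "continuous_on UNIV g" "continuous_on UNIV f"
  shows "continuous_on UNIV (\<lambda>t. schroedinger (g t) (f t))"
proof -
  have "isCont (\<lambda>t. schroedinger (g t) (f t)) t" for t
  proof -
    have f: "isCont f t" and g: "isCont g t"
      using assms by (simp_all add: continuous_on_eq_continuous_at)
    have "isCont (\<lambda>t. schroedinger t (f t0)) s" for s t0
      using continuous_schroedinger[of UNIV "f t0"] by (simp add: continuous_on_eq_continuous_at)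
    then have 1: "(\<lambda>s. schroedinger (g s) (f t)) \<midarrow>t\<rightarrow> schroedinger (g t) (f t)"
      by (rule isCont_tendsto_compose) (use g in \<open>simp add: isCont_def\<close>)
    have "(\<lambda>s. norm (f s - f t)) \<midarrow>t\<rightarrow> 0" using f by (simp add: isCont_def LIM_zero tendsto_norm_zero)
    then have "(\<lambda>s. norm (schroedinger (g s) (f s - f t))) \<midarrow>t\<rightarrow> 0" by simp
    then have "(\<lambda>s. schroedinger (g s) (f s - f t)) \<midarrow>t\<rightarrow> 0" by (rule tendsto_norm_zero_cancel)
    from tendsto_add[OF this 1] show ?thesis by (simp add: isCont_def schroedinger_diff)
  qed
  then show ?thesis by (simp add: continuous_at_imp_continuous_on)
qed

section \<open>Complex Gaussians\<close>

lemma integral_gaussian: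
  assumes k: "k > 0"
  shows "integrable lborel (\<lambda>x. exp (- k * x\<^sup>2))" "(LINT x|lborel. exp (- k * x\<^sup>2)) = sqrt (pi / k)"
    "integrable lborel (\<lambda>x. exp (- k * x\<^sup>2) * x ^ n)"
proof -
  define \<sigma> where "\<sigma> = 1 / sqrt (2 * k)"
  have s: "\<sigma> > 0" "2 * \<sigma>\<^sup>2 = 1 / k" using k by (auto simp: \<sigma>_def power_divide)
  have "x\<^sup>2 / (2 * \<sigma>\<^sup>2) = k * x\<^sup>2" for x :: real unfolding s(2) by simp
  moreover have "2 * pi * \<sigma>\<^sup>2 = pi / k" using s(2) by (simp add: field_simps)
  ultimately have eq: "exp (- k * x\<^sup>2) = sqrt (pi / k) * normal_density 0 \<sigma> x" for x
    using k by (simp add: normal_density_def)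
  show "integrable lborel (\<lambda>x. exp (- k * x\<^sup>2))" unfolding eq using s by simp
  show "(LINT x|lborel. exp (- k * x\<^sup>2)) = sqrt (pi / k)" unfolding eq using s by simp
  have "integrable lborel (\<lambda>x. normal_density 0 \<sigma> x * (x - 0) ^ n)" by (rule integrable_normal_moment[OF s(1)])
  then show "integrable lborel (\<lambda>x. exp (- k * x\<^sup>2) * x ^ n)" unfolding eq mult.assoc by simp
qed

text \<open>Up to normalization the heat kernel at complex time \<open>z\<close>; the Schroedinger
  flow for time \<open>t\<close> is the boundary value \<open>z = \<i> t\<close>.\<close>

definition cgauss :: "complex \<Rightarrow> real \<Rightarrow> complex" where
  "cgauss z x = (LINT \<xi>|lborel. iexp (x * \<xi>) * exp (- z * complex_of_real (\<xi>\<^sup>2)))"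

lemma norm_exp_gauss: "cmod (exp (- z * complex_of_real (\<xi>\<^sup>2))) = exp (- Re z * \<xi>\<^sup>2)"
  unfolding norm_exp_eq_Re by (simp del: of_real_power)

lemma integrable_exp_gauss:
  assumes "Re z > 0"
  shows "integrable lborel (\<lambda>\<xi>. complex_of_real \<xi> ^ n * exp (- z * complex_of_real (\<xi>\<^sup>2)))"
proof (rule Bochner_Integration.integrable_bound)
  show "integrable lborel (\<lambda>\<xi>. exp (- Re z * \<xi>\<^sup>2) * \<xi> ^ n)" by (rule integral_gaussian(3)[OF assms])
  show "AE \<xi> in lborel. norm (complex_of_real \<xi> ^ n * exp (- z * complex_of_real (\<xi>\<^sup>2)))
      \<le> norm (exp (- Re z * \<xi>\<^sup>2) * \<xi> ^ n)"
    by (simp only: norm_mult norm_exp_gauss norm_power norm_of_real) (simp add: abs_mult power_abs mult.commute)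
qed measurable

lemma cgauss_integrable:
  assumes "Re z > 0"
  shows "integrable lborel (\<lambda>\<xi>. iexp (x * \<xi>) * (complex_of_real \<xi> ^ n * exp (- z * complex_of_real (\<xi>\<^sup>2))))"
  by (rule integrable_mult_bounded[where B = 1]) (use integrable_exp_gauss[OF assms] in auto)

text \<open>Integration by parts: the \<open>\<xi>\<close>-derivative of the integrand of
  \<open>cgauss\<close> has integral zero. Combined with the derivative in \<open>x\<close> this
  becomes a linear first-order equation for \<open>cgauss z\<close>.\<close>

lemma cgauss_parts:
  assumes z: "Re z > 0"
  shows "(LINT \<xi>|lborel. iexp (x * \<xi>) * (complex_of_real \<xi> * exp (- z * complex_of_real (\<xi>\<^sup>2))))
     = \<i> * complex_of_real x / (2 * z) * cgauss z x"
proof -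
  let ?F = "\<lambda>\<xi>. iexp (x * \<xi>) * exp (- z * complex_of_real (\<xi>\<^sup>2))"
  let ?G = "\<lambda>\<xi>. iexp (x * \<xi>) * (complex_of_real \<xi> * exp (- z * complex_of_real (\<xi>\<^sup>2)))"
  let ?f = "\<lambda>\<xi>. \<i> * complex_of_real x * ?F \<xi> - 2 * z * ?G \<xi>"
  have iF: "integrable lborel ?F" using cgauss_integrable[OF z, of x 0] by simp
  have iG: "integrable lborel ?G" using cgauss_integrable[OF z, of x 1] by simp
  have if_: "integrable lborel ?f" by (intro Bochner_Integration.integrable_diff integrable_mult_right iF iG)
  have lim: "(?F \<longlongrightarrow> 0) at_top" "(?F \<longlongrightarrow> 0) at_bot"
  proof -
    have *: "norm (?F \<xi>) = exp (- Re z * \<xi>\<^sup>2)" for \<xi>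
      by (simp only: norm_mult norm_exp_gauss) simp
    have "((\<lambda>\<xi>::real. exp (- Re z * \<xi>\<^sup>2)) \<longlongrightarrow> 0) at_top" "((\<lambda>\<xi>::real. exp (- Re z * \<xi>\<^sup>2)) \<longlongrightarrow> 0) at_bot"
      using z by real_asymp+
    then show "(?F \<longlongrightarrow> 0) at_top" "(?F \<longlongrightarrow> 0) at_bot"
      by (auto intro: tendsto_norm_zero_cancel simp only: *)
  qed
  have "(LBINT \<xi>=-\<infinity>..\<infinity>. ?f \<xi>) = 0 - 0"
  proof (rule interval_integral_FTC_integrable)
    fix \<xi> :: real
    show "(?F has_vector_derivative ?f \<xi>) (at \<xi>)"
    proof -
      have "((\<lambda>w. exp (\<i> * (complex_of_real x * w)) * exp (- z * w\<^sup>2)) has_field_derivative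
          exp (\<i> * (complex_of_real x * w)) * (exp (- z * w\<^sup>2) * (- z * (2 * w)))
          + exp (\<i> * (complex_of_real x * w)) * (\<i> * complex_of_real x) * exp (- z * w\<^sup>2)) (at w)" for w
        by (auto intro!: derivative_eq_intros)
      from has_vector_derivative_real_field[OF this[of "complex_of_real \<xi>"]]
      show ?thesis by (simp add: algebra_simps)
    qed
    show "isCont ?f \<xi>" by (intro continuous_intros)
  qed (use lim if_ in \<open>auto simp: ereal_tendsto_simps set_integrable_def\<close>)
  then have "integral\<^sup>L lborel ?f = 0" by (simp add: interval_lebesgue_integral_def set_lebesgue_integral_def)
  then have "\<i> * complex_of_real x * cgauss z x - 2 * z * integral\<^sup>L lborel ?G = 0"
    unfolding cgauss_def
    by (subst (asm) Bochner_Integration.integral_diff) (intro integrable_mult_right iF iG | simp only: integral_mult_right_zero)+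
  moreover have "z \<noteq> 0" using z by auto
  ultimately show ?thesis by (simp add: field_simps)
qed

text \<open>Differentiation under the integral through the Taylor bound
  \<open>|iexp \<theta> - 1 - \<i> \<theta>| \<le> \<theta>^2 / 2\<close>: the remainder is at most
  \<open>d^2\<close> times a finite second moment. The first-order term is evaluated by
  \<open>cgauss_parts\<close>.\<close>

lemma cgauss_deriv:
  assumes z: "Re z > 0"
  shows "(cgauss z has_vector_derivative (- complex_of_real x / (2 * z) * cgauss z x)) (at x)"
proof -
  let ?h = "\<lambda>\<xi>. exp (- z * complex_of_real (\<xi>\<^sup>2))"
  let ?E = "\<lambda>x \<xi>. iexp (x * \<xi>)"
  define D where "D = - complex_of_real x / (2 * z) * cgauss z x"
  define C where "C = (LINT \<xi>|lborel. \<xi>\<^sup>2 / 2 * cmod (?h \<xi>))"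
  have i0: "integrable lborel (\<lambda>\<xi>. ?E x \<xi> * ?h \<xi>)" for x using cgauss_integrable[OF z, of x 0] by simp
  have i1: "integrable lborel (\<lambda>\<xi>. \<i> * (?E x \<xi> * (complex_of_real \<xi> * ?h \<xi>)))"
    using cgauss_integrable[OF z, of x 1] by simp
  have i1d: "integrable lborel (\<lambda>\<xi>. d *\<^sub>R (\<i> * (?E x \<xi> * (complex_of_real \<xi> * ?h \<xi>))))" for d
    by (rule integrable_scaleR_right, rule i1)
  have i2: "integrable lborel (\<lambda>\<xi>. \<xi>\<^sup>2 / 2 * cmod (?h \<xi>))"
    using integrable_norm[OF integrable_exp_gauss[OF z, of 2]] by (simp add: norm_mult norm_power)
  have D: "D = (LINT \<xi>|lborel. \<i> * (?E x \<xi> * (complex_of_real \<xi> * ?h \<xi>)))"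
    unfolding integral_mult_right_zero cgauss_parts[OF z] D_def
    by (simp add: mult.assoc[symmetric])
  have bound: "cmod (cgauss z (x + d) - cgauss z x - d *\<^sub>R D) \<le> C * d\<^sup>2" for d
  proof -
    have eq: "cgauss z (x + d) - cgauss z x - d *\<^sub>R D
        = (LINT \<xi>|lborel. ?E (x + d) \<xi> * ?h \<xi> - ?E x \<xi> * ?h \<xi> - d *\<^sub>R (\<i> * (?E x \<xi> * (complex_of_real \<xi> * ?h \<xi>))))"
      unfolding cgauss_def D
      by (simp only: Bochner_Integration.integral_diff[OF Bochner_Integration.integrable_diff[OF i0 i0] i1d]
          Bochner_Integration.integral_diff[OF i0 i0] integral_scaleR_right)
    have "cmod (cgauss z (x + d) - cgauss z x - d *\<^sub>R D) \<le> (LINT \<xi>|lborel. cmod (?E (x + d) \<xi> * ?h \<xi> - ?E x \<xi> * ?h \<xi> - d *\<^sub>R (\<i> * (?E x \<xi> * (complex_of_real \<xi> * ?h \<xi>)))))"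
      unfolding eq by (rule integral_norm_bound)
    also have "\<dots> \<le> (LINT \<xi>|lborel. d\<^sup>2 * (\<xi>\<^sup>2 / 2 * cmod (?h \<xi>)))"
    proof (rule integral_mono)
      fix \<xi>
      have e: "?E (x + d) \<xi> * ?h \<xi> - ?E x \<xi> * ?h \<xi> - d *\<^sub>R (\<i> * (?E x \<xi> * (complex_of_real \<xi> * ?h \<xi>)))
          = ?E x \<xi> * ((iexp (d * \<xi>) - (\<Sum>k\<le>1. (\<i> * complex_of_real (d * \<xi>)) ^ k / fact k)) * ?h \<xi>)"
      proof -
        have "?E (x + d) \<xi> = ?E x \<xi> * iexp (d * \<xi>)"
          unfolding mult_exp_exp by (rule arg_cong[where f = exp]) (simp add: algebra_simps)
        moreover have "(\<Sum>k\<le>1. (\<i> * complex_of_real (d * \<xi>)) ^ k / fact k) = 1 + \<i> * complex_of_real (d * \<xi>)" by simp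
        moreover have "A * B * H - A * H - d *\<^sub>R (\<i> * (A * (complex_of_real \<xi> * H)))
            = A * ((B - (1 + \<i> * complex_of_real (d * \<xi>))) * H)" for A B H :: complex
          by (simp add: algebra_simps scaleR_conv_of_real)
        ultimately show ?thesis by (simp only:)
      qed
      have "cmod (?E (x + d) \<xi> * ?h \<xi> - ?E x \<xi> * ?h \<xi> - d *\<^sub>R (\<i> * (?E x \<xi> * (complex_of_real \<xi> * ?h \<xi>))))
          = cmod (iexp (d * \<xi>) - (\<Sum>k\<le>1. (\<i> * complex_of_real (d * \<xi>)) ^ k / fact k)) * cmod (?h \<xi>)"
        unfolding e norm_mult norm_exp_i by (rule mult_1)
      also have "\<dots> \<le> \<bar>d * \<xi>\<bar> ^ Suc 1 / fact (Suc 1) * cmod (?h \<xi>)"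
        by (intro mult_right_mono iexp_approx1) simp
      also have "\<dots> = d\<^sup>2 * (\<xi>\<^sup>2 / 2 * cmod (?h \<xi>))" by (simp add: power_mult_distrib abs_mult numeral_2_eq_2[symmetric])
      finally show "cmod (?E (x + d) \<xi> * ?h \<xi> - ?E x \<xi> * ?h \<xi> - d *\<^sub>R (\<i> * (?E x \<xi> * (complex_of_real \<xi> * ?h \<xi>))))
          \<le> d\<^sup>2 * (\<xi>\<^sup>2 / 2 * cmod (?h \<xi>))" .
    qed (intro integrable_norm Bochner_Integration.integrable_diff i0 i1 integrable_scaleR_right integrable_mult_right i2)+
    also have "\<dots> = C * d\<^sup>2" unfolding integral_mult_right_zero C_def by simp
    finally show ?thesis .
  qed
  have "((\<lambda>d. (cgauss z (x + d) - cgauss z x - d *\<^sub>R D) /\<^sub>R norm d) \<longlongrightarrow> 0) (at 0)"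
  proof (rule Lim_null_comparison[OF always_eventually[OF allI]])
    fix d :: real
    show "norm ((cgauss z (x + d) - cgauss z x - d *\<^sub>R D) /\<^sub>R norm d) \<le> C * \<bar>d\<bar>"
    proof (cases "d = 0")
      case False
      have "norm ((cgauss z (x + d) - cgauss z x - d *\<^sub>R D) /\<^sub>R norm d)
          = cmod (cgauss z (x + d) - cgauss z x - d *\<^sub>R D) / \<bar>d\<bar>"
        by (simp only: norm_scaleR real_norm_def abs_inverse abs_abs divide_inverse_commute)
      also have "\<dots> \<le> C * d\<^sup>2 / \<bar>d\<bar>" by (intro divide_right_mono bound) simp
      also have "C * d\<^sup>2 / \<bar>d\<bar> = C * \<bar>d\<bar>" using False by (auto simp: power2_eq_square abs_if)
      finally show ?thesis .
    qed simp
    have "((\<lambda>d::real. C * \<bar>d\<bar>) \<longlongrightarrow> C * \<bar>0\<bar>) (at 0)" by (intro tendsto_intros)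
    then show "((\<lambda>d::real. C * \<bar>d\<bar>) \<longlongrightarrow> 0) (at 0)" by simp
  qed
  from tendsto_norm_zero[OF this] show ?thesis
    unfolding has_vector_derivative_def has_derivative_at D_def[symmetric]
    by (simp add: bounded_linear_scaleR_left divide_inverse_commute)
qed

text \<open>An integrating factor solves the equation of \<open>cgauss_deriv\<close>, in place of a
  contour shift.\<close>

lemma cgauss_eq:
  assumes z: "Re z > 0"
  shows "cgauss z x = cgauss z 0 * exp (- complex_of_real (x\<^sup>2) / (4 * z))"
proof -
  have z0: "z \<noteq> 0" using z by auto
  let ?J = "\<lambda>x. cgauss z x * exp (complex_of_real (x\<^sup>2) / (4 * z))"
  have "(?J has_vector_derivative 0) (at x within UNIV)" for x
  proof -
    have "(?J has_vector_derivative
        (cgauss z x * (exp (complex_of_real (x\<^sup>2) / (4 * z)) * (complex_of_real (2 * x) / (4 * z)))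
         + (- complex_of_real x / (2 * z) * cgauss z x) * exp (complex_of_real (x\<^sup>2) / (4 * z)))) (at x)"
    proof (rule has_vector_derivative_mult[OF cgauss_deriv[OF z]])
      show "((\<lambda>x. exp (complex_of_real (x\<^sup>2) / (4 * z))) has_vector_derivative
          exp (complex_of_real (x\<^sup>2) / (4 * z)) * (complex_of_real (2 * x) / (4 * z))) (at x)"
      proof -
        have "((\<lambda>w. exp (w\<^sup>2 / (4 * z))) has_field_derivative exp (w\<^sup>2 / (4 * z)) * (2 * w / (4 * z))) (at w)" for w
          using z0 by (auto intro!: derivative_eq_intros)
        from has_vector_derivative_real_field[OF this[of "complex_of_real x"]] show ?thesis by simp
      qed
    qed
    then show ?thesis using z0 by (simp add: field_simps)
  qed
  then have "?J x = ?J 0"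
    using has_vector_derivative_zero_constant[of UNIV ?J] by (metis UNIV_I convex_UNIV)
  then have "cgauss z x * exp (complex_of_real (x\<^sup>2) / (4 * z)) = cgauss z 0" by simp
  then show ?thesis by (simp add: exp_minus divide_simps)
qed

text \<open>Only the modulus is needed, so the constant can be read off from the Plancherel identity; this
  avoids choosing a branch of the square root of \<open>pi / z\<close>.\<close>

lemma cmod_cgauss:
  assumes z: "Re z > 0"
  shows "(cmod (cgauss z x))\<^sup>2 = pi / cmod z * exp (- (Re z / (2 * (cmod z)\<^sup>2)) * x\<^sup>2)"
proof -
  have z0: "cmod z > 0" using z by auto
  \<comment> \<open>The decay rate of the squared modulus, from
    \<open>|exp (- x^2 / (4 z))|^2 = exp (- Re (1 / z) x^2 / 2)\<close>.\<close>
  define k where "k = Re z / (2 * (cmod z)\<^sup>2)"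
  have k: "k > 0" using z z0 by (simp add: k_def)
  have eq: "(cmod (cgauss z x))\<^sup>2 = (cmod (cgauss z 0))\<^sup>2 * exp (- k * x\<^sup>2)" for x
  proof -
    define w where "w = - complex_of_real (x\<^sup>2) / (4 * z)"
    have re: "Re (complex_of_real r * u) = r * Re u" for r u by simp
    have "w = complex_of_real (- (x\<^sup>2) / 4) * (1 / z)" unfolding w_def by simp
    then have "Re w = - (x\<^sup>2) / 4 * Re (1 / z)" by (simp only: re)
    also have "Re (1 / z) = Re z / (cmod z)\<^sup>2" by (simp add: Re_divide cmod_power2)
    finally have Rew: "Re w = - (x\<^sup>2) / 4 * (Re z / (cmod z)\<^sup>2)" .
    have "(cmod (exp w))\<^sup>2 = exp (2 * Re w)" unfolding norm_exp_eq_Re by (rule exp_double[symmetric])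
    also have "2 * Re w = - k * x\<^sup>2" unfolding Rew k_def by simp
    finally have "(cmod (exp w))\<^sup>2 = exp (- k * x\<^sup>2)" .
    moreover have "cgauss z x = cgauss z 0 * exp w" unfolding w_def by (rule cgauss_eq[OF z])
    ultimately show ?thesis by (simp add: norm_mult power_mult_distrib)
  qed
  let ?h = "\<lambda>\<xi>. exp (- z * complex_of_real (\<xi>\<^sup>2))"
  have ih: "integrable lborel ?h" using integrable_exp_gauss[OF z, of 0] by simp
  have nh: "(cmod (?h \<xi>))\<^sup>2 = exp (- (2 * Re z) * \<xi>\<^sup>2)" for \<xi>
    unfolding norm_exp_gauss by (subst exp_double[symmetric]) (simp add: algebra_simps)
  have lh: "lsq ?h" unfolding lsq_def nh using integral_gaussian(1)[of "2 * Re z"] z by simp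
  have "(norm (to_L2 ?h))\<^sup>2 = sqrt (pi / (2 * Re z))"
    unfolding norm_to_L2_sq[OF lh] nh by (rule integral_gaussian(2)) (use z in simp)
  moreover have "(norm (to_L2 (ft ?h)))\<^sup>2 = (cmod (cgauss z 0))\<^sup>2 / (2 * pi) * sqrt (pi / k)"
  proof -
    have "ft ?h x = complex_of_real (1 / sqrt (2 * pi)) * cgauss z (- x)" for x
      by (simp add: ft_def cgauss_def mult_ac)
    then have "(cmod (ft ?h x))\<^sup>2 = (cmod (cgauss z 0))\<^sup>2 / (2 * pi) * exp (- k * x\<^sup>2)" for x
      by (simp add: norm_mult norm_divide power_mult_distrib power_divide eq[of "- x"])
    then show ?thesis
      unfolding norm_to_L2_sq[OF plancherel_L1_L2(1)[OF ih lh]]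
      by (simp only: integral_mult_right_zero integral_gaussian(2)[OF k])
  qed
  ultimately have "(cmod (cgauss z 0))\<^sup>2 / (2 * pi) * sqrt (pi / k) = sqrt (pi / (2 * Re z))"
    using plancherel_L1_L2(2)[OF ih lh] by simp
  moreover have "sqrt (pi / k) = 2 * cmod z * sqrt (pi / (2 * Re z))"
  proof -
    have "pi / k = (2 * cmod z)\<^sup>2 * (pi / (2 * Re z))" using z z0 by (simp add: k_def field_simps power2_eq_square)
    then have "sqrt (pi / k) = sqrt ((2 * cmod z)\<^sup>2) * sqrt (pi / (2 * Re z))" by (simp only: real_sqrt_mult)
    then show ?thesis by (simp only: real_sqrt_abs) simp
  qed
  ultimately have "((cmod (cgauss z 0))\<^sup>2 / (2 * pi) * (2 * cmod z)) * sqrt (pi / (2 * Re z)) = 1 * sqrt (pi / (2 * Re z))"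
    by (simp only: mult.assoc mult_1)
  then have "(cmod (cgauss z 0))\<^sup>2 / (2 * pi) * (2 * cmod z) = 1"
    by (rule mult_right_cancel[THEN iffD1, rotated]) (use z in simp)
  then have "(cmod (cgauss z 0))\<^sup>2 = pi / cmod z" using z0 by (simp add: field_simps)
  then show ?thesis using eq[of x] by (simp add: k_def)
qed

section \<open>Gaussian packets and their free evolution\<close>

definition packet_hat :: "complex \<Rightarrow> real \<Rightarrow> real \<Rightarrow> complex" where
  "packet_hat z y \<xi> = exp (- \<i> * complex_of_real (y * \<xi>)) * exp (- z * complex_of_real (\<xi>\<^sup>2))"

definition packet :: "complex \<Rightarrow> real \<Rightarrow> L2" where
  "packet z y = fourier_inv (to_L2 (packet_hat z y))"

definition packet_fun :: "complex \<Rightarrow> real \<Rightarrow> real \<Rightarrow> complex" where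
  "packet_fun z y x = complex_of_real (1 / sqrt (2 * pi)) * cgauss z (x - y)"

lemma packet_hat_integrable:
  assumes z: "Re z > 0"
  shows "integrable lborel (packet_hat z y)" "lsq (packet_hat z y)"
proof -
  show "integrable lborel (packet_hat z y)"
    unfolding packet_hat_def
    by (rule integrable_mult_bounded[where B = 1]) (use integrable_exp_gauss[OF z, of 0] in auto)
  have "(cmod (packet_hat z y \<xi>))\<^sup>2 = exp (- (2 * Re z) * \<xi>\<^sup>2)" for \<xi>
  proof -
    have "cmod (packet_hat z y \<xi>) = exp (- Re z * \<xi>\<^sup>2)"
      unfolding packet_hat_def norm_mult norm_exp_gauss by simp
    then have "(cmod (packet_hat z y \<xi>))\<^sup>2 = exp (2 * (- Re z * \<xi>\<^sup>2))" by (simp only: exp_double)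
    then show ?thesis by (simp add: mult.assoc)
  qed
  moreover have "packet_hat z y \<in> borel_measurable lborel" unfolding packet_hat_def by measurable
  ultimately show "lsq (packet_hat z y)"
    unfolding lsq_def using integral_gaussian(1)[of "2 * Re z"] z by simp
qed

lemma packet_eq:
  assumes z: "Re z > 0"
  shows "packet z y = to_L2 (packet_fun z y)" "lsq (packet_fun z y)"
proof -
  have eq: "ft (packet_hat z y) (- x) = packet_fun z y x" for x
  proof -
    have "exp (- \<i> * complex_of_real (\<xi> * - x)) * (exp (- \<i> * complex_of_real (y * \<xi>)) * E)
        = iexp ((x - y) * \<xi>) * E" for \<xi> E
    proof -
      have "exp (- \<i> * complex_of_real (\<xi> * - x)) * exp (- \<i> * complex_of_real (y * \<xi>))
          = iexp ((x - y) * \<xi>)"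
        unfolding mult_exp_exp by (rule arg_cong[where f = exp]) (simp add: algebra_simps)
      then show ?thesis by (simp only: mult.assoc[symmetric])
    qed
    then show ?thesis unfolding ft_def packet_hat_def packet_fun_def cgauss_def by (simp only:)
  qed
  show "packet z y = to_L2 (packet_fun z y)"
    unfolding packet_def by (simp add: fourier_inv_to_L2 packet_hat_integrable[OF z] eq[abs_def])
  show "lsq (packet_fun z y)"
    using lsq_affine[of "-1" "ft (packet_hat z y)" 0] plancherel_L1_L2(1)[OF packet_hat_integrable[OF z]]
    by (simp add: eq[abs_def])
qed

text \<open>In Fourier variables the flow multiplies by \<open>exp (- \<i> t \<xi>^2)\<close>, which
  merely shifts \<open>z\<close>: its imaginary part records the elapsed time, while
  \<open>Re z\<close> and the centre \<open>y\<close> are preserved.\<close>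

lemma schroedinger_packet:
  assumes z: "Re z > 0"
  shows "schroedinger t (packet z y) = packet (z + \<i> * complex_of_real t) y"
proof -
  have "schroedinger_symbol t \<xi> * packet_hat z y \<xi> = packet_hat (z + \<i> * complex_of_real t) y \<xi>" for \<xi>
  proof -
    have "schroedinger_symbol t \<xi> * exp (- z * complex_of_real (\<xi>\<^sup>2)) = exp (- (z + \<i> * complex_of_real t) * complex_of_real (\<xi>\<^sup>2))"
      unfolding schroedinger_symbol_def mult_exp_exp by (rule arg_cong[where f = exp]) (simp add: algebra_simps)
    then show ?thesis unfolding packet_hat_def by (metis mult.left_commute)
  qed
  then show ?thesis
    unfolding schroedinger_altdef packet_def
    by (simp add: L2_mult_to_L2[where B = 1] packet_hat_integrable[OF z])
qed

lemma packet_cmod: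
  assumes z: "Re z > 0"
  shows "(cmod (packet_fun z y x))\<^sup>2 = 1 / (2 * cmod z) * exp (- (Re z / (2 * (cmod z)\<^sup>2)) * (x - y)\<^sup>2)"
  unfolding packet_fun_def norm_mult power_mult_distrib cmod_cgauss[OF z]
  by (simp add: power_divide norm_divide)

lemma norm_packet:
  assumes z: "Re z > 0"
  shows "(norm (packet z y))\<^sup>2 = sqrt (pi / (2 * Re z))"
proof -
  have "cmod (packet_hat z y \<xi>) = exp (- Re z * \<xi>\<^sup>2)" for \<xi>
    unfolding packet_hat_def norm_mult norm_exp_gauss by simp
  then have "(cmod (packet_hat z y \<xi>))\<^sup>2 = exp (2 * (- Re z * \<xi>\<^sup>2))" for \<xi> by (simp only: exp_double)
  then have "(cmod (packet_hat z y \<xi>))\<^sup>2 = exp (- (2 * Re z) * \<xi>\<^sup>2)" for \<xi> by (simp add: mult.assoc)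
  then show ?thesis
    unfolding packet_def fourier_inv_norm norm_to_L2_sq[OF packet_hat_integrable(2)[OF z]]
    using integral_gaussian(2)[of "2 * Re z"] z by simp
qed

section \<open>Essential bounds and the dispersive estimate\<close>

text \<open>A predicate with a real bound, so that estimates avoid arithmetic in the extended reals;
  \<open>Linf_norm_le_iff\<close> returns to \<open>Linf_norm\<close>.\<close>

definition linf_le :: "L2 \<Rightarrow> real \<Rightarrow> bool" where
  "linf_le x K \<longleftrightarrow> (AE t in lborel. cmod (rep_L2 x t) \<le> K)"

lemma linf_le_to_L2: "lsq f \<Longrightarrow> linf_le (to_L2 f) K \<longleftrightarrow> (AE t in lborel. cmod (f t) \<le> K)"
proof -
  assume "lsq f"
  then have r: "AE t in lborel. rep_L2 (to_L2 f) t = f t" by (rule rep_to_L2)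
  show ?thesis
    unfolding linf_le_def
  proof
    assume "AE t in lborel. cmod (rep_L2 (to_L2 f) t) \<le> K"
    with r show "AE t in lborel. cmod (f t) \<le> K" by eventually_elim simp
  next
    assume "AE t in lborel. cmod (f t) \<le> K"
    with r show "AE t in lborel. cmod (rep_L2 (to_L2 f) t) \<le> K" by eventually_elim simp
  qed
qed

lemma rep_L2_add: "AE t in lborel. rep_L2 (x + y) t = rep_L2 x t + rep_L2 y t"
  using rep_to_L2[of "\<lambda>t. rep_L2 x t + rep_L2 y t"] to_L2_add[of "rep_L2 x" "rep_L2 y"] by (simp add: lsq_add)

lemma rep_L2_diff: "AE t in lborel. rep_L2 (x - y) t = rep_L2 x t - rep_L2 y t"
  using rep_to_L2[of "\<lambda>t. rep_L2 x t - rep_L2 y t"] to_L2_diff[of "rep_L2 x" "rep_L2 y"] by (simp add: lsq_diff)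

lemma rep_L2_scaleC: "AE t in lborel. rep_L2 (scaleC_L2 c x) t = c * rep_L2 x t"
  using rep_to_L2[of "\<lambda>t. c * rep_L2 x t"] scaleC_to_L2[of "rep_L2 x" c] by (simp add: lsq_cmult)

lemma linf_le_mono: "linf_le x K \<Longrightarrow> K \<le> K' \<Longrightarrow> linf_le x K'"
  unfolding linf_le_def by (auto elim!: eventually_mono)

lemma linf_le_add:
  assumes "linf_le x K" "linf_le y K'" shows "linf_le (x + y) (K + K')"
  using assms rep_L2_add[of x y] unfolding linf_le_def
  by eventually_elim (auto intro: norm_triangle_mono)

lemma linf_le_scaleC:
  assumes "linf_le x K" shows "linf_le (scaleC_L2 c x) (cmod c * K)"
  using assms rep_L2_scaleC[of c x] unfolding linf_le_def
  by eventually_elim (auto simp: norm_mult intro: mult_left_mono)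

lemma uminus_L2_eq: "- x = scaleC_L2 (-1) x"
proof -
  obtain f where f: "lsq f" "x = to_L2 f" by (meson L2_cases)
  show ?thesis using to_L2_scaleR[OF f(1), of "-1"] by (simp add: f scaleC_to_L2)
qed

lemma L1_norm_nonneg [simp]: "0 \<le> L1_norm f"
  unfolding L1_norm_def by (rule integral_nonneg_AE) simp

lemma inner_le_linf:
  assumes x: "linf_le x K" and g: "integrable lborel g" "lsq g"
  shows "inner x (to_L2 g) \<le> K * L1_norm g"
proof -
  have "inner x (to_L2 g) = (LINT t|lborel. inner (rep_L2 x t) (g t))"
    using inner_to_L2[of "rep_L2 x" g] g by simp
  also have "\<dots> \<le> (LINT t|lborel. K * cmod (g t))"
  proof (rule integral_mono_AE)
    show "AE t in lborel. inner (rep_L2 x t) (g t) \<le> K * cmod (g t)"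
      using x unfolding linf_le_def
    proof eventually_elim
      case (elim t)
      have "inner (rep_L2 x t) (g t) \<le> cmod (rep_L2 x t) * cmod (g t)" by (rule norm_cauchy_schwarz)
      also have "\<dots> \<le> K * cmod (g t)" by (rule mult_right_mono[OF elim]) simp
      finally show ?case .
    qed
  qed (use g in \<open>auto intro: lsq_inner_integrable\<close>)
  finally show ?thesis by (simp add: L1_norm_def)
qed

text \<open>Testing against integrable functions turns an essential bound into a family of inequalities that are
  preserved by limits and Bochner integrals in \<open>L\<^sup>2\<close>.\<close>

lemma linf_leI:
  assumes K: "0 \<le> K"
    and *: "\<And>g. integrable lborel g \<Longrightarrow> lsq g \<Longrightarrow> inner x (to_L2 g) \<le> K * L1_norm g"
  shows "linf_le x K"
proof -
  let ?f = "rep_L2 x"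
  have "AE t in lborel. \<not> (cmod (?f t) > K \<and> t \<in> {- real n<..<real n})" for n :: nat
  proof -
    \<comment> \<open>The test function \<open>g\<close> is the phase of \<open>?f\<close> on a
      bounded piece \<open>E\<close> of the level set above \<open>K\<close>. Pairing with it, minus
      \<open>K * L1_norm g\<close>, gives the integral over \<open>E\<close> of the positive
      function \<open>|f| - K\<close>, so the hypothesis forces \<open>E\<close> to be null.\<close>
    define E where "E = {t. cmod (?f t) > K} \<inter> {- real n<..<real n}"
    have E [measurable]: "E \<in> sets borel" unfolding E_def by measurable
    define g where "g t = sgn (?f t) * indicator E t" for t
    have [measurable]: "g \<in> borel_measurable lborel" unfolding g_def sgn_div_norm by measurable
    have ind: "lsq (\<lambda>t. 1 * indicator E t)"
      unfolding E_def by (rule lsq_indicator) measurable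
    have g_norm: "cmod (g t) = indicator E t" for t
      using K by (auto simp: g_def E_def indicator_def norm_sgn)
    have lg: "lsq g" by (rule lsq_bound[OF _ ind]) (auto simp: g_norm norm_mult indicator_def)
    have fin: "emeasure lborel E < \<infinity>"
      by (rule le_less_trans[OF emeasure_mono[of _ "{- real n<..<real n}"]]) (auto simp: E_def)
    have iE: "integrable lborel (indicator E :: real \<Rightarrow> real)" using fin by (simp add: integrable_indicator_iff)
    have ig: "integrable lborel g"
      by (rule Bochner_Integration.integrable_bound[OF iE]) (auto simp: g_norm indicator_def)
    have inn: "inner (?f t) (g t) = cmod (?f t) * indicator E t" for t
    proof (cases "t \<in> E")
      case True
      then have "?f t \<noteq> 0" using K by (auto simp: E_def)
      have "inner (?f t) (sgn (?f t)) = cmod (?f t)"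
        unfolding sgn_div_norm inner_scaleR_right power2_norm_eq_inner[symmetric]
        using \<open>?f t \<noteq> 0\<close> by (simp add: power2_eq_square)
      then show ?thesis using True by (simp add: g_def)
    qed (simp add: g_def)
    have i1: "integrable lborel (\<lambda>t. cmod (?f t) * indicator E t)"
      using lsq_inner_integrable[OF lsq_rep_L2[of x] lg] by (simp add: inn)
    have i2: "integrable lborel (\<lambda>t. (cmod (?f t) - K) * indicator E t)"
      unfolding left_diff_distrib by (intro Bochner_Integration.integrable_diff i1 integrable_mult_right iE)
    have "(LINT t|lborel. (cmod (?f t) - K) * indicator E t) = inner x (to_L2 g) - K * L1_norm g"
      using inner_to_L2[OF lsq_rep_L2[of x] lg] i1 iE
      by (simp add: inn L1_norm_def g_norm left_diff_distrib)
    moreover have "0 \<le> (LINT t|lborel. (cmod (?f t) - K) * indicator E t)"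
      by (rule integral_nonneg_AE) (auto simp: E_def indicator_def)
    ultimately have "(LINT t|lborel. (cmod (?f t) - K) * indicator E t) = 0" using *[OF ig lg] by simp
    then have "AE t in lborel. (cmod (?f t) - K) * indicator E t = 0"
      by (subst (asm) integral_nonneg_eq_0_iff_AE[OF i2]) (auto simp: E_def indicator_def)
    then show ?thesis by eventually_elim (auto simp: E_def indicator_def)
  qed
  then have "AE t in lborel. \<forall>n::nat. \<not> (cmod (?f t) > K \<and> t \<in> {- real n<..<real n})"
    unfolding AE_all_countable by (rule allI)
  then show ?thesis unfolding linf_le_def
  proof eventually_elim
    case (elim t)
    obtain n :: nat where "\<bar>t\<bar> < real n" using reals_Archimedean2 by blast
    then have "t \<in> {- real n<..<real n}" by auto
    then show ?case using elim not_less by blast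
  qed
qed

lemma linf_le_lim:
  assumes "0 \<le> K" "\<And>n. linf_le (u n) K" "(u \<longlongrightarrow> x) F" "F \<noteq> bot"
  shows "linf_le x K"
proof (rule linf_leI[OF assms(1)])
  fix g assume g: "integrable lborel g" "lsq g"
  show "inner x (to_L2 g) \<le> K * L1_norm g"
    by (rule tendsto_upperbound[OF tendsto_inner[OF assms(3) tendsto_const]])
       (use inner_le_linf[OF assms(2) g] assms(4) in auto)
qed

lemma linf_le_integral:
  fixes h :: "'a \<Rightarrow> L2"
  assumes h: "integrable M h" and k: "integrable M k" "AE s in M. 0 \<le> k s" "AE s in M. linf_le (h s) (k s)"
  shows "linf_le (integral\<^sup>L M h) (integral\<^sup>L M k)"
proof (rule linf_leI)
  show "0 \<le> integral\<^sup>L M k" by (rule integral_nonneg_AE[OF k(2)])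
  fix g assume g: "integrable lborel g" "lsq g"
  have "inner (integral\<^sup>L M h) (to_L2 g) = (LINT s|M. inner (h s) (to_L2 g))"
    using h by simp
  also have "\<dots> \<le> (LINT s|M. k s * L1_norm g)"
    by (rule integral_mono_AE) (use h k(1,3) inner_le_linf[OF _ g] in \<open>auto elim!: eventually_mono\<close>)
  also have "\<dots> = integral\<^sup>L M k * L1_norm g" by simp
  finally show "inner (integral\<^sup>L M h) (to_L2 g) \<le> integral\<^sup>L M k * L1_norm g" .
qed

text \<open>The heat regularization \<open>Re z > 0\<close> makes the multiplier integrable, so that the multiplication formula
  exhibits a bounded convolution kernel.\<close>

lemma heat_schroedinger_bound:
  assumes f: "integrable lborel f" "lsq f" and z: "Re z > 0"
  shows "linf_le (fourier_inv (L2_mult (\<lambda>\<xi>. exp (- z * complex_of_real (\<xi>\<^sup>2))) (fourier_L2 (to_L2 f))))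
    (L1_norm f / sqrt (cmod z))"
proof -
  let ?m = "\<lambda>\<xi>. exp (- z * complex_of_real (\<xi>\<^sup>2))"
  have m1: "cmod (?m \<xi>) \<le> 1" for \<xi> unfolding norm_exp_gauss using z by simp
  have mm: "?m \<in> borel_measurable borel" by measurable
  have im: "integrable lborel ?m" using integrable_exp_gauss[OF z, of 0] by simp
  note [measurable] = ft_measurable[OF f(1)]
  let ?g = "\<lambda>\<xi>. ?m \<xi> * ft f \<xi>"
  have lg: "lsq ?g" by (rule lsq_mult[OF mm m1 plancherel_L1_L2(1)[OF f]])
  have ig: "integrable lborel ?g"
    using integrable_mult_bounded[OF _ ft_bound[OF f(1)] im] by (simp add: mult.commute)
  have bnd: "cmod (ft ?g (- x)) \<le> L1_norm f / sqrt (cmod z)" for x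
  proof -
    have ih: "integrable lborel (packet_hat z (- x))" by (rule packet_hat_integrable(1)[OF z])
    have "(LINT \<xi>|lborel. exp (- \<i> * complex_of_real (\<xi> * - x)) * ?g \<xi>) = (LINT \<xi>|lborel. ft f \<xi> * packet_hat z (- x) \<xi>)"
      by (rule Bochner_Integration.integral_cong[OF refl]) (simp add: packet_hat_def mult_ac)
    also have "\<dots> = (LINT \<xi>|lborel. ft (packet_hat z (- x)) \<xi> * f \<xi>)"
      using ft_multiplication[OF f(1) ih] by (simp add: mult.commute)
    finally have eq: "(LINT \<xi>|lborel. exp (- \<i> * complex_of_real (\<xi> * - x)) * ?g \<xi>) = (LINT \<xi>|lborel. ft (packet_hat z (- x)) \<xi> * f \<xi>)" .
    \<comment> \<open>This is the convolution kernel: the transform of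
      \<open>packet_hat z (- x)\<close> at \<open>\<xi>\<close> is the packet centred at
      \<open>\<xi>\<close>, evaluated at \<open>x\<close>. The factor \<open>1 / 2\<close> in its
      squared modulus is given away.\<close>
    have b: "cmod (ft (packet_hat z (- x)) \<xi>) \<le> 1 / sqrt (cmod z)" for \<xi>
    proof -
      have "exp (- \<i> * complex_of_real (\<eta> * \<xi>)) * (exp (- \<i> * complex_of_real (- x * \<eta>)) * E)
        = iexp ((x - \<xi>) * \<eta>) * E" for \<eta> E
      proof -
        have "exp (- \<i> * complex_of_real (\<eta> * \<xi>)) * exp (- \<i> * complex_of_real (- x * \<eta>))
            = iexp ((x - \<xi>) * \<eta>)"
          unfolding mult_exp_exp by (rule arg_cong[where f = exp]) (simp add: algebra_simps)
        then show ?thesis by (simp only: mult.assoc[symmetric])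
      qed
      then have "ft (packet_hat z (- x)) \<xi> = packet_fun z \<xi> x"
        unfolding ft_def packet_hat_def packet_fun_def cgauss_def by (simp only:)
      then have "(cmod (ft (packet_hat z (- x)) \<xi>))\<^sup>2 = 1 / (2 * cmod z) * exp (- (Re z / (2 * (cmod z)\<^sup>2)) * (x - \<xi>)\<^sup>2)"
        by (simp only: packet_cmod[OF z])
      also have "\<dots> \<le> 1 / (2 * cmod z) * 1" using z by (intro mult_left_mono) auto
      also have "\<dots> \<le> 1 / cmod z" using z by (auto simp: divide_simps)
      also have "\<dots> = (1 / sqrt (cmod z))\<^sup>2" by (simp add: power_divide)
      finally show ?thesis by (rule power2_le_imp_le) simp
    qed
    have "cmod (ft ?g (- x)) \<le> 1 * cmod (LINT \<xi>|lborel. ft (packet_hat z (- x)) \<xi> * f \<xi>)"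
      unfolding ft_def[of ?g] eq norm_mult
    proof (rule mult_right_mono)
      have "1 \<le> sqrt (2 * pi)" using pi_gt3 by simp
      then show "cmod (complex_of_real (1 / sqrt (2 * pi))) \<le> 1" by (simp add: norm_divide)
    qed simp
    also have "\<dots> \<le> (LINT \<xi>|lborel. cmod (ft (packet_hat z (- x)) \<xi> * f \<xi>))" using integral_norm_bound by simp
    also have "\<dots> \<le> (LINT \<xi>|lborel. 1 / sqrt (cmod z) * cmod (f \<xi>))"
    proof (rule integral_mono)
      show "integrable lborel (\<lambda>\<xi>. cmod (ft (packet_hat z (- x)) \<xi> * f \<xi>))"
        by (rule integrable_norm[OF integrable_mult_bounded[OF _ b f(1)]]) (use ft_measurable[OF ih] in simp)
      show "cmod (ft (packet_hat z (- x)) \<xi> * f \<xi>) \<le> 1 / sqrt (cmod z) * cmod (f \<xi>)" for \<xi>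
        unfolding norm_mult by (rule mult_right_mono[OF b]) simp
    qed (use f in simp)
    also have "\<dots> = L1_norm f / sqrt (cmod z)" by (simp add: L1_norm_def)
    finally show ?thesis .
  qed
  have lr: "lsq (\<lambda>x. ft ?g (- x))"
    using lsq_affine[of "-1" "ft ?g" 0] plancherel_L1_L2(1)[OF ig lg] by simp
  show ?thesis
    unfolding fourier_L2_to_L2[OF f] L2_mult_to_L2[OF mm m1 plancherel_L1_L2(1)[OF f]]
      fourier_inv_to_L2[OF ig lg] linf_le_to_L2[OF lr]
    by (rule AE_I2) (rule bnd)
qed

text \<open>Take \<open>Re z\<close> to 0 with \<open>Im z = t\<close>. The multipliers converge
  strongly, the bounds for positive \<open>Re z\<close> are at most the claimed one because
  \<open>|t| \<le> |z|\<close>, and \<open>linf_le\<close> survives L2 limits.\<close>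

lemma dispersive_estimate:
  assumes f: "integrable lborel f" "lsq f" and t: "t \<noteq> 0"
  shows "linf_le (schroedinger t (to_L2 f)) (L1_norm f / sqrt \<bar>t\<bar>)"
proof -
  define z where "z n = complex_of_real (inverse (real (Suc n))) + \<i> * complex_of_real t" for n
  have Rez: "Re (z n) > 0" for n by (simp add: z_def)
  have "z \<longlonglongrightarrow> complex_of_real 0 + \<i> * complex_of_real t"
    unfolding z_def by (intro tendsto_intros LIMSEQ_inverse_real_of_nat)
  then have zlim: "z \<longlonglongrightarrow> \<i> * complex_of_real t" by simp
  have bz: "sqrt \<bar>t\<bar> \<le> sqrt (cmod (z n))" for n
    using abs_Im_le_cmod[of "z n"] by (simp add: z_def)
  have "(\<lambda>n. L2_mult (\<lambda>\<xi>. exp (- z n * complex_of_real (\<xi>\<^sup>2))) (fourier_L2 (to_L2 f)))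
      \<longlonglongrightarrow> L2_mult (schroedinger_symbol t) (fourier_L2 (to_L2 f))"
  proof (rule L2_mult_tendsto[where B = 1])
    show "cmod (exp (- z n * complex_of_real (\<xi>\<^sup>2))) \<le> 1" for n \<xi>
      unfolding norm_exp_gauss using Rez[of n] by simp
    show "(\<lambda>n. exp (- z n * complex_of_real (\<xi>\<^sup>2))) \<longlonglongrightarrow> schroedinger_symbol t \<xi>" for \<xi>
    proof -
      have "(\<lambda>n. exp (- z n * complex_of_real (\<xi>\<^sup>2))) \<longlonglongrightarrow> exp (- (\<i> * complex_of_real t) * complex_of_real (\<xi>\<^sup>2))"
        by (intro tendsto_intros zlim)
      then show ?thesis by (simp add: schroedinger_symbol_def mult.assoc)
    qed
  qed measurable
  then have lim: "(\<lambda>n. fourier_inv (L2_mult (\<lambda>\<xi>. exp (- z n * complex_of_real (\<xi>\<^sup>2))) (fourier_L2 (to_L2 f))))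
      \<longlonglongrightarrow> schroedinger t (to_L2 f)"
    unfolding schroedinger_altdef by (rule bounded_linear.tendsto[OF bounded_linear_fourier_inv])
  show ?thesis
  proof (rule linf_le_lim[OF _ _ lim])
    show "linf_le (fourier_inv (L2_mult (\<lambda>\<xi>. exp (- z n * complex_of_real (\<xi>\<^sup>2))) (fourier_L2 (to_L2 f))))
        (L1_norm f / sqrt \<bar>t\<bar>)" for n
      by (rule linf_le_mono[OF heat_schroedinger_bound[OF f Rez]])
         (use bz[of n] t in \<open>auto intro!: divide_left_mono mult_pos_pos\<close>)
  qed auto
qed

section \<open>The cubic nonlinearity\<close>

definition cubic_fun :: "(real \<Rightarrow> complex) \<Rightarrow> L2 \<Rightarrow> real \<Rightarrow> complex" where
  "cubic_fun a v x = a x * complex_of_real ((cmod (rep_L2 v x))\<^sup>2) * rep_L2 v x"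

lemma cubic_eq: "cubic a v = to_L2 (cubic_fun a v)"
  unfolding cubic_def cubic_fun_def ..

lemma cubic_lipschitz:
  fixes v w :: complex
  assumes "cmod v \<le> K" "cmod w \<le> K"
  shows "cmod (complex_of_real ((cmod v)\<^sup>2) * v - complex_of_real ((cmod w)\<^sup>2) * w) \<le> 3 * K\<^sup>2 * cmod (v - w)"
proof -
  have K: "0 \<le> K" using assms(1) norm_ge_zero order_trans by blast
  have "complex_of_real ((cmod v)\<^sup>2) * v - complex_of_real ((cmod w)\<^sup>2) * w
      = complex_of_real ((cmod v)\<^sup>2) * (v - w) + complex_of_real ((cmod v + cmod w) * (cmod v - cmod w)) * w"
    by (simp add: algebra_simps power2_eq_square)
  also have "cmod (complex_of_real ((cmod v)\<^sup>2) * (v - w) + complex_of_real ((cmod v + cmod w) * (cmod v - cmod w)) * w)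
      \<le> cmod (complex_of_real ((cmod v)\<^sup>2) * (v - w)) + cmod (complex_of_real ((cmod v + cmod w) * (cmod v - cmod w)) * w)"
    by (rule norm_triangle_ineq)
  also have "\<dots> = (cmod v)\<^sup>2 * cmod (v - w) + (cmod v + cmod w) * \<bar>cmod v - cmod w\<bar> * cmod w"
    by (simp only: norm_mult norm_of_real abs_mult) simp
  also have "\<dots> \<le> K\<^sup>2 * cmod (v - w) + (K + K) * cmod (v - w) * K"
    using assms K norm_triangle_ineq3[of v w]
    by (intro add_mono mult_mono power_mono) auto
  also have "\<dots> = 3 * K\<^sup>2 * cmod (v - w)" by (simp add: algebra_simps power2_eq_square)
  finally show ?thesis .
qed

lemma cubic_fun_measurable [measurable]:
  assumes [measurable]: "a \<in> borel_measurable borel"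
  shows "cubic_fun a v \<in> borel_measurable borel"
  unfolding cubic_fun_def by measurable

lemma lsq_bound_AE:
  assumes "f \<in> borel_measurable lborel" "lsq g" "AE x in lborel. cmod (f x) \<le> C * cmod (g x)" "0 \<le> C"
  shows "lsq f" "norm (to_L2 f) \<le> C * norm (to_L2 g)"
proof -
  have *: "AE x in lborel. (cmod (f x))\<^sup>2 \<le> C\<^sup>2 * (cmod (g x))\<^sup>2"
    using assms(3) by eventually_elim (metis norm_ge_zero power_mono power_mult_distrib)
  have i: "integrable lborel (\<lambda>x. C\<^sup>2 * (cmod (g x))\<^sup>2)" using lsq_integrable[OF assms(2)] by simp
  have "integrable lborel (\<lambda>x. (cmod (f x))\<^sup>2)"
    by (rule Bochner_Integration.integrable_bound[OF i]) (use assms(1) * in auto)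
  with assms(1) show l: "lsq f" by (simp add: lsq_def)
  have "(norm (to_L2 f))\<^sup>2 \<le> (LINT x|lborel. C\<^sup>2 * (cmod (g x))\<^sup>2)"
    unfolding norm_to_L2_sq[OF l] by (rule integral_mono_AE[OF lsq_integrable[OF l] i *])
  also have "\<dots> = (C * norm (to_L2 g))\<^sup>2" by (simp add: norm_to_L2_sq[OF assms(2)] power_mult_distrib)
  finally show "norm (to_L2 f) \<le> C * norm (to_L2 g)" by (rule power2_le_imp_le) (use assms(4) in simp)
qed

lemma integrable_bound_AE:
  fixes f g :: "real \<Rightarrow> complex"
  assumes "f \<in> borel_measurable lborel" "integrable lborel g" "AE x in lborel. cmod (f x) \<le> C * cmod (g x)"
  shows "integrable lborel f" "L1_norm f \<le> C * L1_norm g"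
proof -
  have i: "integrable lborel (\<lambda>x. C * cmod (g x))" using assms(2) by simp
  show l: "integrable lborel f"
    by (rule Bochner_Integration.integrable_bound[OF i assms(1)]) (use assms(3) in \<open>auto elim!: eventually_mono\<close>)
  have "L1_norm f \<le> (LINT x|lborel. C * cmod (g x))"
    unfolding L1_norm_def by (rule integral_mono_AE[OF integrable_norm[OF l] i assms(3)])
  then show "L1_norm f \<le> C * L1_norm g" by (simp add: L1_norm_def)
qed

lemma cubic_fun_AE:
  assumes "linf_le v K"
  shows "AE x in lborel. cmod (cubic_fun a v x) \<le> K ^ 3 * cmod (a x)"
  using assms unfolding linf_le_def
proof eventually_elim
  case (elim x)
  have "cmod (cubic_fun a v x) = cmod (rep_L2 v x) ^ 3 * cmod (a x)"
    unfolding cubic_fun_def norm_mult norm_of_real by (simp add: power3_eq_cube power2_eq_square)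
  also have "\<dots> \<le> K ^ 3 * cmod (a x)" using elim by (intro mult_right_mono power_mono) auto
  finally show ?case .
qed

lemma AE_lborel_not_False: "\<not> (AE x in (lborel :: real measure). False)"
  using ae_filter_eq_bot_iff[of "lborel :: real measure"] by (simp add: trivial_limit_def)

lemma linf_le_nonneg: "linf_le v K \<Longrightarrow> 0 \<le> K"
proof (rule ccontr)
  assume "linf_le v K" "\<not> 0 \<le> K"
  then have "AE x in (lborel :: real measure). False"
    unfolding linf_le_def by (auto elim!: eventually_mono) (smt (verit) norm_ge_zero)
  then show False using AE_lborel_not_False by blast
qed

lemma cubic_fun_integrable:
  assumes a: "integrable lborel a" "lsq a" and v: "linf_le v K"
  shows "lsq (cubic_fun a v)" "integrable lborel (cubic_fun a v)"
proof -
  have [measurable]: "a \<in> borel_measurable borel" using a(2) by (simp add: lsq_def)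
  have m: "cubic_fun a v \<in> borel_measurable lborel" by measurable
  show "lsq (cubic_fun a v)"
    using linf_le_nonneg[OF v] by (intro lsq_bound_AE(1)[OF m a(2) cubic_fun_AE[OF v]]) simp
  show "integrable lborel (cubic_fun a v)" by (rule integrable_bound_AE(1)[OF m a(1) cubic_fun_AE[OF v]])
qed

lemma cubic_diff_AE:
  assumes "linf_le v K" "linf_le w K"
  shows "AE x in lborel. cmod (cubic_fun a v x - cubic_fun a w x) \<le> 3 * K\<^sup>2 * cmod (a x) * cmod (rep_L2 (v - w) x)"
  using assms rep_L2_diff[of v w] unfolding linf_le_def
proof eventually_elim
  case (elim x)
  have "cubic_fun a v x - cubic_fun a w x = a x * (complex_of_real ((cmod (rep_L2 v x))\<^sup>2) * rep_L2 v x
      - complex_of_real ((cmod (rep_L2 w x))\<^sup>2) * rep_L2 w x)"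
    unfolding cubic_fun_def by (simp add: algebra_simps)
  then have "cmod (cubic_fun a v x - cubic_fun a w x) = cmod (a x) * cmod (complex_of_real ((cmod (rep_L2 v x))\<^sup>2) * rep_L2 v x
      - complex_of_real ((cmod (rep_L2 w x))\<^sup>2) * rep_L2 w x)" by (simp only: norm_mult)
  also have "\<dots> \<le> cmod (a x) * (3 * K\<^sup>2 * cmod (rep_L2 v x - rep_L2 w x))"
    by (intro mult_left_mono cubic_lipschitz elim) simp
  finally show ?case using elim(3) by (simp add: mult_ac)
qed

lemma cubic_diff_eq:
  assumes a: "integrable lborel a" "lsq a" and v: "linf_le v K" "linf_le w K'"
  shows "cubic a v - cubic a w = to_L2 (\<lambda>x. cubic_fun a v x - cubic_fun a w x)"
  unfolding cubic_eq
  by (rule to_L2_diff[OF cubic_fun_integrable(1)[OF a v(1)] cubic_fun_integrable(1)[OF a v(2)]])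

text \<open>All three factors of the cubic term are measured in the supremum norm, so the spatial
  integrability comes from \<open>a\<close>: its L2 norm gives the first bound, its L1 norm feeds
  the dispersive estimate for the second.\<close>

lemma cubic_diff_linf:
  assumes a: "integrable lborel a" "lsq a" and v: "linf_le v K" "linf_le w K" and d: "linf_le (v - w) d"
  shows "norm (cubic a v - cubic a w) \<le> 3 * K\<^sup>2 * d * norm (to_L2 a)"
    and "t \<noteq> 0 \<Longrightarrow> linf_le (schroedinger t (cubic a v - cubic a w)) (3 * K\<^sup>2 * d * L1_norm a / sqrt \<bar>t\<bar>)"
proof -
  have [measurable]: "a \<in> borel_measurable borel" using a(2) by (simp add: lsq_def)
  have d0: "0 \<le> 3 * K\<^sup>2 * d" using linf_le_nonneg[OF d] by simp
  let ?f = "\<lambda>x. cubic_fun a v x - cubic_fun a w x"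
  have m: "?f \<in> borel_measurable lborel" by measurable
  have AE: "AE x in lborel. cmod (?f x) \<le> (3 * K\<^sup>2 * d) * cmod (a x)"
    using cubic_diff_AE[OF v, of a] d unfolding linf_le_def
  proof eventually_elim
    case (elim x)
    have "3 * K\<^sup>2 * cmod (a x) * cmod (rep_L2 (v - w) x) \<le> 3 * K\<^sup>2 * cmod (a x) * d"
      by (intro mult_left_mono elim) simp
    then show ?case using elim(1) by (simp add: mult_ac)
  qed
  show "norm (cubic a v - cubic a w) \<le> 3 * K\<^sup>2 * d * norm (to_L2 a)"
    unfolding cubic_diff_eq[OF a v] by (rule lsq_bound_AE(2)[OF m a(2) AE d0])
  assume t: "t \<noteq> 0"
  show "linf_le (schroedinger t (cubic a v - cubic a w)) (3 * K\<^sup>2 * d * L1_norm a / sqrt \<bar>t\<bar>)"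
    unfolding cubic_diff_eq[OF a v]
    by (rule linf_le_mono[OF dispersive_estimate[OF integrable_bound_AE(1)[OF m a(1) AE] lsq_bound_AE(1)[OF m a(2) AE d0] t]])
       (intro divide_right_mono integrable_bound_AE(2)[OF m a(1) AE], simp)
qed

lemma linf_le_0: "0 \<le> K \<Longrightarrow> linf_le 0 K"
  using linf_le_to_L2[of "\<lambda>_. 0" K] by simp

lemma cubic_0 [simp]: "cubic a 0 = 0"
proof -
  have "AE x in lborel. rep_L2 0 x = 0" using rep_to_L2[of "\<lambda>_. 0"] by simp
  then have ae: "AE x in lborel. cubic_fun a 0 x = 0" by eventually_elim (simp add: cubic_fun_def)
  show ?thesis
  \<comment> \<open>For arbitrary \<open>a\<close> measurability may fail; then \<open>to_L2\<close>
    returns its default value 0, which is the desired one.\<close>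
  proof (cases "lsq (cubic_fun a 0)")
    case True
    then have "to_L2 (cubic_fun a 0) = to_L2 (\<lambda>_. 0)" by (rule to_L2_eqI[OF _ lsq_zero ae])
    then show ?thesis by (simp add: cubic_eq)
  qed (simp add: cubic_eq to_L2_def)
qed

text \<open>Comparison with \<open>w = 0\<close>; the factor 3 is inherited from the Lipschitz bound
  and affects constants only.\<close>

lemma cubic_linf:
  assumes a: "integrable lborel a" "lsq a" and v: "linf_le v K"
  shows "norm (cubic a v) \<le> 3 * K ^ 3 * norm (to_L2 a)"
    and "t \<noteq> 0 \<Longrightarrow> linf_le (schroedinger t (cubic a v)) (3 * K ^ 3 * L1_norm a / sqrt \<bar>t\<bar>)"
proof -
  have v0: "linf_le (v - 0) K" using v by simp
  note w = linf_le_0[OF linf_le_nonneg[OF v]]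
  show "norm (cubic a v) \<le> 3 * K ^ 3 * norm (to_L2 a)"
    using cubic_diff_linf(1)[OF a v w v0] by (simp add: power2_eq_square power3_eq_cube mult.assoc)
  show "linf_le (schroedinger t (cubic a v)) (3 * K ^ 3 * L1_norm a / sqrt \<bar>t\<bar>)" if "t \<noteq> 0"
    using cubic_diff_linf(2)[OF a v w v0 that] by (simp add: power2_eq_square power3_eq_cube mult.assoc)
qed

text \<open>Here \<open>a\<close> is measured by its supremum and the difference in L2. This form
  serves continuity in time and the comparison with an arbitrary solution, whose distance is known
  only in L2.\<close>

lemma cubic_diff_L2:
  assumes a: "integrable lborel a" "lsq a" "AE x in lborel. cmod (a x) \<le> M" and v: "linf_le v K" "linf_le w K"
  shows "norm (cubic a v - cubic a w) \<le> 3 * K\<^sup>2 * M * norm (v - w)"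
proof -
  have [measurable]: "a \<in> borel_measurable borel" using a(2) by (simp add: lsq_def)
  have M: "0 \<le> M"
  proof (rule ccontr)
    assume "\<not> 0 \<le> M"
    with a(3) have "AE x in (lborel :: real measure). False"
      by (auto elim!: eventually_mono) (smt (verit) norm_ge_zero)
    then show False using AE_lborel_not_False by blast
  qed
  let ?f = "\<lambda>x. cubic_fun a v x - cubic_fun a w x"
  have m: "?f \<in> borel_measurable lborel" by measurable
  have AE: "AE x in lborel. cmod (?f x) \<le> (3 * K\<^sup>2 * M) * cmod (rep_L2 (v - w) x)"
    using cubic_diff_AE[OF v, of a] a(3)
  proof eventually_elim
    case (elim x)
    have "3 * K\<^sup>2 * cmod (a x) * cmod (rep_L2 (v - w) x) \<le> 3 * K\<^sup>2 * M * cmod (rep_L2 (v - w) x)"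
      by (intro mult_right_mono mult_left_mono elim) auto
    then show ?case using elim(1) by simp
  qed
  show ?thesis
    unfolding cubic_diff_eq[OF a(1,2) v] using lsq_bound_AE(2)[OF m lsq_rep_L2 AE] M by simp
qed

lemma continuous_cubic:
  assumes a: "integrable lborel a" "lsq a" "AE x in lborel. cmod (a x) \<le> M"
    and u: "continuous_on UNIV u" "\<And>t. linf_le (u t) K"
  shows "continuous_on UNIV (\<lambda>t::real. cubic a (u t))"
proof -
  have "isCont (\<lambda>t. cubic a (u t)) t" for t
  proof -
    have "((\<lambda>s. 3 * K\<^sup>2 * M * norm (u s - u t)) \<longlongrightarrow> 3 * K\<^sup>2 * M * norm (u t - u t)) (at t)"
      using u(1) by (intro tendsto_intros) (simp add: continuous_on_eq_continuous_at isCont_def)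
    then have "((\<lambda>s. cubic a (u s) - cubic a (u t)) \<longlongrightarrow> 0) (at t)"
      by (intro Lim_null_comparison[OF always_eventually[OF allI[OF cubic_diff_L2[OF a u(2) u(2)]]]]) simp
    then show ?thesis by (simp add: isCont_def LIM_zero_iff)
  qed
  then show ?thesis by (simp add: continuous_at_imp_continuous_on)
qed

section \<open>Dispersive decay\<close>

text \<open>\<open>wt \<tau>\<close> is the decay profile of a packet of width \<open>\<surd>\<tau>\<close>. The function \<open>gk \<tau>\<close> dominates all integrands
  that occur (up to the junk value \<open>gk \<tau> 0 = 0\<close>).\<close>

definition wt :: "real \<Rightarrow> real \<Rightarrow> real" where
  "wt \<tau> t = sqrt (\<tau> / (\<tau> + \<bar>t\<bar>))"

definition gk :: "real \<Rightarrow> real \<Rightarrow> real" where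
  "gk \<tau> s = 1 / (sqrt \<bar>s\<bar> * (\<tau> + \<bar>s\<bar>))"

lemma wt_measurable [measurable]: "wt \<tau> \<in> borel_measurable borel"
  unfolding wt_def by measurable

lemma gk_measurable [measurable]: "gk \<tau> \<in> borel_measurable borel"
  unfolding gk_def by measurable

lemma wt_bounds:
  assumes "\<tau> > 0"
  shows "0 < wt \<tau> t" "wt \<tau> t \<le> 1"
  using assms by (auto simp: wt_def intro!: divide_pos_pos)

lemma gk_nonneg: "\<tau> > 0 \<Longrightarrow> 0 \<le> gk \<tau> s"
  by (simp add: gk_def)

text \<open>The substitution \<open>s = \<tau> r^2\<close> turns the integral over the half line
  into \<open>2 / sqrt \<tau>\<close> times that of \<open>1 / (1 + r^2)\<close>, whence the
  arctangent primitive; symmetry doubles the value.\<close>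

lemma gk_integral:
  assumes \<tau>: "\<tau> > 0"
  shows "integrable lborel (gk \<tau>)" "(LINT s|lborel. gk \<tau> s) = 2 * pi / sqrt \<tau>"
proof -
  define F where "F s = 2 / sqrt \<tau> * arctan (sqrt (s / \<tau>))" for s
  have FTC: "set_integrable lborel (einterval 0 \<infinity>) (gk \<tau>)" "(LBINT s=0..\<infinity>. gk \<tau> s) = pi / sqrt \<tau> - 0"
  proof -
    have D: "(F has_real_derivative gk \<tau> s) (at s)" if "0 < s" for s
    proof -
      have "(F has_real_derivative (2 / sqrt \<tau> * (inverse (1 + (sqrt (s / \<tau>))\<^sup>2) * (inverse (sqrt (s / \<tau>)) / 2 * (1 / \<tau>))))) (at s)"
        unfolding F_def using that \<tau>
        by (intro DERIV_cmult DERIV_chain2[OF DERIV_arctan] DERIV_chain2[OF DERIV_real_sqrt] DERIV_cdivide DERIV_ident) simp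
      moreover have "2 / sqrt \<tau> * (inverse (1 + (sqrt (s / \<tau>))\<^sup>2) * (inverse (sqrt (s / \<tau>)) / 2 * (1 / \<tau>))) = gk \<tau> s"
      proof -
        have "1 + (sqrt (s / \<tau>))\<^sup>2 = (\<tau> + s) / \<tau>" using that \<tau> by (simp add: field_simps)
        moreover have "sqrt (s / \<tau>) = sqrt s / sqrt \<tau>" by (rule real_sqrt_divide)
        moreover have "2 / q * (inverse (T / \<tau>) * (inverse (r / q) / 2 * (1 / \<tau>))) = 1 / (r * T)"
          if "q > 0" "r > 0" "T > 0" for q r T
          using that \<tau> by (simp add: divide_simps)
        ultimately show ?thesis using that \<tau> by (simp only: gk_def abs_of_pos real_sqrt_gt_0_iff add_pos_pos)
      qed
      ultimately show ?thesis by simp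
    qed
    have l0: "((F \<circ> real_of_ereal) \<longlongrightarrow> 0) (at_right 0)"
    proof -
      have "isCont F 0" unfolding F_def using \<tau> by (intro continuous_intros) auto
      then have "(F \<longlongrightarrow> F 0) (at_right 0)" by (metis continuous_within_subset isCont_def filterlim_at_split)
      then show ?thesis by (simp add: F_def zero_ereal_def ereal_tendsto_simps)
    qed
    have l1: "((F \<circ> real_of_ereal) \<longlongrightarrow> pi / sqrt \<tau>) (at_left \<infinity>)"
    proof -
      have "filterlim (\<lambda>s. sqrt (s / \<tau>)) at_top at_top" using \<tau> by real_asymp
      from filterlim_compose[OF tendsto_arctan_at_top this]
      have "(F \<longlongrightarrow> 2 / sqrt \<tau> * (pi / 2)) at_top" unfolding F_def by (intro tendsto_intros)
      then show ?thesis by (simp add: ereal_tendsto_simps)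
    qed
    have c: "isCont (gk \<tau>) s" if "0 < s" for s
      unfolding gk_def using that \<tau> by (intro continuous_intros) auto
    show "set_integrable lborel (einterval 0 \<infinity>) (gk \<tau>)"
      by (rule interval_integral_FTC_nonneg(1)[OF _ _ _ _ l0 l1]) (use D c \<tau> in \<open>auto simp: gk_nonneg zero_ereal_def\<close>)
    show "(LBINT s=0..\<infinity>. gk \<tau> s) = pi / sqrt \<tau> - 0"
      by (rule interval_integral_FTC_nonneg(2)[OF _ _ _ _ l0 l1]) (use D c \<tau> in \<open>auto simp: gk_nonneg zero_ereal_def\<close>)
  qed
  have E: "einterval 0 \<infinity> = {0::real<..}" by (auto simp: einterval_def zero_ereal_def)
  let ?g = "\<lambda>s. indicator {0<..} s *\<^sub>R gk \<tau> s"
  have i: "integrable lborel ?g" using FTC(1) unfolding E set_integrable_def .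
  have v: "integral\<^sup>L lborel ?g = pi / sqrt \<tau>"
    using FTC(2) unfolding interval_lebesgue_integral_def E set_lebesgue_integral_def by simp
  \<comment> \<open>The identity holds at \<open>s = 0\<close> too: both indicators vanish there,
    and \<open>gk \<tau> 0 = 0\<close> by division by zero.\<close>
  have eq: "gk \<tau> s = ?g s + ?g (0 + (-1) * s)" for s by (auto simp: indicator_def gk_def)
  have i': "integrable lborel (\<lambda>s. ?g (0 + (-1) * s))" by (rule lborel_integrable_real_affine[OF i]) simp
  have v': "(LINT s|lborel. ?g (0 + (-1) * s)) = pi / sqrt \<tau>"
    using lborel_integral_real_affine[of "-1" ?g 0] v by simp
  show "integrable lborel (gk \<tau>)"
    by (rule Bochner_Integration.integrable_cong[OF refl eq, THEN iffD2]) (rule Bochner_Integration.integrable_add[OF i i'])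
  show "(LINT s|lborel. gk \<tau> s) = 2 * pi / sqrt \<tau>"
    by (rule trans[OF Bochner_Integration.integral_cong[OF refl eq]])
       (use Bochner_Integration.integral_add[OF i i'] v v' in simp)
qed

lemma wt_cube: "\<tau> > 0 \<Longrightarrow> wt \<tau> s ^ 3 = \<tau> * sqrt \<tau> / ((\<tau> + \<bar>s\<bar>) * sqrt (\<tau> + \<bar>s\<bar>))"
  by (simp add: wt_def real_sqrt_divide power_divide power3_eq_cube)

lemma wt_cube_le:
  assumes \<tau>: "\<tau> > 0" and s: "s \<noteq> 0"
  shows "wt \<tau> s ^ 3 \<le> \<tau> * sqrt \<tau> * gk \<tau> s"
proof -
  have "\<tau> * sqrt \<tau> / ((\<tau> + \<bar>s\<bar>) * sqrt (\<tau> + \<bar>s\<bar>)) \<le> \<tau> * sqrt \<tau> / ((\<tau> + \<bar>s\<bar>) * sqrt \<bar>s\<bar>)"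
    using \<tau> s by (intro divide_left_mono mult_left_mono mult_pos_pos) auto
  then show ?thesis unfolding wt_cube[OF \<tau>] gk_def by (simp add: mult.commute)
qed

text \<open>The factor \<open>(\<tau> + \<bar>t\<bar>)\<^sup>1\<^sup>/\<^sup>2\<close> is absorbed by \<open>(\<tau> + \<bar>s\<bar>)\<^sup>1\<^sup>/\<^sup>2 + \<bar>t - s\<bar>\<^sup>1\<^sup>/\<^sup>2\<close>, and a product of functions decreasing
  in \<open>\<bar>t - s\<bar>\<close> and \<open>\<bar>s\<bar>\<close> is at most the sum of its values with both arguments equal.\<close>

lemma wt_kernel_pointwise:
  assumes \<tau>: "\<tau> > 0" and s: "s \<noteq> 0" "s \<noteq> t"
  shows "wt \<tau> s ^ 3 / sqrt \<bar>t - s\<bar> \<le> \<tau> * wt \<tau> t * (gk \<tau> (t - s) + 2 * gk \<tau> s)"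
proof -
  define A B T where "A = \<bar>t - s\<bar>" and "B = \<tau> + \<bar>s\<bar>" and "T = \<tau> + \<bar>t\<bar>"
  have pos: "A > 0" "B > 0" "T > 0" "B \<ge> \<bar>s\<bar>" "T \<le> B + A" using \<tau> s by (auto simp: A_def B_def T_def)
  have "sqrt T \<le> sqrt (B + A)" using pos by simp
  also have "\<dots> \<le> sqrt B + sqrt A" using sqrt_add_le_add_sqrt[of B A] pos by simp
  finally have sT: "sqrt T \<le> sqrt B + sqrt A" .
  have g1: "1 / (sqrt A * B) \<le> gk \<tau> (t - s) + gk \<tau> s"
  proof (cases "A \<le> \<bar>s\<bar>")
    case True
    then have "1 / (sqrt A * B) \<le> gk \<tau> (t - s)"
      unfolding gk_def A_def[symmetric] using pos \<tau>
      by (intro divide_left_mono mult_left_mono mult_pos_pos) (auto simp: B_def)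
    then show ?thesis using gk_nonneg[OF \<tau>, of s] by simp
  next
    case False
    then have "1 / (sqrt A * B) \<le> gk \<tau> s"
      unfolding gk_def B_def[symmetric] using pos s
      by (intro divide_left_mono mult_right_mono mult_pos_pos) auto
    then show ?thesis using gk_nonneg[OF \<tau>, of "t - s"] by simp
  qed
  have g2: "1 / (B * sqrt B) \<le> gk \<tau> s"
    unfolding gk_def B_def[symmetric] using pos s
    by (subst mult.commute, intro divide_left_mono mult_left_mono mult_pos_pos) auto
  have "sqrt T / (sqrt A * (B * sqrt B)) \<le> (sqrt B + sqrt A) / (sqrt A * (B * sqrt B))"
    using pos sT by (intro divide_right_mono) auto
  also have "\<dots> = 1 / (sqrt A * B) + 1 / (B * sqrt B)" using pos by (simp add: field_simps)
  also have "\<dots> \<le> gk \<tau> (t - s) + 2 * gk \<tau> s" using g1 g2 by simp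
  finally have "sqrt T / (sqrt A * (B * sqrt B)) \<le> gk \<tau> (t - s) + 2 * gk \<tau> s" .
  then have "\<tau> * wt \<tau> t * (sqrt T / (sqrt A * (B * sqrt B))) \<le> \<tau> * wt \<tau> t * (gk \<tau> (t - s) + 2 * gk \<tau> s)"
    using \<tau> wt_bounds[OF \<tau>, of t] by (intro mult_left_mono) auto
  moreover have "\<tau> * wt \<tau> t * (sqrt T / (sqrt A * (B * sqrt B))) = wt \<tau> s ^ 3 / sqrt A"
    using pos unfolding wt_cube[OF \<tau>] unfolding wt_def B_def[symmetric] T_def[symmetric] real_sqrt_divide
    by simp
  ultimately show ?thesis by (simp add: A_def)
qed

lemma AE_neq: "AE s in lborel. s \<noteq> (t::real)"
  by (rule AE_lborel_singleton)

text \<open>Duhamel's integral of the cubed profile against the dispersive kernel reproduces the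
  profile with a gain of \<open>sqrt \<tau>\<close>, which is where the smallness of the contraction
  factor comes from. The three kernels on the right of \<open>wt_kernel_pointwise\<close> contribute
  \<open>2 * pi / sqrt \<tau>\<close> each.\<close>

lemma wt_kernel:
  assumes \<tau>: "\<tau> > 0"
  shows "integrable lborel (\<lambda>s. wt \<tau> s ^ 3 / sqrt \<bar>t - s\<bar>)"
    "(LINT s|lborel. wt \<tau> s ^ 3 / sqrt \<bar>t - s\<bar>) \<le> 6 * pi * sqrt \<tau> * wt \<tau> t"
proof -
  let ?G = "\<lambda>s. \<tau> * wt \<tau> t * (gk \<tau> (t - s) + 2 * gk \<tau> s)"
  have i1: "integrable lborel (\<lambda>s. gk \<tau> (t - s))"
    using lborel_integrable_real_affine[OF gk_integral(1)[OF \<tau>], of "-1" t] by simp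
  have v1: "(LINT s|lborel. gk \<tau> (t - s)) = 2 * pi / sqrt \<tau>"
    using lborel_integral_real_affine[of "-1" "gk \<tau>" t] gk_integral(2)[OF \<tau>] by simp
  have iG: "integrable lborel ?G" using i1 gk_integral(1)[OF \<tau>] by simp
  have vG: "integral\<^sup>L lborel ?G = \<tau> * wt \<tau> t * (2 * pi / sqrt \<tau> + 2 * (2 * pi / sqrt \<tau>))"
    using i1 gk_integral[OF \<tau>] v1 by simp
  have le: "AE s in lborel. wt \<tau> s ^ 3 / sqrt \<bar>t - s\<bar> \<le> ?G s"
    using AE_neq[of 0] AE_neq[of t] by eventually_elim (rule wt_kernel_pointwise[OF \<tau>])
  have pos: "0 \<le> wt \<tau> s ^ 3 / sqrt \<bar>t - s\<bar>" for s using wt_bounds[OF \<tau>, of s] by simp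
  show i: "integrable lborel (\<lambda>s. wt \<tau> s ^ 3 / sqrt \<bar>t - s\<bar>)"
    by (rule Bochner_Integration.integrable_bound[OF iG]) (use le pos in \<open>auto elim!: eventually_mono simp: abs_of_nonneg simp del: abs_divide\<close>)
  have "(LINT s|lborel. wt \<tau> s ^ 3 / sqrt \<bar>t - s\<bar>) \<le> integral\<^sup>L lborel ?G" by (rule integral_mono_AE[OF i iG le])
  also have "\<dots> = 6 * pi * sqrt \<tau> * wt \<tau> t"
    unfolding vG using \<tau> by (simp add: field_simps)
  finally show "(LINT s|lborel. wt \<tau> s ^ 3 / sqrt \<bar>t - s\<bar>) \<le> 6 * pi * sqrt \<tau> * wt \<tau> t" .
qed

lemma wt_cube_integral:
  assumes \<tau>: "\<tau> > 0"
  shows "integrable lborel (\<lambda>s. wt \<tau> s ^ 3)" "(LINT s|lborel. wt \<tau> s ^ 3) \<le> 2 * pi * \<tau>"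
    "integrable lborel (\<lambda>s. wt \<tau> s ^ 4)" "(LINT s|lborel. wt \<tau> s ^ 4) \<le> 2 * pi * \<tau>"
proof -
  have iG: "integrable lborel (\<lambda>s. \<tau> * sqrt \<tau> * gk \<tau> s)" using gk_integral[OF \<tau>] by simp
  have le: "AE s in lborel. wt \<tau> s ^ 3 \<le> \<tau> * sqrt \<tau> * gk \<tau> s"
    using AE_neq[of 0] by eventually_elim (rule wt_cube_le[OF \<tau>])
  have pos: "0 \<le> wt \<tau> s" for s using wt_bounds[OF \<tau>, of s] by simp
  show i: "integrable lborel (\<lambda>s. wt \<tau> s ^ 3)"
    by (rule Bochner_Integration.integrable_bound[OF iG]) (use le pos in \<open>auto elim!: eventually_mono intro: order_trans[OF _ abs_ge_self]\<close>)
  have le4: "wt \<tau> s ^ 4 \<le> wt \<tau> s ^ 3" for s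
    using wt_bounds[OF \<tau>, of s] by (intro power_decreasing) auto
  show i4: "integrable lborel (\<lambda>s. wt \<tau> s ^ 4)"
    by (rule Bochner_Integration.integrable_bound[OF i]) (use le4 pos in \<open>auto\<close>)
  have "(LINT s|lborel. wt \<tau> s ^ 3) \<le> (LINT s|lborel. \<tau> * sqrt \<tau> * gk \<tau> s)" by (rule integral_mono_AE[OF i iG le])
  also have "\<dots> = 2 * pi * \<tau>" using gk_integral(2)[OF \<tau>] \<tau> by (simp add: field_simps)
  finally show 3: "(LINT s|lborel. wt \<tau> s ^ 3) \<le> 2 * pi * \<tau>" .
  have "(LINT s|lborel. wt \<tau> s ^ 4) \<le> (LINT s|lborel. wt \<tau> s ^ 3)" by (rule integral_mono[OF i4 i le4])
  with 3 show "(LINT s|lborel. wt \<tau> s ^ 4) \<le> 2 * pi * \<tau>" by simp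
qed

section \<open>Small global solutions\<close>

text \<open>The oriented indicator of the segment from 0 to \<open>t\<close>. Interval integrals
  with endpoints in either order become one integral over the line, to which norm bounds and
  dominated convergence apply directly.\<close>

definition seg_sign :: "real \<Rightarrow> real \<Rightarrow> real" where
  "seg_sign t s = indicator {0<..<t} s - indicator {t<..<0} s"

definition prim :: "(real \<Rightarrow> L2) \<Rightarrow> real \<Rightarrow> L2" where
  "prim f t = (LINT s|lborel. seg_sign t s *\<^sub>R f s)"

lemma seg_sign_measurable [measurable]: "seg_sign t \<in> borel_measurable borel"
  unfolding seg_sign_def by measurable

lemma abs_seg_sign_le: "\<bar>seg_sign t s\<bar> \<le> 1"
  by (auto simp: seg_sign_def indicator_def)

lemma interval_integral_eq_prim: "(LBINT s=0..ereal t. f s) = prim f t"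
proof (cases "0 \<le> t")
  case True
  then have "seg_sign t = indicator {0<..<t}"
    by (auto simp: seg_sign_def indicator_def fun_eq_iff)
  then show ?thesis using True
    by (simp add: prim_def interval_lebesgue_integral_def set_lebesgue_integral_def zero_ereal_def)
next
  case False
  then have "seg_sign t = (\<lambda>s. - indicator {t<..<0} s)"
    by (auto simp: seg_sign_def indicator_def fun_eq_iff)
  then show ?thesis using False
    by (simp add: prim_def interval_lebesgue_integral_def set_lebesgue_integral_def zero_ereal_def)
qed

lemma interval_integrable_iff_seg_sign:
  "interval_lebesgue_integrable lborel 0 (ereal t) f \<longleftrightarrow> integrable lborel (\<lambda>s. seg_sign t s *\<^sub>R f s)"
proof (cases "0 \<le> t")
  case True
  then have "seg_sign t = indicator {0<..<t}"
    by (auto simp: seg_sign_def indicator_def fun_eq_iff)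
  then show ?thesis using True
    by (simp add: interval_lebesgue_integrable_def set_integrable_def zero_ereal_def)
next
  case False
  then have "seg_sign t = (\<lambda>s. - indicator {t<..<0} s)"
    by (auto simp: seg_sign_def indicator_def fun_eq_iff)
  then show ?thesis using False
    by (simp add: interval_lebesgue_integrable_def set_integrable_def zero_ereal_def)
qed

lemma integrable_seg_sign:
  fixes f :: "real \<Rightarrow> L2"
  assumes "integrable lborel f" shows "integrable lborel (\<lambda>s. seg_sign t s *\<^sub>R f s)"
proof (rule Bochner_Integration.integrable_bound[OF assms])
  note [measurable] = borel_measurable_integrable[OF assms]
  show "(\<lambda>s. seg_sign t s *\<^sub>R f s) \<in> borel_measurable lborel" by measurable
  show "AE s in lborel. norm (seg_sign t s *\<^sub>R f s) \<le> norm (f s)"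
    using abs_seg_sign_le by (intro AE_I2) (simp add: mult_left_le_one_le)
qed

lemma prim_diff:
  "integrable lborel f \<Longrightarrow> integrable lborel g \<Longrightarrow> prim f t - prim g t = prim (\<lambda>s. f s - g s) t"
  unfolding prim_def by (simp add: integrable_seg_sign scaleR_diff_right)

lemma prim_bounded_linear:
  assumes T: "bounded_linear T" and f: "integrable lborel (\<lambda>s. seg_sign t s *\<^sub>R f s)"
  shows "T (prim f t) = prim (\<lambda>s. T (f s)) t"
  unfolding prim_def
  by (subst integral_bounded_linear[OF T f, symmetric]) (simp add: linear_simps(5)[OF T])

lemma norm_prim_le:
  assumes f: "integrable lborel f" shows "norm (prim f t) \<le> (LINT s|lborel. norm (f s))"
proof -
  have "norm (prim f t) \<le> (LINT s|lborel. norm (seg_sign t s *\<^sub>R f s))"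
    unfolding prim_def by (rule integral_norm_bound)
  also have "\<dots> \<le> (LINT s|lborel. norm (f s))"
    using abs_seg_sign_le
    by (intro integral_mono integrable_norm integrable_seg_sign f) (simp add: mult_left_le_one_le)
  finally show ?thesis .
qed

lemma prim_zero [simp]: "prim (\<lambda>s. 0) t = 0"
  by (simp add: prim_def)

text \<open>For \<open>s \<noteq> t\<close> the value \<open>seg_sign (u n) s\<close> is eventually
  constant when \<open>u n\<close> tends to \<open>t\<close>, so dominated convergence applies off
  one point.\<close>

lemma continuous_prim:
  assumes f: "integrable lborel f" shows "continuous_on UNIV (prim f)"
proof -
  note [measurable] = borel_measurable_integrable[OF f]
  have "isCont (prim f) t" for t
    unfolding continuous_at_sequentially o_def
  proof (intro allI impI)
    fix u assume u: "u \<longlonglongrightarrow> t"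
    show "(\<lambda>n. prim f (u n)) \<longlonglongrightarrow> prim f t"
      unfolding prim_def
    proof (rule integral_dominated_convergence[where w = "\<lambda>s. norm (f s)"])
      show "AE s in lborel. (\<lambda>n. seg_sign (u n) s *\<^sub>R f s) \<longlonglongrightarrow> seg_sign t s *\<^sub>R f s"
        using AE_neq[of t]
      proof eventually_elim
        case (elim s)
        have "\<forall>\<^sub>F n in sequentially. seg_sign (u n) s = seg_sign t s"
        proof (cases "s < t")
          case True
          from order_tendstoD(1)[OF u True] show ?thesis
            by eventually_elim (use True in \<open>auto simp: seg_sign_def indicator_def\<close>)
        next
          case False
          with elim have "t < s" by simp
          from order_tendstoD(2)[OF u this] show ?thesis
            by eventually_elim (use \<open>t < s\<close> in \<open>auto simp: seg_sign_def indicator_def\<close>)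
        qed
        then show ?case by (intro tendsto_scaleR tendsto_const tendsto_eventually)
      qed
      show "AE s in lborel. norm (seg_sign (u n) s *\<^sub>R f s) \<le> norm (f s)" for n
        using abs_seg_sign_le by (intro AE_I2) (simp add: mult_left_le_one_le)
    qed (use f in auto)
  qed
  then show ?thesis by (simp add: continuous_at_imp_continuous_on)
qed

text \<open>The limit is the Duhamel integral over all positive times, from which the scattering
  state is formed.\<close>

lemma prim_tendsto_at_top:
  assumes f: "integrable lborel f"
  shows "(prim f \<longlongrightarrow> (LINT s|lborel. indicator {0<..} s *\<^sub>R f s)) at_top"
  unfolding prim_def
proof (rule integral_dominated_convergence_at_top[where w = "\<lambda>s. norm (f s)"])
  note [measurable] = borel_measurable_integrable[OF f]
  show "(\<lambda>s. indicator {0<..} s *\<^sub>R f s) \<in> borel_measurable lborel" by measurable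
  show "(\<lambda>s. seg_sign t s *\<^sub>R f s) \<in> borel_measurable lborel" for t by measurable
  show "\<forall>\<^sub>F t in at_top. AE s in lborel. norm (seg_sign t s *\<^sub>R f s) \<le> norm (f s)"
    using abs_seg_sign_le by (intro always_eventually allI AE_I2) (simp add: mult_left_le_one_le)
  show "AE s in lborel. ((\<lambda>t. seg_sign t s *\<^sub>R f s) \<longlongrightarrow> indicator {0<..} s *\<^sub>R f s) at_top"
  proof (rule AE_I2)
    fix s
    have "\<forall>\<^sub>F t in at_top. seg_sign t s = indicator {0<..} s"
      using eventually_gt_at_top[of "max s 0"]
      by eventually_elim (auto simp: seg_sign_def indicator_def)
    then show "((\<lambda>t. seg_sign t s *\<^sub>R f s) \<longlongrightarrow> indicator {0<..} s *\<^sub>R f s) at_top"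
      by (intro tendsto_scaleR tendsto_const tendsto_eventually)
  qed
qed (use f in auto)

lemma scaleR_L2_eq: "r *\<^sub>R x = scaleC_L2 (complex_of_real r) x"
proof -
  obtain f where f: "lsq f" "x = to_L2 f" by (meson L2_cases)
  show ?thesis using to_L2_scaleR[OF f(1), of r] by (simp add: f scaleC_to_L2)
qed

lemma linf_le_scaleR: "linf_le x K \<Longrightarrow> linf_le (r *\<^sub>R x) (\<bar>r\<bar> * K)"
  using linf_le_scaleC[of x K "complex_of_real r"] by (simp add: scaleR_L2_eq)

lemma linf_le_prim:
  assumes f: "integrable lborel f" and k: "integrable lborel k" "AE s in lborel. linf_le (f s) (k s)"
  shows "linf_le (prim f t) (integral\<^sup>L lborel k)"
  unfolding prim_def
proof (rule linf_le_integral[OF integrable_seg_sign[OF f] k(1)])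
  show "AE s in lborel. 0 \<le> k s" using k(2) by eventually_elim (rule linf_le_nonneg)
  show "AE s in lborel. linf_le (seg_sign t s *\<^sub>R f s) (k s)"
    using k(2)
  proof eventually_elim
    case (elim s)
    show ?case
      by (rule linf_le_mono[OF linf_le_scaleR[OF elim]])
         (use abs_seg_sign_le linf_le_nonneg[OF elim] in \<open>auto intro: mult_left_le_one_le\<close>)
  qed
qed

text \<open>The constant \<open>576\<close> makes the Duhamel map a contraction with factor one half for the weighted norm
  \<open>sup\<^sub>t \<parallel>u(t)\<parallel>\<^sub>\<infinity> / wt \<tau> t\<close> on the ball of radius \<open>4\<close>.\<close>

locale small_data =
  fixes a :: "real \<Rightarrow> complex" and M \<tau> :: real and \<phi> :: L2
  assumes a: "integrable lborel a" "lsq a" "AE x in lborel. cmod (a x) \<le> M"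
    and \<tau>: "\<tau> > 0"
    and small: "576 * pi * L1_norm a * sqrt \<tau> \<le> 1"
    and \<phi>: "\<And>t. linf_le (schroedinger t \<phi>) (2 * wt \<tau> t)"
begin

definition adm :: "(real \<Rightarrow> L2) \<Rightarrow> bool" where
  "adm u \<longleftrightarrow> continuous_on UNIV u \<and> (\<forall>t. linf_le (u t) (4 * wt \<tau> t))"

text \<open>The interaction picture: pulling the free flow out of Duhamel's integral leaves an
  integrand independent of the final time, so that \<open>prim\<close> of it is continuous and has a
  limit at infinity.\<close>

definition nonlin :: "(real \<Rightarrow> L2) \<Rightarrow> real \<Rightarrow> L2" where
  "nonlin u s = schroedinger (- s) (cubic a (u s))"

definition picard :: "(real \<Rightarrow> L2) \<Rightarrow> real \<Rightarrow> L2" where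
  "picard u t = schroedinger t (\<phi> - scaleC_L2 \<i> (prim (nonlin u) t))"

text \<open>\<open>288 = 48 * 6\<close>, where \<open>48 = 3 * 4^2\<close> is the cubic Lipschitz
  constant on the ball of radius 4 and \<open>6 * pi\<close> comes from \<open>wt_kernel\<close>.
  The smallness assumption says \<open>2 * \<kappa> \<le> 1\<close>.\<close>

abbreviation "\<kappa> \<equiv> 288 * pi * L1_norm a * sqrt \<tau>"

lemma wt_pos: "0 < wt \<tau> t" and wt_nonneg: "0 \<le> wt \<tau> t" and wt_le: "wt \<tau> t \<le> 1"
  using wt_bounds[OF \<tau>, of t] by auto

lemma adm_linf: "adm u \<Longrightarrow> linf_le (u t) (4 * wt \<tau> t)" and adm_cont: "adm u \<Longrightarrow> continuous_on UNIV u"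
  by (auto simp: adm_def)

lemma adm_linf_4: "adm u \<Longrightarrow> linf_le (u t) 4"
  by (rule linf_le_mono[OF adm_linf]) (use wt_le[of t] in auto)

lemma nonlin_continuous: "adm u \<Longrightarrow> continuous_on UNIV (nonlin u)"
  unfolding nonlin_def
  by (intro continuous_schroedinger_apply continuous_cubic[OF a adm_cont adm_linf_4] continuous_intros)

lemma nonlin_integrable:
  assumes u: "adm u"
  shows "integrable lborel (nonlin u)"
proof (rule Bochner_Integration.integrable_bound)
  show "integrable lborel (\<lambda>s. 192 * norm (to_L2 a) * wt \<tau> s ^ 3)" using wt_cube_integral(1)[OF \<tau>] by simp
  show "nonlin u \<in> borel_measurable lborel"
    using borel_measurable_continuous_onI[OF nonlin_continuous[OF u]] by simp
  have "norm (nonlin u s) \<le> 192 * norm (to_L2 a) * wt \<tau> s ^ 3" for s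
    using cubic_linf(1)[OF a(1,2) adm_linf[OF u, of s]] by (simp add: nonlin_def power_mult_distrib mult_ac)
  then show "AE s in lborel. norm (nonlin u s) \<le> norm (192 * norm (to_L2 a) * wt \<tau> s ^ 3)"
    using wt_nonneg by (intro AE_I2) simp
qed

lemma picard_continuous: "adm u \<Longrightarrow> continuous_on UNIV (picard u)"
  unfolding picard_def
  by (intro continuous_schroedinger_apply continuous_intros continuous_prim nonlin_integrable
      bounded_linear.continuous_on[OF bounded_linear_scaleC_L2])

lemma scaleC_diff: "scaleC_L2 c (x - y) = scaleC_L2 c x - scaleC_L2 c y"
  by (rule linear_simps(2)[OF bounded_linear_scaleC_L2])

lemma picard_diff:
  assumes u: "adm u" "adm v"
  shows "picard u t - picard v t = scaleC_L2 (- \<i>) (prim (\<lambda>s. schroedinger t (nonlin u s - nonlin v s)) t)"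
proof -
  have i: "integrable lborel (\<lambda>s. nonlin u s - nonlin v s)" using u by (simp add: nonlin_integrable)
  have "picard u t - picard v t = schroedinger t (scaleC_L2 \<i> (prim (nonlin v) t) - scaleC_L2 \<i> (prim (nonlin u) t))"
    unfolding picard_def by (simp flip: schroedinger_diff)
  also have "\<dots> = scaleC_L2 \<i> (schroedinger t (prim (nonlin v) t - prim (nonlin u) t))"
    by (simp only: scaleC_diff[symmetric] schroedinger_scaleC)
  also have "\<dots> = scaleC_L2 (- \<i>) (schroedinger t (prim (nonlin u) t - prim (nonlin v) t))"
  proof -
    have "scaleC_L2 \<i> (- x) = scaleC_L2 (- \<i>) x" for x
    proof -
      obtain f where f: "lsq f" "x = to_L2 f" by (meson L2_cases)
      show ?thesis by (simp add: f uminus_L2_eq scaleC_to_L2 lsq_cmult lsq_uminus)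
    qed
    then show ?thesis by (metis minus_diff_eq schroedinger_diff)
  qed
  also have "\<dots> = scaleC_L2 (- \<i>) (prim (\<lambda>s. schroedinger t (nonlin u s - nonlin v s)) t)"
    unfolding prim_diff[OF nonlin_integrable[OF u(1)] nonlin_integrable[OF u(2)]]
    by (subst prim_bounded_linear[OF bounded_linear_schroedinger integrable_seg_sign[OF i]]) simp
  finally show ?thesis .
qed

text \<open>One weighted supremum distance \<open>d\<close> controls the images twice: again in the
  weighted norm, which gives the contraction, and in L2, which is the complete space where limits
  are taken. In the second bound \<open>96 = 48 * 2\<close>, with \<open>2 * pi * \<tau>\<close>
  from \<open>wt_cube_integral\<close>.\<close>

lemma picard_diff_bounds:
  assumes u: "adm u" "adm v" and d: "\<And>s. linf_le (u s - v s) (d * wt \<tau> s)"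
  shows "linf_le (picard u t - picard v t) (\<kappa> * d * wt \<tau> t)"
    and "norm (picard u t - picard v t) \<le> 96 * pi * \<tau> * norm (to_L2 a) * d"
proof -
  have d0: "0 \<le> d" using linf_le_nonneg[OF d[of 0]] wt_pos[of 0] by (simp add: zero_le_mult_iff)
  let ?f = "\<lambda>s. schroedinger t (nonlin u s - nonlin v s)"
  have i: "integrable lborel (\<lambda>s. nonlin u s - nonlin v s)" using u by (simp add: nonlin_integrable)
  have if_: "integrable lborel ?f" by (rule integrable_bounded_linear[OF bounded_linear_schroedinger i])
  have eq: "?f s = schroedinger (t - s) (cubic a (u s) - cubic a (v s))" for s
    unfolding nonlin_def by (simp flip: schroedinger_diff)
  let ?k = "\<lambda>s. 48 * d * L1_norm a * (wt \<tau> s ^ 3 / sqrt \<bar>t - s\<bar>)"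
  have "linf_le (prim ?f t) (integral\<^sup>L lborel ?k)"
  proof (rule linf_le_prim[OF if_])
    show "integrable lborel ?k" by (rule integrable_mult_right[OF wt_kernel(1)[OF \<tau>]])
    show "AE s in lborel. linf_le (?f s) (?k s)"
      using AE_neq[of t]
    proof eventually_elim
      case (elim s)
      have "linf_le (?f s) (3 * (4 * wt \<tau> s)\<^sup>2 * (d * wt \<tau> s) * L1_norm a / sqrt \<bar>t - s\<bar>)"
        unfolding eq by (rule cubic_diff_linf(2)[OF a(1,2) adm_linf[OF u(1)] adm_linf[OF u(2)] d]) (use elim in simp)
      then show ?case by (simp add: power2_eq_square power3_eq_cube mult_ac)
    qed
  qed
  then have "linf_le (picard u t - picard v t) (integral\<^sup>L lborel ?k)"
    using linf_le_scaleC[of "prim ?f t" "integral\<^sup>L lborel ?k" "- \<i>"] by (simp add: picard_diff[OF u])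
  then show "linf_le (picard u t - picard v t) (\<kappa> * d * wt \<tau> t)"
  proof (rule linf_le_mono)
    have "integral\<^sup>L lborel ?k = 48 * d * L1_norm a * (LINT s|lborel. wt \<tau> s ^ 3 / sqrt \<bar>t - s\<bar>)"
      by (rule integral_mult_right_zero)
    also have "\<dots> \<le> 48 * d * L1_norm a * (6 * pi * sqrt \<tau> * wt \<tau> t)"
      using d0 by (intro mult_left_mono wt_kernel(2)[OF \<tau>]) simp
    finally show "integral\<^sup>L lborel ?k \<le> \<kappa> * d * wt \<tau> t" by (simp add: mult_ac)
  qed
  have "norm (picard u t - picard v t) \<le> (LINT s|lborel. norm (?f s))"
    unfolding picard_diff[OF u] using norm_prim_le[OF if_, of t] by simp
  also have "\<dots> \<le> (LINT s|lborel. 48 * d * norm (to_L2 a) * wt \<tau> s ^ 3)"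
  proof (rule integral_mono[OF integrable_norm[OF if_]])
    show "norm (?f s) \<le> 48 * d * norm (to_L2 a) * wt \<tau> s ^ 3" for s
      using cubic_diff_linf(1)[OF a(1,2) adm_linf[OF u(1)] adm_linf[OF u(2)] d, of s]
      unfolding eq norm_schroedinger by (simp add: power2_eq_square power3_eq_cube mult_ac)
  qed (use wt_cube_integral(1)[OF \<tau>] in simp)
  also have "\<dots> = 48 * d * norm (to_L2 a) * (LINT s|lborel. wt \<tau> s ^ 3)" by simp
  also have "\<dots> \<le> 48 * d * norm (to_L2 a) * (2 * pi * \<tau>)"
    using d0 by (intro mult_left_mono wt_cube_integral(2)[OF \<tau>]) simp
  finally show "norm (picard u t - picard v t) \<le> 96 * pi * \<tau> * norm (to_L2 a) * d" by (simp add: mult_ac)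
qed

lemma adm_0: "adm (\<lambda>t. 0)"
  using wt_nonneg by (auto simp: adm_def intro!: linf_le_0)

lemma picard_0: "picard (\<lambda>t. 0) t = schroedinger t \<phi>"
proof -
  have "nonlin (\<lambda>t. 0) = (\<lambda>s. 0)" unfolding nonlin_def
    by (auto simp: linear_simps(3)[OF bounded_linear_schroedinger])
  then show ?thesis unfolding picard_def by (simp add: linear_simps(3)[OF bounded_linear_scaleC_L2])
qed

lemma picard_minus_linear: "adm u \<Longrightarrow> linf_le (picard u t - schroedinger t \<phi>) (4 * \<kappa> * wt \<tau> t)"
  using picard_diff_bounds(1)[OF _ adm_0, of u 4 t] adm_linf[of u] by (simp add: picard_0 mult_ac)

lemma \<kappa>_le: "\<kappa> \<le> 1 / 2" and \<kappa>_nonneg: "0 \<le> \<kappa>"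
  using small \<tau> by simp_all

lemma adm_picard:
  assumes u: "adm u" shows "adm (picard u)"
  unfolding adm_def
proof (intro conjI allI)
  show "continuous_on UNIV (picard u)" by (rule picard_continuous[OF u])
  fix t
  have "linf_le (schroedinger t \<phi> + (picard u t - schroedinger t \<phi>)) (2 * wt \<tau> t + 4 * \<kappa> * wt \<tau> t)"
    by (rule linf_le_add[OF \<phi> picard_minus_linear[OF u]])
  moreover have "4 * \<kappa> * wt \<tau> t \<le> 2 * wt \<tau> t"
    using \<kappa>_le wt_nonneg[of t] by (intro mult_right_mono) auto
  ultimately show "linf_le (picard u t) (4 * wt \<tau> t)" by (auto elim: linf_le_mono)
qed

text \<open>The iterates contract in the weighted \<open>L\<^sup>\<infinity>\<close> norm, and because \<open>a\<close> is square integrable this controls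
  their \<open>L\<^sup>2\<close> distances; the limit is taken in \<open>L\<^sup>2\<close>.\<close>

lemma picard_fixed_point: "\<exists>u. adm u \<and> picard u = u"
proof -
  define u where "u n = (picard ^^ n) (\<lambda>t. 0)" for n
  have u_Suc: "u (Suc n) = picard (u n)" for n by (simp add: u_def)
  have adm: "adm (u n)" for n
    by (induction n) (simp_all add: u_def adm_0 adm_picard)
  have diff: "linf_le (u (Suc n) t - u n t) (2 * (1/2) ^ n * wt \<tau> t)" for n t
  proof (induction n arbitrary: t)
    case 0
    then show ?case using \<phi>[of t] by (simp add: u_def picard_0)
  next
    case (Suc n)
    have "linf_le (picard (u (Suc n)) t - picard (u n) t) (\<kappa> * (2 * (1/2) ^ n) * wt \<tau> t)"
      by (rule picard_diff_bounds(1)[OF adm adm Suc.IH])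
    moreover have "\<kappa> * (2 * (1/2) ^ n) * wt \<tau> t \<le> 1/2 * (2 * (1/2) ^ n) * wt \<tau> t"
      using \<kappa>_le wt_nonneg[of t] by (intro mult_right_mono) auto
    ultimately show ?case by (auto simp: u_Suc elim: linf_le_mono)
  qed
  \<comment> \<open>\<open>192 = 96 * 2\<close>, the 2 being the constant in \<open>diff\<close>.
    The L2 estimate sees only differences of Picard images, hence the summation starts from
    \<open>u 1\<close>.\<close>
  define C where "C = 192 * pi * \<tau> * norm (to_L2 a)"
  have diff_norm: "norm (u (Suc (Suc n)) t - u (Suc n) t) \<le> C * (1/2) ^ n" for n t
    using picard_diff_bounds(2)[OF adm adm diff, of n t] by (simp add: u_Suc C_def mult_ac)
  have "summable (\<lambda>n. C * (1/2::real) ^ n)" by (intro summable_mult summable_geometric) simp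
  then have "uniform_limit UNIV (\<lambda>n t. \<Sum>i<n. u (Suc (Suc i)) t - u (Suc i) t)
      (\<lambda>t. \<Sum>i. u (Suc (Suc i)) t - u (Suc i) t) sequentially"
    by (intro Weierstrass_m_test) (use diff_norm in auto)
  moreover have "(\<Sum>i<n. u (Suc (Suc i)) t - u (Suc i) t) = u (Suc n) t - u 1 t" for n t
    using sum_lessThan_telescope[of "\<lambda>i. u (Suc i) t" n] by simp
  ultimately obtain g where "uniform_limit UNIV (\<lambda>n t. u (Suc n) t - u 1 t) g sequentially" by auto
  then have "uniform_limit UNIV (\<lambda>n t. (u (Suc n) t - u 1 t) + u 1 t) (\<lambda>t. g t + u 1 t) sequentially"
    by (rule uniform_limit_add) (rule uniform_limit_const)
  then have ul: "uniform_limit UNIV (\<lambda>n. u (Suc n)) (\<lambda>t. g t + u 1 t) sequentially" by simp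
  define U where "U t = g t + u 1 t" for t
  have lim: "(\<lambda>n. u (Suc n) t) \<longlonglongrightarrow> U t" for t
    using tendsto_uniform_limitI[OF ul] by (simp add: U_def)
  have lim': "(\<lambda>n. u n t) \<longlonglongrightarrow> U t" for t by (rule LIMSEQ_imp_Suc[OF lim])
  have contU: "continuous_on UNIV U"
    using uniform_limit_theorem[OF _ ul] adm_cont[OF adm] by (simp add: U_def[abs_def])
  have linfU: "linf_le (U t) (4 * wt \<tau> t)" for t
    by (rule linf_le_lim[OF _ adm_linf[OF adm] lim']) (use wt_nonneg[of t] in auto)
  have admU: "adm U" using contU linfU by (simp add: adm_def)
  \<comment> \<open>The bound is the exact geometric partial sum, so that the induction closes; the
    simpler bound \<open>4 * (1/2) ^ n\<close> is extracted afterwards in \<open>dU\<close>.\<close>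
  have tail: "linf_le (u (n + m) t - u n t) ((4 * (1/2) ^ n - 4 * (1/2) ^ (n + m)) * wt \<tau> t)" for n m t
  proof (induction m)
    case (Suc m)
    have "linf_le ((u (n + m) t - u n t) + (u (Suc (n + m)) t - u (n + m) t))
      ((4 * (1/2) ^ n - 4 * (1/2) ^ (n + m)) * wt \<tau> t + 2 * (1/2) ^ (n + m) * wt \<tau> t)"
      by (rule linf_le_add[OF Suc diff])
    then show ?case by (simp add: algebra_simps)
  qed (simp add: linf_le_0)
  have dU: "linf_le (U t - u n t) (4 * (1/2) ^ n * wt \<tau> t)" for n t
  proof (rule linf_le_lim[where u = "\<lambda>m. u (n + m) t - u n t" and F = sequentially])
    show "(\<lambda>m. u (n + m) t - u n t) \<longlonglongrightarrow> U t - u n t"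
      using LIMSEQ_ignore_initial_segment[OF lim'[of t], of n] by (intro tendsto_intros) (simp add: add.commute)
    show "linf_le (u (n + m) t - u n t) (4 * (1/2) ^ n * wt \<tau> t)" for m
      by (rule linf_le_mono[OF tail]) (use wt_nonneg[of t] in \<open>auto intro!: mult_right_mono\<close>)
  qed (use wt_nonneg[of t] in auto)
  \<comment> \<open>By \<open>dU\<close> the iterates approach \<open>U\<close> in the weighted
    norm, so their Picard images converge to \<open>picard U t\<close> in L2; the same sequence
    converges to \<open>U t\<close>.\<close>
  have "picard U t = U t" for t
  proof -
    have "(\<lambda>n. picard (u n) t - picard U t) \<longlonglongrightarrow> 0"
    proof (rule Lim_null_comparison[OF always_eventually[OF allI]])
      show "norm (picard (u n) t - picard U t) \<le> 96 * pi * \<tau> * norm (to_L2 a) * (4 * (1/2) ^ n)" for n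
        using picard_diff_bounds(2)[OF admU adm dU, of t n] by (simp add: norm_minus_commute)
      have "(\<lambda>n. 96 * pi * \<tau> * norm (to_L2 a) * (4 * (1/2::real) ^ n)) \<longlonglongrightarrow> 96 * pi * \<tau> * norm (to_L2 a) * (4 * 0)"
        by (intro tendsto_intros LIMSEQ_power_zero) simp
      then show "(\<lambda>n. 96 * pi * \<tau> * norm (to_L2 a) * (4 * (1/2::real) ^ n)) \<longlonglongrightarrow> 0" by simp
    qed
    then have "(\<lambda>n. picard (u n) t) \<longlonglongrightarrow> picard U t" by (simp add: LIM_zero_iff)
    then show ?thesis using lim[of t] by (simp add: u_Suc LIMSEQ_unique)
  qed
  then show ?thesis using admU by (intro exI[of _ U]) auto
qed

end

section \<open>Uniqueness and the scattering map\<close>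

lemma Linf_norm_le: "linf_le x K \<Longrightarrow> Linf_norm (rep_L2 x) \<le> ennreal K"
  unfolding Linf_norm_def linf_le_def by (intro esssup_I) (auto elim!: eventually_mono intro: ennreal_leI)

lemma linf_le_Linf_norm:
  assumes "Linf_norm (rep_L2 x) < \<infinity>"
  shows "linf_le x (enn2real (Linf_norm (rep_L2 x)))"
proof -
  have "AE t in lborel. ennreal (cmod (rep_L2 x t)) \<le> Linf_norm (rep_L2 x)"
    unfolding Linf_norm_def by (rule esssup_AE)
  then show ?thesis unfolding linf_le_def
  proof eventually_elim
    case (elim t)
    then have "enn2real (ennreal (cmod (rep_L2 x t))) \<le> enn2real (Linf_norm (rep_L2 x))"
      using assms by (intro enn2real_mono) auto
    then show ?case by simp
  qed
qed

lemma Linf_norm_le_iff: "0 \<le> K \<Longrightarrow> Linf_norm (rep_L2 x) \<le> ennreal K \<longleftrightarrow> linf_le x K"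
proof
  assume K: "0 \<le> K" "Linf_norm (rep_L2 x) \<le> ennreal K"
  then have fin: "Linf_norm (rep_L2 x) < \<infinity>" by (auto intro: le_less_trans)
  have "enn2real (Linf_norm (rep_L2 x)) \<le> K"
    using K by (intro enn2real_leI) auto
  then show "linf_le x K" by (rule linf_le_mono[OF linf_le_Linf_norm[OF fin]])
qed (rule Linf_norm_le)

text \<open>Sublevel sets at finite levels are closed because \<open>linf_le\<close> survives L2
  limits: the supremum norm is lower semicontinuous along a continuous curve in L2.\<close>

lemma Linf_norm_measurable:
  assumes v: "continuous_on UNIV (v :: real \<Rightarrow> L2)"
  shows "(\<lambda>t. Linf_norm (rep_L2 (v t))) \<in> borel_measurable borel"
proof (rule borel_measurableI_le)
  fix y :: ennreal
  show "{t \<in> space borel. Linf_norm (rep_L2 (v t)) \<le> y} \<in> sets borel"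
  proof (cases y)
    case (real K)
    have "closed {t. linf_le (v t) K}"
      unfolding closed_sequential_limits
    proof (intro allI impI)
      fix x l assume "(\<forall>n. x n \<in> {t. linf_le (v t) K}) \<and> x \<longlonglongrightarrow> l"
      then have x: "\<And>n. linf_le (v (x n)) K" "x \<longlonglongrightarrow> l" by auto
      have "isCont v l" using v by (simp add: continuous_on_eq_continuous_at)
      then have vl: "(\<lambda>n. v (x n)) \<longlonglongrightarrow> v l" by (rule isCont_tendsto_compose[OF _ x(2)])
      then show "l \<in> {t. linf_le (v t) K}" using linf_le_lim[OF real(1) x(1) vl] by simp
    qed
    then show ?thesis using real by (simp add: Linf_norm_le_iff)
  qed simp
qed

lemma integrable_indicator_Icc: "integrable lborel (indicator {a..b} :: real \<Rightarrow> real)" for a b :: real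
  by (rule integrable_real_indicator) (auto simp: emeasure_lborel_Icc_eq)

text \<open>Cut at a high level: \<open>g \<le> N + max 0 (g - N)\<close>, where the excess has
  small integral and the constant is paid for by a short interval. One length \<open>d\<close> works
  for every position \<open>a\<close>, as stepping along the whole line requires.\<close>

lemma absolutely_continuous_integral:
  fixes g :: "real \<Rightarrow> real"
  assumes g: "integrable lborel g" and e: "e > 0"
  obtains d where "d > 0" "\<And>a. (LINT s|lborel. indicator {a..a + d} s * g s) \<le> e"
proof -
  note [measurable] = borel_measurable_integrable[OF g]
  have "(\<lambda>N. LINT s|lborel. max 0 (g s - real N)) \<longlonglongrightarrow> (LINT s|(lborel :: real measure). 0)"
  proof (rule integral_dominated_convergence[where w = "\<lambda>s. \<bar>g s\<bar>"])
    show "AE s in lborel. (\<lambda>N. max 0 (g s - real N)) \<longlonglongrightarrow> 0"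
    proof (rule AE_I2)
      fix s
      obtain N where "g s < real N" using reals_Archimedean2 by blast
      then show "(\<lambda>N. max 0 (g s - real N)) \<longlonglongrightarrow> 0"
        by (intro tendsto_eventually eventually_mono[OF eventually_ge_at_top[of N]]) auto
    qed
  qed (use g in auto)
  then have "\<forall>\<^sub>F N in sequentially. (LINT s|lborel. max 0 (g s - real N)) < e / 2"
    by (rule order_tendstoD(2)) (use e in simp)
  then obtain N where N: "(LINT s|lborel. max 0 (g s - real N)) < e / 2" by (auto simp: eventually_sequentially)
  define d where "d = e / (2 * (real N + 1))"
  have d: "d > 0" using e by (simp add: d_def)
  have imax: "integrable lborel (\<lambda>s. max 0 (g s - real N))"
    by (rule Bochner_Integration.integrable_bound[OF integrable_abs[OF g]]) auto
  show ?thesis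
  proof (rule that[OF d])
    fix a
    have "(LINT s|lborel. indicator {a..a + d} s * g s) \<le> (LINT s|lborel. real N * indicator {a..a + d} s + max 0 (g s - real N))"
    proof (rule integral_mono)
      show "integrable lborel (\<lambda>s. indicator {a..a + d} s * g s)"
        using integrable_mult_indicator[OF _ g, of "{a..a + d}"] by simp
      show "integrable lborel (\<lambda>s. real N * indicator {a..a + d} s + max 0 (g s - real N))"
        by (intro Bochner_Integration.integrable_add imax integrable_mult_right integrable_indicator_Icc)
    qed (auto simp: indicator_def)
    also have "\<dots> = real N * d + (LINT s|lborel. max 0 (g s - real N))" using imax d by simp
    also have "real N * d \<le> e / 2" using e by (simp add: d_def field_simps)
    finally show "(LINT s|lborel. indicator {a..a + d} s * g s) \<le> e" using N by simp
  qed
qed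

lemma seg_sign_nonzero: "seg_sign t s \<noteq> 0 \<Longrightarrow> 0 < s \<and> s < t \<or> t < s \<and> s < 0"
  by (cases "0 < s \<and> s < t"; cases "t < s \<and> s < 0") (auto simp: seg_sign_def)

text \<open>If \<open>w\<close> vanishes on \<open>[- n d, n d]\<close>, then its maximum over \<open>[- (n + 1) d, (n + 1) d]\<close> is at most half of
  itself.\<close>

lemma gronwall_zero:
  fixes w k :: "real \<Rightarrow> real"
  assumes w: "continuous_on UNIV w" "\<And>t. 0 \<le> w t"
    and k: "\<And>a b. integrable lborel (\<lambda>s. indicator {a..b} s * k s)" "\<And>s. 0 \<le> k s"
    and small: "d > 0" "\<And>a. (LINT s|lborel. indicator {a..a + d} s * k s) \<le> 1 / 2"
    and le: "\<And>t. w t \<le> (LINT s|lborel. \<bar>seg_sign t s\<bar> * (k s * w s))"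
  shows "w t = 0"
proof -
  have zero: "w t = 0" if "\<bar>t\<bar> \<le> real n * d" for n t
    using that
  proof (induction n arbitrary: t)
    case 0
    have "seg_sign 0 s = 0" for s by (simp add: seg_sign_def)
    then show ?case using le[of 0] w(2)[of 0] 0 by simp
  next
    case (Suc n)
    let ?K = "{- (real (Suc n) * d)..real (Suc n) * d}"
    have "0 \<in> ?K" using small(1) by simp
    then have "\<exists>t1\<in>?K. \<forall>t\<in>?K. w t \<le> w t1"
      by (intro continuous_attains_sup compact_Icc continuous_on_subset[OF w(1)]) auto
    then obtain t1 where t1: "t1 \<in> ?K" and max: "\<And>t. t \<in> ?K \<Longrightarrow> w t \<le> w t1" by blast
    \<comment> \<open>Outside the region where \<open>w\<close> already vanishes, the segment from 0
      to \<open>t1\<close> lies in a single end interval of length \<open>d\<close>: the right one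
      or the left one, according to the sign of \<open>t1\<close>.\<close>
    define a where "a = (if 0 \<le> t1 then real n * d else - (real (Suc n) * d))"
    have step: "\<bar>seg_sign t1 s\<bar> * (k s * w s) \<le> w t1 * (indicator {a..a + d} s * k s)" for s
    proof (cases "\<bar>seg_sign t1 s\<bar> * (k s * w s) = 0")
      case True
      show ?thesis unfolding True using k(2)[of s] w(2)[of t1] by (intro mult_nonneg_nonneg) auto
    next
      case False
      then have s: "seg_sign t1 s \<noteq> 0" "w s \<noteq> 0" by auto
      from s(2) Suc.IH[of s] have ns: "\<not> \<bar>s\<bar> \<le> real n * d" by blast
      have seg: "0 < s \<and> s < t1 \<or> t1 < s \<and> s < 0" by (rule seg_sign_nonzero[OF s(1)])
      then have "s \<in> {a..a + d}" using ns t1 by (auto simp: a_def algebra_simps)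
      moreover have "s \<in> ?K" using seg t1 by auto
      then have "w s \<le> w t1" by (rule max)
      moreover have "\<bar>seg_sign t1 s\<bar> * (k s * w s) \<le> 1 * (k s * w s)"
        by (rule mult_right_mono[OF abs_seg_sign_le]) (use k(2) w(2) in simp)
      moreover have "k s * w s \<le> k s * w t1" using calculation(2) k(2)[of s] by (rule mult_left_mono)
      ultimately show ?thesis by (simp add: mult.commute)
    qed
    have [measurable]: "w \<in> borel_measurable borel" by (rule borel_measurable_continuous_onI[OF w(1)])
    have "w t1 \<le> (LINT s|lborel. \<bar>seg_sign t1 s\<bar> * (k s * w s))" by (rule le)
    also have "\<dots> \<le> (LINT s|lborel. w t1 * (indicator {a..a + d} s * k s))"
    proof (rule integral_mono_AE')
      show "integrable lborel (\<lambda>s. w t1 * (indicator {a..a + d} s * k s))" using k(1) by simp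
      show "AE s in lborel. \<bar>seg_sign t1 s\<bar> * (k s * w s) \<le> w t1 * (indicator {a..a + d} s * k s)" using step by simp
      show "AE s in lborel. 0 \<le> w t1 * (indicator {a..a + d} s * k s)"
        using k(2) w(2) by (intro AE_I2 mult_nonneg_nonneg) auto
    qed
    also have "\<dots> = w t1 * (LINT s|lborel. indicator {a..a + d} s * k s)" by simp
    also have "\<dots> \<le> w t1 * (1 / 2)" by (rule mult_left_mono[OF small(2) w(2)])
    finally have "w t1 = 0" using w(2)[of t1] by simp
    moreover have "t \<in> ?K" using Suc.prems by auto
    ultimately show ?case using max[of t] w(2)[of t] by simp
  qed
  obtain n :: nat where "\<bar>t\<bar> / d < real n" using reals_Archimedean2 by blast
  then have "\<bar>t\<bar> \<le> real n * d" using small(1) by (simp add: field_simps)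
  then show ?thesis by (rule zero)
qed

context small_data begin

definition sol :: "real \<Rightarrow> L2" where
  "sol = (SOME u. adm u \<and> picard u = u)"

lemma adm_sol: "adm sol" and picard_sol: "picard sol = sol"
  using someI_ex[OF picard_fixed_point] unfolding sol_def by auto

lemma sol_eq: "sol t = schroedinger t \<phi> - scaleC_L2 \<i> (prim (\<lambda>s. schroedinger (t - s) (cubic a (sol s))) t)"
proof -
  have "sol t = schroedinger t \<phi> - scaleC_L2 \<i> (schroedinger t (prim (nonlin sol) t))"
    using picard_sol[unfolded fun_eq_iff picard_def, rule_format, of t] by (simp add: schroedinger_diff schroedinger_scaleC)
  also have "schroedinger t (prim (nonlin sol) t) = prim (\<lambda>s. schroedinger t (nonlin sol s)) t"
    by (rule prim_bounded_linear[OF bounded_linear_schroedinger integrable_seg_sign[OF nonlin_integrable[OF adm_sol]]])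
  finally show ?thesis by (simp add: nonlin_def)
qed

lemma sol_duhamel_integrable: "integrable lborel (\<lambda>s. schroedinger (t - s) (cubic a (sol s)))"
  using integrable_bounded_linear[OF bounded_linear_schroedinger nonlin_integrable[OF adm_sol], of t]
  by (simp add: nonlin_def)

lemma nls_solution_sol: "nls_solution a \<phi> sol"
  unfolding nls_solution_def interval_integral_eq_prim interval_integrable_iff_seg_sign
proof (intro conjI allI)
  show "continuous_on UNIV sol" by (rule adm_cont[OF adm_sol])
  have "(\<integral>\<^sup>+ t. Linf_norm (rep_L2 (sol t)) ^ 4 \<partial>lborel) \<le> (\<integral>\<^sup>+ t. ennreal ((4 * wt \<tau> t) ^ 4) \<partial>lborel)"
  proof (rule nn_integral_mono)
    fix t
    have "Linf_norm (rep_L2 (sol t)) ^ 4 \<le> ennreal (4 * wt \<tau> t) ^ 4"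
      by (intro power_mono Linf_norm_le adm_linf[OF adm_sol]) simp
    then show "Linf_norm (rep_L2 (sol t)) ^ 4 \<le> ennreal ((4 * wt \<tau> t) ^ 4)"
      using wt_nonneg[of t] by (simp add: ennreal_power)
  qed
  also have "\<dots> = ennreal (LINT t|lborel. (4 * wt \<tau> t) ^ 4)"
    by (rule nn_integral_eq_integral) (use wt_cube_integral(3)[OF \<tau>] in \<open>auto simp: power_mult_distrib\<close>)
  also have "\<dots> < \<infinity>" by simp
  finally show "(\<integral>\<^sup>+ t. Linf_norm (rep_L2 (sol t)) ^ 4 \<partial>lborel) < \<infinity>" .
  show "integrable lborel (\<lambda>s. seg_sign t s *\<^sub>R schroedinger (t - s) (cubic a (sol s)))" for t
    by (rule integrable_seg_sign[OF sol_duhamel_integrable])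
  show "sol t = schroedinger t \<phi> - scaleC_L2 \<i> (prim (\<lambda>s. schroedinger (t - s) (cubic a (sol s))) t)" for t
    by (rule sol_eq)
qed

lemma M_nonneg: "0 \<le> M"
proof (rule ccontr)
  assume "\<not> 0 \<le> M"
  with a(3) have "AE x in (lborel :: real measure). False"
    by (auto elim!: eventually_mono) (smt (verit) norm_ge_zero)
  then show False using AE_lborel_not_False by blast
qed

text \<open>The competitor \<open>v\<close> has only a finite L4 norm in time of its supremum norm,
  so the weighted contraction does not apply. Its L2 distance to \<open>sol\<close> satisfies a
  Gronwall inequality whose kernel is locally integrable because \<open>m^4\<close> is
  integrable.\<close>

lemma nls_solution_unique:
  assumes v: "nls_solution a \<phi> v"
  shows "v = sol"
proof
  fix t
  define m where "m s = enn2real (Linf_norm (rep_L2 (v s)))" for s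
  note V = v[unfolded nls_solution_def interval_integral_eq_prim interval_integrable_iff_seg_sign]
  note cv = V[THEN conjunct1] and L4 = V[THEN conjunct2, THEN conjunct1]
    and iv = V[THEN conjunct2, THEN conjunct2, rule_format, THEN conjunct1]
    and ev = V[THEN conjunct2, THEN conjunct2, rule_format, THEN conjunct2]
  note [measurable] = Linf_norm_measurable[OF cv]
  have m_meas [measurable]: "m \<in> borel_measurable borel" unfolding m_def by measurable
  have m0: "0 \<le> m s" for s by (simp add: m_def)
  have "AE s in lborel. Linf_norm (rep_L2 (v s)) ^ 4 \<noteq> \<infinity>"
    by (rule nn_integral_PInf_AE) (use L4 in auto)
  then have fin: "AE s in lborel. Linf_norm (rep_L2 (v s)) < \<infinity>"
    by eventually_elim (auto simp: less_top power_eq_top_ennreal)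
  have im: "integrable lborel (\<lambda>s. m s ^ 4)"
  proof (rule integrableI_bounded)
    have "(\<integral>\<^sup>+ s. ennreal (norm (m s ^ 4)) \<partial>lborel) \<le> (\<integral>\<^sup>+ s. Linf_norm (rep_L2 (v s)) ^ 4 \<partial>lborel)"
    proof (rule nn_integral_mono_AE)
      show "AE s in lborel. ennreal (norm (m s ^ 4)) \<le> Linf_norm (rep_L2 (v s)) ^ 4"
        using fin
      proof eventually_elim
        case (elim s)
        have "ennreal (norm (m s ^ 4)) = ennreal (m s) ^ 4" using m0[of s] by (simp add: ennreal_power)
        then show ?case using elim by (simp add: m_def)
      qed
    qed
    also note L4
    finally show "(\<integral>\<^sup>+ s. ennreal (norm (m s ^ 4)) \<partial>lborel) < \<infinity>" .
  qed measurable
  \<comment> \<open>Both solutions are bounded by \<open>4 + m s\<close>, and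
    \<open>(4 + m)^2 \<le> 33 * (1 + m^4)\<close>; the Lipschitz factor 3 makes it 99.\<close>
  define k where "k s = 99 * M * (1 + m s ^ 4)" for s
  have k0: "0 \<le> k s" for s using M_nonneg m0[of s] by (simp add: k_def)
  define w where "w s = norm (sol s - v s)" for s
  have w0: "0 \<le> w s" for s by (simp add: w_def)
  have cw: "continuous_on UNIV w" unfolding w_def by (intro continuous_intros adm_cont[OF adm_sol] cv)
  have [measurable]: "w \<in> borel_measurable borel" by (rule borel_measurable_continuous_onI[OF cw])
  have diff: "AE s in lborel. norm (cubic a (sol s) - cubic a (v s)) \<le> k s * w s"
    using fin
  proof eventually_elim
    case (elim s)
    have 1: "linf_le (sol s) (4 + m s)" by (rule linf_le_mono[OF adm_linf_4[OF adm_sol]]) (use m0 in simp)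
    have 2: "linf_le (v s) (4 + m s)"
      by (rule linf_le_mono[OF linf_le_Linf_norm[OF elim]]) (simp add: m_def)
    have "norm (cubic a (sol s) - cubic a (v s)) \<le> 3 * (4 + m s)\<^sup>2 * M * norm (sol s - v s)"
      by (rule cubic_diff_L2[OF a 1 2])
    also have "\<dots> \<le> k s * w s"
    proof -
      have "2 * m s * 4 \<le> m s * m s + 4 * 4" using sum_squares_bound[of "m s" 4] by (simp add: power2_eq_square)
      moreover have "2 * (m s)\<^sup>2 * 1 \<le> ((m s)\<^sup>2)\<^sup>2 + 1\<^sup>2" by (rule sum_squares_bound)
      ultimately have "(4 + m s)\<^sup>2 \<le> 33 * (1 + m s ^ 4)"
        by (simp add: power2_eq_square power4_eq_xxxx algebra_simps)
          (use zero_le_power[OF m0[of s], of 4] in \<open>simp add: power4_eq_xxxx\<close>)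
      then have "3 * (4 + m s)\<^sup>2 * M \<le> 3 * (33 * (1 + m s ^ 4)) * M"
        using M_nonneg by (intro mult_right_mono mult_left_mono) auto
      then show ?thesis unfolding k_def w_def by (intro mult_right_mono) (auto simp: mult_ac)
    qed
    finally show ?case .
  qed
  have ik: "integrable lborel (\<lambda>s. indicator {a..b} s * k s)" for a b
  proof -
    have "integrable lborel (\<lambda>s. 99 * M * (indicator {a..b} s + indicator {a..b} s * m s ^ 4))"
      by (intro integrable_mult_right Bochner_Integration.integrable_add)
         (use integrable_mult_indicator[OF _ im, of "{a..b}"] integrable_indicator_Icc in auto)
    then show ?thesis by (simp add: k_def algebra_simps)
  qed
  have iw: "integrable lborel (\<lambda>s. \<bar>seg_sign t s\<bar> * (k s * w s))" for t
  proof -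
    have "compact (w ` {-\<bar>t\<bar>..\<bar>t\<bar>})" by (intro compact_continuous_image continuous_on_subset[OF cw]) auto
    then obtain B where B: "\<And>s. s \<in> {-\<bar>t\<bar>..\<bar>t\<bar>} \<Longrightarrow> norm (w s) \<le> B"
      using compact_imp_bounded bounded_iff by (metis imageI)
    have B0: "0 \<le> B" using B[of 0] norm_ge_zero order_trans by fastforce
    have "\<bar>seg_sign t s\<bar> * (k s * w s) \<le> B * (indicator {-\<bar>t\<bar>..\<bar>t\<bar>} s * k s)" for s
    proof (cases "seg_sign t s = 0")
      case True
      then show ?thesis using B0 k0[of s] by simp
    next
      case False
      have s: "s \<in> {-\<bar>t\<bar>..\<bar>t\<bar>}" using seg_sign_nonzero[OF False] by auto
      have "\<bar>seg_sign t s\<bar> * (k s * w s) \<le> 1 * (k s * w s)"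
        by (rule mult_right_mono[OF abs_seg_sign_le]) (use k0 w0 in simp)
      also have "k s * w s \<le> k s * B" using B[OF s] w0[of s] k0[of s] by (intro mult_left_mono) auto
      finally show ?thesis using s by (simp add: mult.commute)
    qed
    moreover have "(\<lambda>s. \<bar>seg_sign t s\<bar> * (k s * w s)) \<in> borel_measurable lborel" unfolding k_def by measurable
    ultimately show ?thesis
      using k0 w0 by (intro Bochner_Integration.integrable_bound[OF integrable_mult_right[OF ik[of "-\<bar>t\<bar>" "\<bar>t\<bar>"], of B]])
        (auto intro: order_trans[OF _ abs_ge_self])
  qed
  have le: "w t \<le> (LINT s|lborel. \<bar>seg_sign t s\<bar> * (k s * w s))" for t
  proof -
    let ?f = "\<lambda>s. schroedinger (t - s) (cubic a (v s))" and ?g = "\<lambda>s. schroedinger (t - s) (cubic a (sol s))"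
    have "sol t - v t = scaleC_L2 \<i> (prim ?f t) - scaleC_L2 \<i> (prim ?g t)"
      by (subst ev, subst sol_eq) simp
    then have "w t = norm (prim ?f t - prim ?g t)"
      unfolding w_def by (simp flip: scaleC_diff)
    also have "prim ?f t - prim ?g t = (LINT s|lborel. seg_sign t s *\<^sub>R ?f s - seg_sign t s *\<^sub>R ?g s)"
      unfolding prim_def using iv[of t] integrable_seg_sign[OF sol_duhamel_integrable, of t t] by simp
    also have "norm (LINT s|lborel. seg_sign t s *\<^sub>R ?f s - seg_sign t s *\<^sub>R ?g s)
        \<le> (LINT s|lborel. norm (seg_sign t s *\<^sub>R ?f s - seg_sign t s *\<^sub>R ?g s))" by (rule integral_norm_bound)
    also have "\<dots> \<le> (LINT s|lborel. \<bar>seg_sign t s\<bar> * (k s * w s))"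
    proof (rule integral_mono_AE)
      show "integrable lborel (\<lambda>s. norm (seg_sign t s *\<^sub>R ?f s - seg_sign t s *\<^sub>R ?g s))"
        by (intro integrable_norm Bochner_Integration.integrable_diff iv integrable_seg_sign sol_duhamel_integrable)
      show "AE s in lborel. norm (seg_sign t s *\<^sub>R ?f s - seg_sign t s *\<^sub>R ?g s) \<le> \<bar>seg_sign t s\<bar> * (k s * w s)"
        using diff
      proof eventually_elim
        case (elim s)
        have "norm (seg_sign t s *\<^sub>R ?f s - seg_sign t s *\<^sub>R ?g s) = \<bar>seg_sign t s\<bar> * norm (cubic a (v s) - cubic a (sol s))"
          by (simp flip: scaleR_diff_right schroedinger_diff)
        also have "\<dots> \<le> \<bar>seg_sign t s\<bar> * (k s * w s)"
          using elim by (intro mult_left_mono) (auto simp: norm_minus_commute)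
        finally show ?case .
      qed
    qed (rule iw)
    finally show ?thesis .
  qed
  \<comment> \<open>The constant part and the \<open>m^4\<close> part of \<open>k\<close> each get
    at most \<open>1 / (4 * (99 * M + 1))\<close> before multiplication by \<open>99 * M\<close>;
    the summand 1 keeps this meaningful for \<open>M = 0\<close>.\<close>
  obtain d where d: "d > 0" "\<And>a. (LINT s|lborel. indicator {a..a + d} s * k s) \<le> 1 / 2"
  proof -
    have e: "1 / (4 * (99 * M + 1)) > 0" using M_nonneg by simp
    obtain d0 where d0: "d0 > 0" "\<And>a. (LINT s|lborel. indicator {a..a + d0} s * m s ^ 4) \<le> 1 / (4 * (99 * M + 1))"
      by (rule absolutely_continuous_integral[OF im e]) blast
    define d where "d = min d0 (1 / (4 * (99 * M + 1)))"
    have d: "d > 0" "d \<le> d0" "d \<le> 1 / (4 * (99 * M + 1))" using d0(1) e by (auto simp: d_def)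
    show ?thesis
    proof (rule that[OF d(1)])
      fix a
      have i: "integrable lborel (\<lambda>s. indicator {a..a + r} s * m s ^ 4)" for r
        using integrable_mult_indicator[OF _ im, of "{a..a + r}"] by simp
      have "(LINT s|lborel. indicator {a..a + d} s * m s ^ 4) \<le> (LINT s|lborel. indicator {a..a + d0} s * m s ^ 4)"
        using d by (intro integral_mono i) (auto simp: indicator_def)
      then have 1: "(LINT s|lborel. indicator {a..a + d} s * m s ^ 4) \<le> 1 / (4 * (99 * M + 1))" using d0(2)[of a] by linarith
      have "(LINT s|lborel. indicator {a..a + d} s * k s) = (LINT s|lborel. 99 * M * (indicator {a..a + d} s + indicator {a..a + d} s * m s ^ 4))"
        by (simp add: k_def algebra_simps)
      also have "\<dots> = 99 * M * (d + (LINT s|lborel. indicator {a..a + d} s * m s ^ 4))"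
        using i[of d] d(1) by simp
      also have "\<dots> \<le> 99 * M * (1 / (4 * (99 * M + 1)) + 1 / (4 * (99 * M + 1)))"
        using 1 d M_nonneg by (intro mult_left_mono add_mono) auto
      also have "\<dots> \<le> 1 / 2" using M_nonneg by (simp add: field_simps)
      finally show "(LINT s|lborel. indicator {a..a + d} s * k s) \<le> 1 / 2" .
    qed
  qed
  have "w t = 0" by (rule gronwall_zero[OF cw w0 ik k0 d le])
  then show "v t = sol t" by (simp add: w_def)
qed

lemma nls_flow_eq: "nls_flow a \<phi> = sol"
  unfolding nls_flow_def
proof (rule the_equality)
  show "nls_solution a \<phi> sol" by (rule nls_solution_sol)
  show "u = sol" if "nls_solution a \<phi> u" for u by (rule nls_solution_unique[OF that])
qed

section \<open>The scattering state and its Born approximation\<close>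

definition nonlin_total :: L2 where
  "nonlin_total = (LINT s|lborel. indicator {0<..} s *\<^sub>R nonlin sol s)"

text \<open>In the interaction picture \<open>sol\<close> converges because
  \<open>prim (nonlin sol)\<close> does. Since the free flow is isometric, two asymptotic states of
  the same solution have distance 0, which settles the \<open>THE\<close>.\<close>

lemma scattering_map_eq: "scattering_map a \<phi> = \<phi> - scaleC_L2 \<i> nonlin_total"
  unfolding scattering_map_def nls_flow_eq
proof (rule the_equality)
  have "norm (sol t - schroedinger t (\<phi> - scaleC_L2 \<i> nonlin_total)) = norm (nonlin_total - prim (nonlin sol) t)" for t
  proof -
    have "sol t = schroedinger t (\<phi> - scaleC_L2 \<i> (prim (nonlin sol) t))"
      using picard_sol[unfolded fun_eq_iff picard_def, rule_format, of t] by simp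
    then show ?thesis by (simp flip: schroedinger_diff scaleC_diff)
  qed
  moreover have "((\<lambda>t. norm (nonlin_total - prim (nonlin sol) t)) \<longlongrightarrow> norm (nonlin_total - nonlin_total)) at_top"
    unfolding nonlin_total_def by (intro tendsto_intros prim_tendsto_at_top nonlin_integrable adm_sol)
  ultimately show lim: "((\<lambda>t. norm (sol t - schroedinger t (\<phi> - scaleC_L2 \<i> nonlin_total))) \<longlongrightarrow> 0) at_top" by simp
  fix y assume y: "((\<lambda>t. norm (sol t - schroedinger t y)) \<longlongrightarrow> 0) at_top"
  let ?x = "\<phi> - scaleC_L2 \<i> nonlin_total"
  have "norm (y - ?x) \<le> norm (sol t - schroedinger t y) + norm (sol t - schroedinger t ?x)" for t
  proof -
    have "norm (y - ?x) = norm (schroedinger t y - schroedinger t ?x)" by (simp flip: schroedinger_diff)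
    also have "\<dots> \<le> norm (sol t - schroedinger t y) + norm (sol t - schroedinger t ?x)"
      by norm
    finally show ?thesis .
  qed
  then have "norm (y - ?x) \<le> 0 + 0"
    by (intro tendsto_lowerbound[OF tendsto_add[OF y lim]]) auto
  then show "y = ?x" by simp
qed

text \<open>Replacing \<open>sol\<close> by the free wave costs
  \<open>4 * \<kappa> * wt \<tau>\<close> in supremum norm, so the error is quadratic in
  \<open>L1_norm a\<close>. Moving \<open>\<i>\<close> across the real inner product turns
  \<open>c\<close> into \<open>- \<i> * c\<close>. The constants are
  \<open>384 = 3 * 4^2 * 4 * 2\<close>, and twice that after integrating
  \<open>wt^4\<close>.\<close>

lemma born_approximation:
  assumes c: "cmod c = 1"
  shows "\<bar>inner (scattering_map a \<phi> - \<phi>) (scaleC_L2 c \<phi>)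
      + (LINT s|lborel. indicator {0<..} s * inner (cubic a (schroedinger s \<phi>)) (scaleC_L2 (- \<i> * c) (schroedinger s \<phi>)))\<bar>
    \<le> 768 * \<kappa> * pi * L1_norm a * \<tau>"
    and "integrable lborel (\<lambda>s. indicator {0<..} s * inner (cubic a (schroedinger s \<phi>)) (scaleC_L2 (- \<i> * c) (schroedinger s \<phi>)))"
proof -
  define e where "e = - \<i> * c"
  have e: "cmod e = 1" using c by (simp add: e_def norm_mult)
  let ?v = "\<lambda>s. schroedinger s \<phi>"
  have swap: "inner (scaleC_L2 \<i> x) (scaleC_L2 c y) = inner x (scaleC_L2 e y)" for x y
  proof -
    have "inner (scaleC_L2 \<i> x) (scaleC_L2 c y) = inner x (L2_mult (\<lambda>_. - \<i>) (L2_mult (\<lambda>_. c) y))"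
      unfolding scaleC_L2_eq by (subst L2_mult_inner[where B = 1]) auto
    also have "L2_mult (\<lambda>_. - \<i>) (L2_mult (\<lambda>_. c) y) = scaleC_L2 e y"
      unfolding scaleC_L2_eq e_def by (rule L2_mult_L2_mult[where B = 1 and B' = 1]) (use c in auto)
    finally show ?thesis .
  qed
  have linf_v: "linf_le (?v s) (2 * wt \<tau> s)" for s by (rule \<phi>)
  have linf_v4: "linf_le (?v s) (4 * wt \<tau> s)" for s
    by (rule linf_le_mono[OF \<phi>]) (use wt_nonneg[of s] in simp)
  have ns: "inner (nonlin sol s) (scaleC_L2 e \<phi>) = inner (cubic a (sol s)) (scaleC_L2 e (?v s))" for s
    unfolding nonlin_def by (simp add: schroedinger_inner schroedinger_scaleC)
  have ii: "integrable lborel (\<lambda>s. indicator {0<..} s *\<^sub>R nonlin sol s)"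
    by (rule integrable_mult_indicator) (use nonlin_integrable[OF adm_sol] in auto)
  have "inner (scattering_map a \<phi> - \<phi>) (scaleC_L2 c \<phi>) = - inner (scaleC_L2 \<i> nonlin_total) (scaleC_L2 c \<phi>)"
    unfolding scattering_map_eq by simp
  also have "\<dots> = - inner nonlin_total (scaleC_L2 e \<phi>)" by (simp only: swap)
  also have "inner nonlin_total (scaleC_L2 e \<phi>) = (LINT s|lborel. inner (indicator {0<..} s *\<^sub>R nonlin sol s) (scaleC_L2 e \<phi>))"
    unfolding nonlin_total_def by (rule integral_inner_left[symmetric]) (rule ii)
  also have "\<dots> = (LINT s|lborel. indicator {0<..} s * inner (cubic a (sol s)) (scaleC_L2 e (?v s)))"
    by (simp add: ns)
  finally have I: "inner (scattering_map a \<phi> - \<phi>) (scaleC_L2 c \<phi>)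
      = - (LINT s|lborel. indicator {0<..} s * inner (cubic a (sol s)) (scaleC_L2 e (?v s)))" .
  have i1: "integrable lborel (\<lambda>s. indicator {0<..} s * inner (cubic a (sol s)) (scaleC_L2 e (?v s)))"
    using integrable_inner_left[OF ii, of "scaleC_L2 e \<phi>"] by (simp add: ns)
  have d: "linf_le (sol s - ?v s) (4 * \<kappa> * wt \<tau> s)" for s
    using picard_minus_linear[OF adm_sol, of s] by (simp add: picard_sol)
  have bound: "\<bar>inner (cubic a (sol s) - cubic a (?v s)) (scaleC_L2 e (?v s))\<bar> \<le> 384 * \<kappa> * L1_norm a * wt \<tau> s ^ 4" for s
  proof -
    let ?f = "\<lambda>x. cubic_fun a (sol s) x - cubic_fun a (?v s) x"
    note eq = cubic_diff_eq[OF a(1,2) adm_linf[OF adm_sol, of s] linf_v4[of s]]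
    have [measurable]: "a \<in> borel_measurable borel" using a(2) by (simp add: lsq_def)
    have m: "?f \<in> borel_measurable lborel" by measurable
    have "AE x in lborel. cmod (?f x) \<le> 3 * (4 * wt \<tau> s)\<^sup>2 * (4 * \<kappa> * wt \<tau> s) * cmod (a x)"
      using cubic_diff_AE[OF adm_linf[OF adm_sol] linf_v4, of a s] d[of s] unfolding linf_le_def
    proof eventually_elim
      case (elim x)
      have "3 * (4 * wt \<tau> s)\<^sup>2 * cmod (a x) * cmod (rep_L2 (sol s - ?v s) x) \<le> 3 * (4 * wt \<tau> s)\<^sup>2 * cmod (a x) * (4 * \<kappa> * wt \<tau> s)"
        by (intro mult_left_mono elim(2)) simp
      then show ?case using elim(1) by (simp add: mult_ac)
    qed
    then have AE: "AE x in lborel. cmod (?f x) \<le> (192 * \<kappa> * wt \<tau> s ^ 3) * cmod (a x)"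
      by (simp add: power2_eq_square power3_eq_cube mult_ac)
    have lf: "lsq ?f" 
      by (intro lsq_diff cubic_fun_integrable(1)[OF a(1,2) adm_linf[OF adm_sol]] cubic_fun_integrable(1)[OF a(1,2) linf_v4])
    \<comment> \<open>The free wave is bounded and the cubic difference is integrable, so they pair
      directly; \<open>e\<close> and \<open>- e\<close> together give the absolute value.\<close>
    have one_sided: "inner (scaleC_L2 e' (?v s)) (to_L2 ?f) \<le> 384 * \<kappa> * L1_norm a * wt \<tau> s ^ 4" if "cmod e' = 1" for e'
    proof -
      have "linf_le (scaleC_L2 e' (?v s)) (2 * wt \<tau> s)" using linf_le_scaleC[OF linf_v[of s], of e'] that by simp
      from inner_le_linf[OF this integrable_bound_AE(1)[OF m a(1) AE] lf]
      have "inner (scaleC_L2 e' (?v s)) (to_L2 ?f) \<le> 2 * wt \<tau> s * L1_norm ?f" .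
      also have "\<dots> \<le> 2 * wt \<tau> s * (192 * \<kappa> * wt \<tau> s ^ 3 * L1_norm a)"
        using wt_nonneg[of s] by (intro mult_left_mono integrable_bound_AE(2)[OF m a(1) AE]) auto
      finally show ?thesis by (simp add: power4_eq_xxxx power3_eq_cube mult_ac)
    qed
    have "scaleC_L2 (- e) y = - scaleC_L2 e y" for y
    proof -
      obtain f where f: "lsq f" "y = to_L2 f" by (meson L2_cases)
      show ?thesis by (simp add: f uminus_L2_eq scaleC_to_L2 lsq_cmult lsq_uminus)
    qed
    then show ?thesis
      using one_sided[of e] one_sided[of "- e"] e unfolding eq by (simp add: inner_commute abs_le_iff)
  qed
  have cont: "continuous_on UNIV (\<lambda>s. inner (cubic a (?v s)) (scaleC_L2 e (?v s)))"
  proof (intro continuous_on_inner)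
    have "linf_le (?v s) 4" for s by (rule linf_le_mono[OF linf_v4]) (use wt_le[of s] in simp)
    then show "continuous_on UNIV (\<lambda>s. cubic a (?v s))" by (intro continuous_cubic[OF a continuous_schroedinger])
    show "continuous_on UNIV (\<lambda>s. scaleC_L2 e (?v s))"
      by (rule bounded_linear.continuous_on[OF bounded_linear_scaleC_L2 continuous_schroedinger])
  qed
  note [measurable] = borel_measurable_continuous_onI[OF cont]
  have i4: "integrable lborel (\<lambda>s. 384 * \<kappa> * L1_norm a * wt \<tau> s ^ 4)" using wt_cube_integral(3)[OF \<tau>] by simp
  have id: "integrable lborel (\<lambda>s. indicator {0<..} s * inner (cubic a (sol s) - cubic a (?v s)) (scaleC_L2 e (?v s)))"
  proof (rule Bochner_Integration.integrable_bound[OF i4])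
    have "(\<lambda>s. indicator {0<..} s * inner (cubic a (sol s)) (scaleC_L2 e (?v s))
        - indicator {0<..} s * inner (cubic a (?v s)) (scaleC_L2 e (?v s))) \<in> borel_measurable lborel"
      using borel_measurable_integrable[OF i1] by measurable
    then show "(\<lambda>s. indicator {0<..} s * inner (cubic a (sol s) - cubic a (?v s)) (scaleC_L2 e (?v s))) \<in> borel_measurable lborel"
      by (simp add: inner_diff_left right_diff_distrib)
    show "AE s in lborel. norm (indicator {0<..} s * inner (cubic a (sol s) - cubic a (?v s)) (scaleC_L2 e (?v s)))
        \<le> norm (384 * \<kappa> * L1_norm a * wt \<tau> s ^ 4)"
      using bound by (intro AE_I2) (auto simp: indicator_def intro: order_trans[OF _ abs_ge_self])
  qed
  have eq2: "indicator {0<..} s * inner (cubic a (?v s)) (scaleC_L2 e (?v s))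
      = indicator {0<..} s * inner (cubic a (sol s)) (scaleC_L2 e (?v s))
        - indicator {0<..} s * inner (cubic a (sol s) - cubic a (?v s)) (scaleC_L2 e (?v s))" for s :: real
    by (simp add: inner_diff_left right_diff_distrib)
  show "integrable lborel (\<lambda>s. indicator {0<..} s * inner (cubic a (?v s)) (scaleC_L2 (- \<i> * c) (?v s)))"
    unfolding e_def[symmetric] eq2 by (rule Bochner_Integration.integrable_diff[OF i1 id])
  have "inner (scattering_map a \<phi> - \<phi>) (scaleC_L2 c \<phi>)
      + (LINT s|lborel. indicator {0<..} s * inner (cubic a (?v s)) (scaleC_L2 e (?v s)))
      = - (LINT s|lborel. indicator {0<..} s * inner (cubic a (sol s) - cubic a (?v s)) (scaleC_L2 e (?v s)))"
    unfolding I eq2 Bochner_Integration.integral_diff[OF i1 id] by simp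
  also have "\<bar>\<dots>\<bar> \<le> (LINT s|lborel. 384 * \<kappa> * L1_norm a * wt \<tau> s ^ 4)"
  proof -
    have "\<bar>LINT s|lborel. indicator {0<..} s * inner (cubic a (sol s) - cubic a (?v s)) (scaleC_L2 e (?v s))\<bar>
        \<le> (LINT s|lborel. \<bar>indicator {0<..} s * inner (cubic a (sol s) - cubic a (?v s)) (scaleC_L2 e (?v s))\<bar>)"
      by (rule integral_abs_bound)
    also have "\<dots> \<le> (LINT s|lborel. 384 * \<kappa> * L1_norm a * wt \<tau> s ^ 4)"
      by (rule integral_mono[OF integrable_abs[OF id] i4])
         (use bound \<kappa>_nonneg in \<open>auto simp: indicator_def abs_mult\<close>)
    finally show ?thesis by simp
  qed
  also have "\<dots> = 384 * \<kappa> * L1_norm a * (LINT s|lborel. wt \<tau> s ^ 4)" by (rule integral_mult_right_zero)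
  also have "\<dots> \<le> 384 * \<kappa> * L1_norm a * (2 * pi * \<tau>)"
    using \<kappa>_nonneg \<tau> by (intro mult_left_mono wt_cube_integral(4)[OF \<tau>] mult_nonneg_nonneg) auto
  also have "\<dots> = 768 * \<kappa> * pi * L1_norm a * \<tau>" by simp
  finally show "\<bar>inner (scattering_map a \<phi> - \<phi>) (scaleC_L2 c \<phi>)
      + (LINT s|lborel. indicator {0<..} s * inner (cubic a (?v s)) (scaleC_L2 (- \<i> * c) (?v s)))\<bar>
    \<le> 768 * \<kappa> * pi * L1_norm a * \<tau>" unfolding e_def .
qed

end

section \<open>Hoelder continuity of Sobolev functions\<close>

lemma integral_inverse_one_plus_square:
  "integrable lborel (\<lambda>x::real. inverse (1 + x\<^sup>2))" "(LINT x|lborel. inverse (1 + x\<^sup>2)) = pi"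
proof -
  have E: "einterval (- \<infinity>) \<infinity> = UNIV" by (auto simp: einterval_def)
  show "integrable lborel (\<lambda>x::real. inverse (1 + x\<^sup>2))"
    using integrable_inverse_1_plus_square unfolding E set_integrable_def by simp
  show "(LINT x|lborel. inverse (1 + x\<^sup>2)) = pi"
    using LBINT_inverse_1_plus_square by (simp add: interval_lebesgue_integral_def E set_lebesgue_integral_def)
qed

lemma integral_dilated_inverse_square:
  assumes "h \<noteq> 0"
  shows "integrable lborel (\<lambda>x::real. inverse (1 + (h * x)\<^sup>2))" "(LINT x|lborel. inverse (1 + (h * x)\<^sup>2)) = pi / \<bar>h\<bar>"
  using lborel_integrable_real_affine[OF integral_inverse_one_plus_square(1) assms, of 0]
    lborel_integral_real_affine[OF assms, of "\<lambda>x. inverse (1 + x\<^sup>2)" 0] integral_inverse_one_plus_square(2) assms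
  by (simp_all add: field_simps)

text \<open>Merges the bounds \<open>\<theta>^2\<close> and \<open>4\<close> for
  \<open>|iexp \<theta> - 1|^2\<close> into one rational function, with \<open>5 = 1 + 4\<close>,
  whose integral is explicit by the arctangent.\<close>

lemma norm_exp_diff_le:
  "(cmod (iexp (x * \<xi>) - iexp (y * \<xi>)))\<^sup>2
     \<le> 5 * ((x - y) * \<xi>)\<^sup>2 / (1 + ((x - y) * \<xi>)\<^sup>2)"
proof -
  define \<theta> where "\<theta> = (x - y) * \<xi>"
  have "iexp (x * \<xi>) = iexp (y * \<xi>) * iexp \<theta>"
    unfolding mult_exp_exp by (rule arg_cong[where f = exp]) (simp add: \<theta>_def algebra_simps)
  then have "iexp (x * \<xi>) - iexp (y * \<xi>)
      = iexp (y * \<xi>) * (iexp \<theta> - 1)" by (simp only: right_diff_distrib mult_1_right)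
  then have eq: "cmod (iexp (x * \<xi>) - iexp (y * \<xi>)) = cmod (iexp \<theta> - 1)"
    by (simp only: norm_mult norm_exp_i)
  have 1: "cmod (iexp \<theta> - 1) \<le> \<bar>\<theta>\<bar>" using iexp_approx1[of \<theta> 0] by simp
  have 2: "cmod (iexp \<theta> - 1) \<le> 2" using norm_triangle_ineq4[of "iexp \<theta>" 1] by simp
  have 3: "(cmod (iexp \<theta> - 1))\<^sup>2 \<le> \<theta>\<^sup>2" using power_mono[OF 1, of 2] by simp
  have 4: "(cmod (iexp \<theta> - 1))\<^sup>2 \<le> 4" using power_mono[OF 2, of 2] by simp
  have "(cmod (iexp \<theta> - 1))\<^sup>2 * (1 + \<theta>\<^sup>2) \<le> \<theta>\<^sup>2 + 4 * \<theta>\<^sup>2"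
    unfolding distrib_left mult_1_right by (intro add_mono 3 mult_right_mono 4) simp
  moreover have "1 + \<theta>\<^sup>2 > 0" by (simp add: add_pos_nonneg)
  ultimately have "(cmod (iexp \<theta> - 1))\<^sup>2 \<le> 5 * \<theta>\<^sup>2 / (1 + \<theta>\<^sup>2)" by (simp add: pos_le_divide_eq)
  then show ?thesis unfolding eq \<theta>_def .
qed

text \<open>Fourier inversion with Cauchy-Schwarz: splitting the weight as
  \<open>|k| |A| = (|k| / sqrt (1 + \<xi>^2)) |W|\<close> bounds the integral of
  \<open>|k| |A|\<close> by the H1 norm. The choice \<open>k = 1\<close> makes \<open>A\<close>
  integrable and provides the representative; a difference of two exponentials gives the exponent
  one half.\<close>

lemma H1_holder_representative:
  assumes a: "a \<in> L1_H1"
  obtains a' where "AE x in lborel. a x = a' x" "a' \<in> borel_measurable borel"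
    "\<And>x. cmod (a' x) \<le> 2 * H1_norm a" "\<And>x y. cmod (a' x - a' y) \<le> 4 * H1_norm a * sqrt \<bar>x - y\<bar>"
proof -
  have la: "lsq a" and lW: "lsq (H1_weighted a)" using a by (auto simp: L1_H1_def in_H1_def)
  define A where "A = rep_L2 (fourier_L2 (to_L2 a))"
  define W where "W = H1_weighted a"
  have lA: "lsq A" by (simp add: A_def)
  have Am [measurable]: "A \<in> borel_measurable borel" by (simp add: A_def)
  have W: "W \<xi> = complex_of_real (sqrt (1 + \<xi>\<^sup>2)) * A \<xi>" for \<xi> by (simp add: W_def A_def H1_weighted_def)
  have pos: "1 + \<xi>\<^sup>2 > 0" for \<xi> :: real by (simp add: add_pos_nonneg)
  have nW: "norm (to_L2 W) = H1_norm a" by (simp add: W_def H1_norm_def)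
  have kernel: "integrable lborel (\<lambda>\<xi>. cmod (k \<xi>) * cmod (A \<xi>))"
      "(LINT \<xi>|lborel. cmod (k \<xi>) * cmod (A \<xi>)) \<le> B * H1_norm a"
    if k [measurable]: "k \<in> borel_measurable borel"
      and q: "integrable lborel q" "integral\<^sup>L lborel q \<le> B\<^sup>2" "0 \<le> B" "\<And>\<xi>. (cmod (k \<xi>))\<^sup>2 / (1 + \<xi>\<^sup>2) \<le> q \<xi>" for k q B
  proof -
    define p where "p \<xi> = k \<xi> / complex_of_real (sqrt (1 + \<xi>\<^sup>2))" for \<xi>
    have [measurable]: "p \<in> borel_measurable borel" unfolding p_def by measurable
    have p2: "(cmod (p \<xi>))\<^sup>2 = (cmod (k \<xi>))\<^sup>2 / (1 + \<xi>\<^sup>2)" for \<xi>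
      using pos[of \<xi>] by (simp add: p_def norm_divide power_divide)
    have ip: "integrable lborel (\<lambda>\<xi>. (cmod (p \<xi>))\<^sup>2)"
      by (rule Bochner_Integration.integrable_bound[OF q(1)])
         (use q(4) in \<open>auto simp: p2 intro: order_trans[OF _ abs_ge_self]\<close>)
    have lp: "lsq p" using ip by (simp add: lsq_def)
    have "(norm (to_L2 p))\<^sup>2 \<le> B\<^sup>2"
      unfolding norm_to_L2_sq[OF lp] by (rule order_trans[OF integral_mono[OF ip q(1)] q(2)]) (simp add: p2 q(4))
    then have np: "norm (to_L2 p) \<le> B" by (rule power2_le_imp_le[OF _ q(3)])
    have eq: "cmod (k \<xi>) * cmod (A \<xi>) = cmod (p \<xi>) * cmod (W \<xi>)" for \<xi>
    proof -
      have "sqrt (1 + \<xi>\<^sup>2) > 0" using pos[of \<xi>] by simp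
      then show ?thesis by (simp add: p_def W norm_mult norm_divide)
    qed
    show "integrable lborel (\<lambda>\<xi>. cmod (k \<xi>) * cmod (A \<xi>))"
      unfolding eq by (rule lsq_norm_mult_integrable[OF lp lW[folded W_def]])
    have "(LINT \<xi>|lborel. cmod (k \<xi>) * cmod (A \<xi>)) \<le> norm (to_L2 p) * norm (to_L2 W)"
      unfolding eq by (rule lsq_norm_mult_le[OF lp lW[folded W_def]])
    also have "\<dots> \<le> B * H1_norm a" unfolding nW by (rule mult_right_mono[OF np]) (simp add: H1_norm_def)
    finally show "(LINT \<xi>|lborel. cmod (k \<xi>) * cmod (A \<xi>)) \<le> B * H1_norm a" .
  qed
  have q1: "integral\<^sup>L lborel (\<lambda>\<xi>::real. inverse (1 + \<xi>\<^sup>2)) \<le> 2\<^sup>2"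
    unfolding integral_inverse_one_plus_square(2) using pi_less_4 by simp
  note k1 = kernel[of "\<lambda>_. 1", OF _ integral_inverse_one_plus_square(1) q1, simplified]
  have iA: "integrable lborel A"
    using k1(1) by (simp add: inverse_eq_divide integrable_norm_iff)
  have LA: "L1_norm A \<le> 2 * H1_norm a" using k1(2) by (simp add: L1_norm_def inverse_eq_divide)
  define a' where "a' x = ft A (- x)" for x
  have "to_L2 a = fourier_inv (to_L2 A)" by (simp add: A_def)
  also have "\<dots> = to_L2 a'" unfolding a'_def by (rule fourier_inv_to_L2[OF iA lA])
  finally have eq: "to_L2 a = to_L2 a'" .
  have la': "lsq a'"
    using lsq_affine[of "-1" "ft A" 0] plancherel_L1_L2(1)[OF iA lA] by (simp add: a'_def[abs_def])
  show ?thesis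
  proof (rule that)
    show "AE x in lborel. a x = a' x" using eq to_L2_eq_iff[OF la la'] by simp
    show "a' \<in> borel_measurable borel" using la' by (simp add: lsq_def)
    show "cmod (a' x) \<le> 2 * H1_norm a" for x
      unfolding a'_def using ft_bound[OF iA] LA order_trans by blast
    show "cmod (a' x - a' y) \<le> 4 * H1_norm a * sqrt \<bar>x - y\<bar>" for x y
    proof (cases "x = y")
      case False
      define h where "h = x - y"
      have h: "h \<noteq> 0" using False by (simp add: h_def)
      let ?k = "\<lambda>\<xi>. iexp (x * \<xi>) - iexp (y * \<xi>)"
      \<comment> \<open>Obtained from \<open>norm_exp_diff_le\<close> by discarding
        \<open>\<xi>^2 / (1 + \<xi>^2) \<le> 1\<close>. Its integral is
        \<open>5 * pi * |h| \<le> 16 * |h|\<close>, which fixes the Hoelder constant 4.\<close>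
      let ?q = "\<lambda>\<xi>. 5 * h\<^sup>2 * inverse (1 + (h * \<xi>)\<^sup>2)"
      have iq: "integrable lborel ?q" using integral_dilated_inverse_square(1)[OF h] by simp
      have "integral\<^sup>L lborel ?q = 5 * h\<^sup>2 * (pi / \<bar>h\<bar>)"
        by (simp only: integral_mult_right_zero integral_dilated_inverse_square(2)[OF h])
      also have "\<dots> = 5 * pi * \<bar>h\<bar>" using h by (auto simp: power2_eq_square abs_if)
      also have "\<dots> \<le> 16 * \<bar>h\<bar>" using pi_approx by (intro mult_right_mono) auto
      also have "\<dots> = (4 * sqrt \<bar>h\<bar>)\<^sup>2" by (simp add: power_mult_distrib)
      finally have vq: "integral\<^sup>L lborel ?q \<le> (4 * sqrt \<bar>h\<bar>)\<^sup>2" .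
      have kq: "(cmod (?k \<xi>))\<^sup>2 / (1 + \<xi>\<^sup>2) \<le> ?q \<xi>" for \<xi>
      proof -
        have "(cmod (?k \<xi>))\<^sup>2 / (1 + \<xi>\<^sup>2) \<le> (5 * (h * \<xi>)\<^sup>2 / (1 + (h * \<xi>)\<^sup>2)) / (1 + \<xi>\<^sup>2)"
          using norm_exp_diff_le[of x \<xi> y] pos[of \<xi>] unfolding h_def by (intro divide_right_mono) auto
        also have "\<dots> = ?q \<xi> * (\<xi>\<^sup>2 / (1 + \<xi>\<^sup>2))" by (simp add: power_mult_distrib divide_inverse)
        also have "\<dots> \<le> ?q \<xi> * 1"
          using pos[of \<xi>] pos[of "h * \<xi>"] by (intro mult_left_mono) auto
        finally show ?thesis by simp
      qed
      have km: "?k \<in> borel_measurable borel" by measurable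
      have "a' x - a' y = complex_of_real (1 / sqrt (2 * pi)) * (LINT \<xi>|lborel. ?k \<xi> * A \<xi>)"
      proof -
        have e: "exp (- \<i> * complex_of_real (\<xi> * - x)) = iexp (x * \<xi>)" for \<xi> x
          by (rule arg_cong[where f = exp]) simp
        have i: "integrable lborel (\<lambda>\<xi>. iexp (x * \<xi>) * A \<xi>)" for x
          using integrable_ft[OF iA, of "- x"] unfolding e .
        show ?thesis
          unfolding a'_def ft_def e left_diff_distrib Bochner_Integration.integral_diff[OF i i] right_diff_distrib ..
      qed
      then have "cmod (a' x - a' y) \<le> 1 * cmod (LINT \<xi>|lborel. ?k \<xi> * A \<xi>)"
        unfolding norm_mult
      proof (simp only: norm_mult, intro mult_right_mono)
        have "1 \<le> sqrt (2 * pi)" using pi_gt3 by simp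
        then show "cmod (complex_of_real (1 / sqrt (2 * pi))) \<le> 1" by (simp add: norm_divide)
      qed simp
      also have "\<dots> \<le> (LINT \<xi>|lborel. cmod (?k \<xi> * A \<xi>))" using integral_norm_bound[of lborel "\<lambda>\<xi>. ?k \<xi> * A \<xi>"] by simp
      also have "\<dots> = (LINT \<xi>|lborel. cmod (?k \<xi>) * cmod (A \<xi>))" by (simp only: norm_mult)
      also have "\<dots> \<le> 4 * sqrt \<bar>h\<bar> * H1_norm a"
        by (rule kernel(2)[OF km iq vq _ kq]) simp
      finally show ?thesis by (simp add: h_def mult_ac)
    qed simp
  qed
qed

section \<open>Averages against evolving Gaussian packets\<close>

lemma integral_FTC_Ioo_nonneg:
  fixes f F :: "real \<Rightarrow> real"
  assumes "a < b" "\<And>x. a < x \<Longrightarrow> x < b \<Longrightarrow> (F has_real_derivative f x) (at x)"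
    "\<And>x. a < x \<Longrightarrow> x < b \<Longrightarrow> isCont f x" "\<And>x. a < x \<Longrightarrow> x < b \<Longrightarrow> 0 \<le> f x"
    "(F \<longlongrightarrow> A) (at_right a)" "(F \<longlongrightarrow> B) (at_left b)"
  shows "integrable lborel (\<lambda>x. indicator {a<..<b} x * f x)" "(LINT x|lborel. indicator {a<..<b} x * f x) = B - A"
proof -
  have ab: "ereal a < ereal b" using assms(1) by simp
  have D: "(F has_real_derivative f x) (at x)" and C: "isCont f x" if "ereal a < ereal x" "ereal x < ereal b" for x
    using that assms(2,3) by auto
  have N: "AE x in lborel. ereal a < ereal x \<longrightarrow> ereal x < ereal b \<longrightarrow> 0 \<le> f x" using assms(4) by auto
  have l: "((F \<circ> real_of_ereal) \<longlongrightarrow> A) (at_right (ereal a))" "((F \<circ> real_of_ereal) \<longlongrightarrow> B) (at_left (ereal b))"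
    using assms(5,6) unfolding ereal_tendsto_simps .
  have E: "einterval (ereal a) (ereal b) = {a<..<b}" by (auto simp: einterval_def)
  have "set_integrable lborel (einterval (ereal a) (ereal b)) f"
    by (rule interval_integral_FTC_nonneg(1)[OF ab D C N l])
  then show "integrable lborel (\<lambda>x. indicator {a<..<b} x * f x)"
    unfolding E set_integrable_def real_scaleR_def .
  have "(LINT x|lborel. indicator {a<..<b} x * f x) = (LBINT x=ereal a..ereal b. f x)"
    unfolding interval_lebesgue_integral_def E set_lebesgue_integral_def real_scaleR_def if_P[OF less_imp_le[OF ab]] ..
  also have "\<dots> = B - A"
    by (rule interval_integral_FTC_nonneg(2)[OF ab D C N l])
  finally show "(LINT x|lborel. indicator {a<..<b} x * f x) = B - A" .
qed

section \<open>Time integrals for the near, logarithmic and far ranges\<close>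

lemma integral_inverse_sqrt:
  fixes b :: real
  assumes "0 < b"
  shows "integrable lborel (\<lambda>s. indicator {0<..<b} s * (1 / sqrt s))"
    "(LINT s|lborel. indicator {0<..<b} s * (1 / sqrt s)) = 2 * sqrt b"
proof -
  have D: "((\<lambda>s. 2 * sqrt s) has_real_derivative 1 / sqrt s) (at s)" if "0 < s" for s
  proof -
    have "((\<lambda>s. 2 * sqrt s) has_real_derivative 2 * (inverse (sqrt s) / 2)) (at s)"
      by (rule DERIV_cmult[OF DERIV_real_sqrt[OF that]])
    moreover have "2 * (inverse (sqrt s) / 2) = 1 / sqrt s" by (simp add: inverse_eq_divide)
    ultimately show ?thesis by (simp only:)
  qed
  have l: "((\<lambda>s. 2 * sqrt s) \<longlongrightarrow> 2 * sqrt c) (at c within S)" for c :: real and S by (intro tendsto_intros)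
  have l0: "((\<lambda>s. 2 * sqrt s) \<longlongrightarrow> 0) (at_right 0)" using l[of 0 "{0<..}"] by simp
  show "integrable lborel (\<lambda>s. indicator {0<..<b} s * (1 / sqrt s))"
    by (rule integral_FTC_Ioo_nonneg(1)[where F = "\<lambda>s. 2 * sqrt s" and f = "\<lambda>s. 1 / sqrt s", OF assms D _ _ l0 l])
       (auto intro!: continuous_intros)
  have "(LINT s|lborel. indicator {0<..<b} s * (1 / sqrt s)) = 2 * sqrt b - 0"
    by (rule integral_FTC_Ioo_nonneg(2)[where F = "\<lambda>s. 2 * sqrt s" and f = "\<lambda>s. 1 / sqrt s", OF assms D _ _ l0 l])
       (auto intro!: continuous_intros)
  then show "(LINT s|lborel. indicator {0<..<b} s * (1 / sqrt s)) = 2 * sqrt b" by simp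
qed

lemma integral_inverse:
  fixes a b :: real
  assumes "0 < a" "a < b"
  shows "integrable lborel (\<lambda>s. indicator {a<..<b} s * (1 / s))"
    "(LINT s|lborel. indicator {a<..<b} s * (1 / s)) = ln b - ln a"
proof -
  have D: "(ln has_real_derivative 1 / s) (at s)" if "a < s" for s :: real
    using that assms by (intro DERIV_ln_divide) auto
  have l: "(ln \<longlongrightarrow> ln c) (at c within S)" if "a \<le> c" for c :: real and S using that assms by (intro tendsto_intros) auto
  show "integrable lborel (\<lambda>s. indicator {a<..<b} s * (1 / s))"
    by (rule integral_FTC_Ioo_nonneg(1)[where F = ln and f = "\<lambda>s. 1 / s", OF assms(2) D _ _ l l])
       (use assms in \<open>auto intro!: continuous_intros\<close>)
  show "(LINT s|lborel. indicator {a<..<b} s * (1 / s)) = ln b - ln a"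
    by (rule integral_FTC_Ioo_nonneg(2)[where F = ln and f = "\<lambda>s. 1 / s", OF assms(2) D _ _ l l])
       (use assms in \<open>auto intro!: continuous_intros\<close>)
qed

lemma integral_inverse_square_tail:
  fixes a :: real
  assumes a: "0 < a"
  shows "integrable lborel (\<lambda>s. indicator {a<..} s * (1 / s\<^sup>2))"
    "(LINT s|lborel. indicator {a<..} s * (1 / s\<^sup>2)) = 1 / a"
proof -
  have E: "einterval (ereal a) \<infinity> = {a<..}" by (auto simp: einterval_def)
  have D: "((\<lambda>s. - 1 / s) has_real_derivative 1 / s\<^sup>2) (at s)" if "a < s" for s
    using that a by (auto intro!: derivative_eq_intros simp: power2_eq_square)
  have l: "((\<lambda>s. - 1 / s) \<longlongrightarrow> - 1 / a) (at_right a)" using a by (intro tendsto_intros) auto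
  have l': "((\<lambda>s::real. - 1 / s) \<longlongrightarrow> 0) at_top" by real_asymp
  have D': "((\<lambda>s. - 1 / s) has_real_derivative 1 / s\<^sup>2) (at s)" and C: "isCont (\<lambda>s. 1 / s\<^sup>2) s"
    if "ereal a < ereal s" "ereal s < \<infinity>" for s
    using that a D by (auto intro!: continuous_intros)
  have N: "AE s in lborel. ereal a < ereal s \<longrightarrow> ereal s < \<infinity> \<longrightarrow> 0 \<le> 1 / s\<^sup>2" by simp
  have L: "(((\<lambda>s. - 1 / s) \<circ> real_of_ereal) \<longlongrightarrow> - 1 / a) (at_right (ereal a))"
    "(((\<lambda>s. - 1 / s) \<circ> real_of_ereal) \<longlongrightarrow> 0) (at_left \<infinity>)"
    using l l' unfolding ereal_tendsto_simps .
  have inf: "ereal a < \<infinity>" by simp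
  have "set_integrable lborel (einterval (ereal a) \<infinity>) (\<lambda>s. 1 / s\<^sup>2)"
    by (rule interval_integral_FTC_nonneg(1)[OF inf D' C N L])
  then show "integrable lborel (\<lambda>s. indicator {a<..} s * (1 / s\<^sup>2))"
    unfolding E set_integrable_def real_scaleR_def .
  have "(LINT s|lborel. indicator {a<..} s * (1 / s\<^sup>2)) = (LBINT s=ereal a..\<infinity>. 1 / s\<^sup>2)"
    unfolding interval_lebesgue_integral_def E set_lebesgue_integral_def real_scaleR_def if_P[OF less_imp_le[OF inf]] ..
  also have "\<dots> = 0 - (- 1 / a)"
    by (rule interval_integral_FTC_nonneg(2)[OF inf D' C N L])
  finally show "(LINT s|lborel. indicator {a<..} s * (1 / s\<^sup>2)) = 1 / a" by simp
qed

text \<open>At \<open>z = \<tau> / 2\<close> the squared modulus of the packet has peak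
  \<open>1 / \<tau>\<close>; the factor \<open>sqrt \<tau>\<close> normalizes the amplitude to
  one.\<close>

definition gpacket :: "real \<Rightarrow> real \<Rightarrow> L2" where
  "gpacket \<tau> x0 = scaleC_L2 (complex_of_real (sqrt \<tau>)) (packet (complex_of_real (\<tau> / 2)) x0)"

definition gpacket_fun :: "real \<Rightarrow> real \<Rightarrow> real \<Rightarrow> real \<Rightarrow> complex" where
  "gpacket_fun \<tau> x0 s x = complex_of_real (sqrt \<tau>) * packet_fun (complex_of_real (\<tau> / 2) + \<i> * complex_of_real s) x0 x"

text \<open>The fourth power of the modulus of the evolved packet is \<open>mass \<tau> s\<close>
  times a normal density with standard deviation \<open>width \<tau> s\<close>. The width starts at
  \<open>sqrt \<tau> / 2\<close> and grows like \<open>s / sqrt \<tau>\<close>.\<close>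

definition width :: "real \<Rightarrow> real \<Rightarrow> real" where
  "width \<tau> s = sqrt ((\<tau>\<^sup>2 / 4 + s\<^sup>2) / \<tau>)"

definition mass :: "real \<Rightarrow> real \<Rightarrow> real" where
  "mass \<tau> s = \<tau> * sqrt (2 * pi) / (4 * width \<tau> s)"

context
  fixes \<tau> :: real
  assumes \<tau>: "\<tau> > 0"
begin

lemma width_pos: "0 < width \<tau> s"
  using \<tau> by (simp add: width_def add_pos_nonneg)

lemma width_sq: "(width \<tau> s)\<^sup>2 = (\<tau>\<^sup>2 / 4 + s\<^sup>2) / \<tau>"
  using \<tau> by (simp add: width_def)

lemma mass_pos: "0 < mass \<tau> s"
  using \<tau> width_pos[of s] by (simp add: mass_def)

lemma width_ge: "0 < s \<Longrightarrow> s / sqrt \<tau> \<le> width \<tau> s" and width_ge': "sqrt \<tau> / 2 \<le> width \<tau> s"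
proof -
  show "s / sqrt \<tau> \<le> width \<tau> s" if "0 < s"
    by (rule power2_le_imp_le) (use that \<tau> width_pos[of s] in \<open>auto simp: width_sq power_divide intro!: divide_right_mono\<close>)
  have "(\<tau>\<^sup>2 / 4 + s\<^sup>2) / \<tau> = \<tau> / 4 + s\<^sup>2 / \<tau>"
    unfolding add_divide_distrib using \<tau> by (simp add: power2_eq_square[of \<tau>])
  moreover have "0 \<le> s\<^sup>2 / \<tau>" using \<tau> by simp
  ultimately have le: "\<tau> / 4 \<le> (\<tau>\<^sup>2 / 4 + s\<^sup>2) / \<tau>" by linarith
  show "sqrt \<tau> / 2 \<le> width \<tau> s"
  proof (rule power2_le_imp_le)
    have "(sqrt \<tau> / 2)\<^sup>2 = \<tau> / 4" using \<tau> by (simp add: power_divide)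
    then show "(sqrt \<tau> / 2)\<^sup>2 \<le> (width \<tau> s)\<^sup>2" unfolding width_sq using le by (simp only:)
  qed (rule less_imp_le[OF width_pos])
qed

lemma width_le:
  assumes "\<tau> \<le> s" shows "width \<tau> s \<le> 2 * s / sqrt \<tau>"
proof (rule power2_le_imp_le)
  have "\<tau>\<^sup>2 \<le> s\<^sup>2" using assms \<tau> by (intro power_mono) auto
  then have "\<tau>\<^sup>2 / 4 + s\<^sup>2 \<le> 4 * s\<^sup>2" using zero_le_power2[of s] by linarith
  then have "(\<tau>\<^sup>2 / 4 + s\<^sup>2) / \<tau> \<le> 4 * s\<^sup>2 / \<tau>" using \<tau> by (intro divide_right_mono) auto
  then show "(width \<tau> s)\<^sup>2 \<le> (2 * s / sqrt \<tau>)\<^sup>2" using \<tau> by (simp add: width_sq power_divide power_mult_distrib)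
qed (use assms \<tau> in auto)

lemma schroedinger_gpacket:
  shows "schroedinger s (gpacket \<tau> x0) = to_L2 (gpacket_fun \<tau> x0 s)" "lsq (gpacket_fun \<tau> x0 s)"
proof -
  have z: "Re (complex_of_real (\<tau> / 2)) > 0" "Re (complex_of_real (\<tau> / 2) + \<i> * complex_of_real s) > 0" using \<tau> by auto
  show "schroedinger s (gpacket \<tau> x0) = to_L2 (gpacket_fun \<tau> x0 s)"
    unfolding gpacket_def schroedinger_scaleC schroedinger_packet[OF z(1)] packet_eq(1)[OF z(2)]
      scaleC_to_L2[OF packet_eq(2)[OF z(2)]] gpacket_fun_def[abs_def] ..
  show "lsq (gpacket_fun \<tau> x0 s)"
    unfolding gpacket_fun_def[abs_def] by (rule lsq_cmult[OF packet_eq(2)[OF z(2)]])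
qed

lemma cmod_gpacket_fun:
  "(cmod (gpacket_fun \<tau> x0 s x))\<^sup>2 = sqrt \<tau> / (2 * width \<tau> s) * exp (- (x - x0)\<^sup>2 / (4 * (width \<tau> s)\<^sup>2))"
proof -
  define z where "z = complex_of_real (\<tau> / 2) + \<i> * complex_of_real s"
  have z: "Re z > 0" using \<tau> by (simp add: z_def)
  have cz: "cmod z = width \<tau> s * sqrt \<tau>"
  proof -
    have "cmod z = sqrt (\<tau>\<^sup>2 / 4 + s\<^sup>2)" by (simp add: z_def cmod_def power_divide)
    also have "\<dots> = sqrt ((\<tau>\<^sup>2 / 4 + s\<^sup>2) / \<tau> * \<tau>)" using \<tau> by simp
    also have "\<dots> = width \<tau> s * sqrt \<tau>" unfolding width_def by (rule real_sqrt_mult)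
    finally show ?thesis .
  qed
  have "(cmod (gpacket_fun \<tau> x0 s x))\<^sup>2 = \<tau> * (cmod (packet_fun z x0 x))\<^sup>2"
    using \<tau> by (simp add: gpacket_fun_def z_def norm_mult power_mult_distrib)
  also have "\<dots> = \<tau> * (1 / (2 * (width \<tau> s * sqrt \<tau>)) * exp (- ((\<tau> / 2) / (2 * (width \<tau> s * sqrt \<tau>)\<^sup>2)) * (x - x0)\<^sup>2))"
    unfolding packet_cmod[OF z] cz by (simp add: z_def)
  also have "- ((\<tau> / 2) / (2 * (width \<tau> s * sqrt \<tau>)\<^sup>2)) * (x - x0)\<^sup>2 = - (x - x0)\<^sup>2 / (4 * (width \<tau> s)\<^sup>2)"
    using \<tau> by (simp add: power_mult_distrib)
  also have "\<tau> * (1 / (2 * (width \<tau> s * sqrt \<tau>)) * E) = sqrt \<tau> / (2 * width \<tau> s) * E" for E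
  proof -
    have gen: "t * (1 / (2 * (w * r)) * E) = (t / r) / (2 * w) * E" for t w r :: real by simp
    have "\<tau> / sqrt \<tau> = sqrt \<tau>" using \<tau> by (simp add: real_div_sqrt)
    then show ?thesis unfolding gen by (simp only:)
  qed
  finally show ?thesis .
qed

lemma cmod_gpacket_fun_power4:
  "((cmod (gpacket_fun \<tau> x0 s x))\<^sup>2)\<^sup>2 = mass \<tau> s * normal_density x0 (width \<tau> s) x"
proof -
  have "((cmod (gpacket_fun \<tau> x0 s x))\<^sup>2)\<^sup>2 = (sqrt \<tau> / (2 * width \<tau> s))\<^sup>2 * exp (2 * (- (x - x0)\<^sup>2 / (4 * (width \<tau> s)\<^sup>2)))"
    unfolding cmod_gpacket_fun power_mult_distrib exp_double ..
  also have "2 * (- (x - x0)\<^sup>2 / (4 * (width \<tau> s)\<^sup>2)) = - (x - x0)\<^sup>2 / (2 * (width \<tau> s)\<^sup>2)" by simp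
  also have "(sqrt \<tau> / (2 * width \<tau> s))\<^sup>2 = mass \<tau> s * (1 / sqrt (2 * pi * (width \<tau> s)\<^sup>2))"
    using \<tau> width_pos[of s] by (simp add: mass_def real_sqrt_mult power_divide power_mult_distrib power2_eq_square)
  finally show ?thesis by (simp add: normal_density_def)
qed

text \<open>Supplies the decay hypothesis on \<open>\<phi>\<close> in \<open>small_data\<close>. The
  two lower bounds \<open>width_ge\<close> and \<open>width_ge'\<close> combine to
  \<open>\<tau> + |s| \<le> 4 * width \<tau> s * sqrt \<tau>\<close>.\<close>

lemma gpacket_linf: "linf_le (schroedinger s (gpacket \<tau> x0)) (2 * wt \<tau> s)"
  unfolding schroedinger_gpacket(1) linf_le_to_L2[OF schroedinger_gpacket(2)]
proof (rule AE_I2)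
  fix x
  have "(\<tau> + \<bar>s\<bar>) * sqrt \<tau> \<le> 4 * \<tau> * width \<tau> s"
  proof -
    have "\<bar>s\<bar> \<le> width \<tau> s * sqrt \<tau>"
      using width_ge[of "\<bar>s\<bar>"] \<tau> width_pos[of s] by (cases "s = 0") (auto simp: field_simps width_def)
    moreover have "\<tau> \<le> 2 * (width \<tau> s * sqrt \<tau>)"
    proof -
      have "sqrt \<tau> / 2 * sqrt \<tau> \<le> width \<tau> s * sqrt \<tau>" using width_ge'[of s] \<tau> by (intro mult_right_mono) auto
      then show ?thesis using \<tau> by simp
    qed
    ultimately have "\<tau> + \<bar>s\<bar> \<le> 4 * (width \<tau> s * sqrt \<tau>)" using width_pos[of s] \<tau> by simp
    then have "(\<tau> + \<bar>s\<bar>) * sqrt \<tau> \<le> 4 * (width \<tau> s * sqrt \<tau>) * sqrt \<tau>" using \<tau> by (intro mult_right_mono) auto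
    also have "\<dots> = 4 * (sqrt \<tau> * sqrt \<tau>) * width \<tau> s" by (simp only: mult_ac)
    finally show ?thesis using \<tau> by simp
  qed
  then have le: "sqrt \<tau> / (2 * width \<tau> s) \<le> 4 * (\<tau> / (\<tau> + \<bar>s\<bar>))"
    using \<tau> width_pos[of s] by (simp add: divide_simps mult_ac) (use width_pos[of s] \<tau> in \<open>auto simp: algebra_simps intro: order_trans\<close>)
  have "(cmod (gpacket_fun \<tau> x0 s x))\<^sup>2 \<le> sqrt \<tau> / (2 * width \<tau> s) * 1"
    unfolding cmod_gpacket_fun using \<tau> width_pos[of s] by (intro mult_left_mono) auto
  also have "\<dots> \<le> (2 * wt \<tau> s)\<^sup>2" using le \<tau> by (simp add: wt_def power_mult_distrib)
  finally show "cmod (gpacket_fun \<tau> x0 s x) \<le> 2 * wt \<tau> s"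
    by (rule power2_le_imp_le) (use wt_bounds[OF \<tau>, of s] in simp)
qed

text \<open>Amplitude one over a width of order \<open>sqrt \<tau>\<close>: the norm tends to 0 with
  \<open>\<tau>\<close>, so narrow packets lie in any given ball.\<close>

lemma norm_gpacket: "(norm (gpacket \<tau> x0))\<^sup>2 = sqrt (pi * \<tau>)"
proof -
  have "(norm (gpacket \<tau> x0))\<^sup>2 = \<tau> * sqrt (pi / \<tau>)"
    unfolding gpacket_def norm_scaleC_L2 power_mult_distrib using norm_packet[of "complex_of_real (\<tau> / 2)" x0] \<tau> by simp
  also have "\<dots> = sqrt (\<tau>\<^sup>2 * (pi / \<tau>))" using \<tau> by (simp only: real_sqrt_mult real_sqrt_abs abs_of_pos)
  also have "\<tau>\<^sup>2 * (pi / \<tau>) = pi * \<tau>" using \<tau> by (simp add: power2_eq_square)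
  finally show ?thesis .
qed

text \<open>Pairing \<open>|v|^2 v\<close> with \<open>v\<close> leaves \<open>|v|^4\<close>, in
  which the phase of \<open>cgauss\<close> has cancelled; this is why knowing its modulus
  suffices.\<close>

lemma inner_cubic_gpacket:
  assumes a: "integrable lborel a" "lsq a"
  shows "inner (cubic a (schroedinger s (gpacket \<tau> x0))) (scaleC_L2 e (schroedinger s (gpacket \<tau> x0)))
      = Re (cnj e * (LINT x|lborel. a x * complex_of_real (mass \<tau> s * normal_density x0 (width \<tau> s) x)))"
    and "integrable lborel (\<lambda>x. a x * complex_of_real (mass \<tau> s * normal_density x0 (width \<tau> s) x))"
proof -
  let ?f = "gpacket_fun \<tau> x0 s" and ?v = "schroedinger s (gpacket \<tau> x0)"
  let ?G = "\<lambda>x. complex_of_real (mass \<tau> s * normal_density x0 (width \<tau> s) x)"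
  have ae: "AE x in lborel. rep_L2 ?v x = ?f x"
    unfolding schroedinger_gpacket(1) by (rule rep_to_L2[OF schroedinger_gpacket(2)])
  have Gb: "cmod (?G x) \<le> mass \<tau> s * (1 / sqrt (2 * pi * (width \<tau> s)\<^sup>2))" for x
  proof -
    have "normal_density x0 (width \<tau> s) x \<le> 1 / sqrt (2 * pi * (width \<tau> s)\<^sup>2) * 1"
      unfolding normal_density_def by (intro mult_left_mono) auto
    then have "mass \<tau> s * normal_density x0 (width \<tau> s) x \<le> mass \<tau> s * (1 / sqrt (2 * pi * (width \<tau> s)\<^sup>2))"
      using mass_pos[of s] by (intro mult_left_mono) auto
    moreover have "0 \<le> mass \<tau> s * normal_density x0 (width \<tau> s) x"
      using mass_pos[of s] by (simp add: normal_density_nonneg)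
    ultimately show ?thesis by (simp only: norm_of_real abs_of_nonneg)
  qed
  have i: "integrable lborel (\<lambda>x. ?G x * a x)"
    by (rule integrable_mult_bounded[OF _ Gb a(1)]) measurable
  then show "integrable lborel (\<lambda>x. a x * ?G x)" by (simp only: mult.commute)
  have lc: "lsq (cubic_fun a ?v)" by (rule cubic_fun_integrable(1)[OF a gpacket_linf])
  note [measurable] = lsq_measurable[OF lc] lsq_measurable[OF a(2)]
  have "inner (cubic a ?v) (scaleC_L2 e ?v) = (LINT x|lborel. inner (cubic_fun a ?v x) (e * rep_L2 ?v x))"
    using inner_to_L2[OF lc lsq_cmult[OF lsq_rep_L2, of e ?v]] scaleC_to_L2[OF lsq_rep_L2, of e ?v] by (simp add: cubic_eq)
  also have "\<dots> = (LINT x|lborel. Re (cnj e * (?G x * a x)))"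
  proof (rule integral_cong_AE)
    show "AE x in lborel. inner (cubic_fun a ?v x) (e * rep_L2 ?v x) = Re (cnj e * (?G x * a x))"
      using ae
    proof eventually_elim
      case (elim x)
      have "?G x = complex_of_real (((cmod (?f x))\<^sup>2)\<^sup>2)" by (simp only: cmod_gpacket_fun_power4)
      also have "\<dots> = complex_of_real ((cmod (?f x))\<^sup>2) * (?f x * cnj (?f x))"
        by (simp only: complex_norm_square[symmetric] power2_eq_square of_real_mult)
      finally have "?G x = complex_of_real ((cmod (?f x))\<^sup>2) * (?f x * cnj (?f x))" .
      then have eq: "cnj e * (?G x * a x) = cubic_fun a ?v x * cnj (e * rep_L2 ?v x)"
        by (simp add: cubic_fun_def elim mult_ac)
      have "inner w u = Re (w * cnj u)" for w u :: complex by (simp add: inner_complex_def)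
      then show ?case by (simp only: eq)
    qed
  qed measurable
  also have "\<dots> = Re (LINT x|lborel. cnj e * (?G x * a x))" by (rule integral_Re) (use i in simp)
  also have "\<dots> = Re (cnj e * (LINT x|lborel. a x * ?G x))" by (simp add: mult_ac)
  finally show "inner (cubic a ?v) (scaleC_L2 e ?v) = Re (cnj e * (LINT x|lborel. a x * ?G x))" .
qed

text \<open>With \<open>u = |x - x0| / width\<close>, the inequality
  \<open>sqrt u \<le> 1 + u^2\<close> reduces the half moment to the second moment, which the
  library evaluates.\<close>

lemma normal_sqrt_moment:
  "integrable lborel (\<lambda>x. sqrt \<bar>x - x0\<bar> * normal_density x0 (width \<tau> s) x)"
  "(LINT x|lborel. sqrt \<bar>x - x0\<bar> * normal_density x0 (width \<tau> s) x) \<le> 2 * sqrt (width \<tau> s)"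
proof -
  let ?r = "width \<tau> s"
  have r: "?r > 0" by (rule width_pos)
  let ?G = "\<lambda>x. sqrt ?r * (normal_density x0 ?r x + normal_density x0 ?r x * (x - x0) ^ (2 * 1) / ?r\<^sup>2)"
  have im: "integrable lborel (\<lambda>x. normal_density x0 ?r x * (x - x0) ^ (2 * 1))" by (rule integrable_normal_moment[OF r])
  have iG: "integrable lborel ?G" using im r by (intro integrable_mult_right Bochner_Integration.integrable_add integrable_divide) auto
  have "(LINT x|lborel. normal_density x0 ?r x * (x - x0) ^ (2 * 1)) = ?r\<^sup>2"
    unfolding integral_normal_moment_even[OF r] by (simp add: fact_numeral)
  then have vG: "integral\<^sup>L lborel ?G = sqrt ?r * 2" using im r by simp
  have le: "sqrt \<bar>x - x0\<bar> * normal_density x0 ?r x \<le> ?G x" for x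
  proof -
    define u where "u = \<bar>x - x0\<bar> / ?r"
    have u: "0 \<le> u" "\<bar>x - x0\<bar> = ?r * u" "u\<^sup>2 = (x - x0)\<^sup>2 / ?r\<^sup>2" using r by (auto simp: u_def power_divide)
    have "sqrt u \<le> 1 + u\<^sup>2"
    proof (cases "u \<le> 1")
      case True
      then show ?thesis using real_sqrt_le_1_iff[of u] zero_le_power2[of u] by linarith
    next
      case False
      then have "sqrt u \<le> sqrt (u\<^sup>2)" by (intro real_sqrt_le_mono) (simp add: power2_eq_square)
      also have "\<dots> = u" using u(1) by simp
      also have "\<dots> \<le> u\<^sup>2" using False by (simp add: power2_eq_square)
      finally show ?thesis by simp
    qed
    then have "sqrt ?r * sqrt u * normal_density x0 ?r x \<le> sqrt ?r * (1 + u\<^sup>2) * normal_density x0 ?r x"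
      using r by (intro mult_right_mono mult_left_mono) (auto simp: normal_density_nonneg)
    moreover have "?G x = sqrt ?r * (1 + u\<^sup>2) * normal_density x0 ?r x"
      unfolding u(3) by (simp add: distrib_left distrib_right mult_ac)
    moreover have "sqrt \<bar>x - x0\<bar> = sqrt ?r * sqrt u" unfolding u(2) by (rule real_sqrt_mult)
    ultimately show ?thesis by (simp only:)
  qed
  show i: "integrable lborel (\<lambda>x. sqrt \<bar>x - x0\<bar> * normal_density x0 ?r x)"
  proof (rule Bochner_Integration.integrable_bound[OF iG])
    have mono: "norm p \<le> norm q" if "0 \<le> p" "p \<le> q" for p q :: real using that by simp
    show "AE x in lborel. norm (sqrt \<bar>x - x0\<bar> * normal_density x0 ?r x) \<le> norm (?G x)"
      by (intro AE_I2 mono le mult_nonneg_nonneg normal_density_nonneg) simp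
  qed measurable
  show "(LINT x|lborel. sqrt \<bar>x - x0\<bar> * normal_density x0 ?r x) \<le> 2 * sqrt ?r"
    using integral_mono[OF i iG le] unfolding vG by simp
qed

lemma two_le_sqrt_2pi: "2 \<le> sqrt (2 * pi)" "sqrt (2 * pi) \<le> 4"
proof -
  show "2 \<le> sqrt (2 * pi)" by (rule real_le_rsqrt) (use pi_gt3 in simp)
  show "sqrt (2 * pi) \<le> 4" by (rule real_le_lsqrt) (use pi_less_4 in auto)
qed

text \<open>Oscillation over a width \<open>w\<close> costs at most \<open>2 * H * sqrt w\<close>;
  the mass is of order \<open>\<tau> / w\<close>, which leaves \<open>\<tau> / sqrt w\<close>, and
  \<open>w \<ge> s / sqrt \<tau>\<close>. The resulting singularity \<open>1 / sqrt s\<close> is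
  integrable at 0.\<close>

lemma gaussian_average_near:
  assumes c: "AE x in lborel. c x = c' x" "c \<in> borel_measurable borel" "c' \<in> borel_measurable borel"
    "\<And>x. cmod (c' x) \<le> B" "\<And>x y. cmod (c' x - c' y) \<le> H * sqrt \<bar>x - y\<bar>" and H: "0 \<le> H" and s: "0 < s"
  shows "cmod ((LINT x|lborel. c x * complex_of_real (mass \<tau> s * normal_density x0 (width \<tau> s) x)) - c' x0 * complex_of_real (mass \<tau> s))
    \<le> 2 * H * \<tau> * sqrt (sqrt \<tau>) * (1 / sqrt s)"
proof -
  note [measurable] = c(2,3)
  let ?N = "normal_density x0 (width \<tau> s)"
  let ?G = "\<lambda>x. complex_of_real (mass \<tau> s * ?N x)"
  have iG: "integrable lborel ?G" using width_pos[of s] by (simp add: complex_of_real_integrable_eq del: of_real_mult)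
  have vG: "integral\<^sup>L lborel ?G = complex_of_real (mass \<tau> s)"
    using width_pos[of s] by (simp del: of_real_mult)
  have i: "integrable lborel (\<lambda>x. c' x * ?G x)" by (rule integrable_mult_bounded[OF _ c(4) iG]) measurable
  have i0: "integrable lborel (\<lambda>x. c' x0 * ?G x)" using iG by (rule integrable_mult_right)
  have "(LINT x|lborel. c x * ?G x) = (LINT x|lborel. c' x * ?G x)"
  proof (rule integral_cong_AE)
    show "AE x in lborel. c x * ?G x = c' x * ?G x" using c(1) by eventually_elim simp
  qed measurable
  then have eq: "(LINT x|lborel. c x * ?G x) - c' x0 * complex_of_real (mass \<tau> s) = (LINT x|lborel. c' x * ?G x - c' x0 * ?G x)"
    unfolding Bochner_Integration.integral_diff[OF i i0] integral_mult_right_zero vG by simp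
  have "cmod ((LINT x|lborel. c x * ?G x) - c' x0 * complex_of_real (mass \<tau> s)) \<le> (LINT x|lborel. cmod (c' x * ?G x - c' x0 * ?G x))"
    unfolding eq by (rule integral_norm_bound)
  also have "\<dots> \<le> (LINT x|lborel. (H * mass \<tau> s) * (sqrt \<bar>x - x0\<bar> * ?N x))"
  proof (rule integral_mono)
    show "integrable lborel (\<lambda>x. cmod (c' x * ?G x - c' x0 * ?G x))" by (intro integrable_norm Bochner_Integration.integrable_diff i i0)
    show "integrable lborel (\<lambda>x. (H * mass \<tau> s) * (sqrt \<bar>x - x0\<bar> * ?N x))" by (intro integrable_mult_right normal_sqrt_moment)
    fix x
    have "cmod (c' x * ?G x - c' x0 * ?G x) = cmod (c' x - c' x0) * (mass \<tau> s * ?N x)"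
      using mass_pos[of s] unfolding left_diff_distrib[symmetric] norm_mult norm_of_real by (simp add: abs_mult normal_density_nonneg)
    also have "\<dots> \<le> H * sqrt \<bar>x - x0\<bar> * (mass \<tau> s * ?N x)"
      using mass_pos[of s] by (intro mult_right_mono c(5)) (simp add: normal_density_nonneg)
    finally show "cmod (c' x * ?G x - c' x0 * ?G x) \<le> (H * mass \<tau> s) * (sqrt \<bar>x - x0\<bar> * ?N x)" by (simp add: mult_ac)
  qed
  also have "\<dots> \<le> (H * mass \<tau> s) * (2 * sqrt (width \<tau> s))"
    unfolding integral_mult_right_zero using H mass_pos[of s] by (intro mult_left_mono normal_sqrt_moment(2)) auto
  also have "\<dots> = 2 * H * \<tau> * (sqrt (2 * pi) / 4) * (1 / sqrt (width \<tau> s))"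
  proof -
    have "sqrt (width \<tau> s) / width \<tau> s = 1 / sqrt (width \<tau> s)"
      using width_pos[of s] by (simp add: divide_eq_eq eq_divide_eq)
    moreover have "H * (t * p / (4 * w)) * (2 * q) = 2 * H * t * (p / 4) * (q / w)" for t p w q :: real by simp
    ultimately show ?thesis unfolding mass_def by (simp only:)
  qed
  also have "\<dots> \<le> 2 * H * \<tau> * 1 * (sqrt (sqrt \<tau>) / sqrt s)"
  proof (intro mult_mono)
    have "sqrt (s / sqrt \<tau>) \<le> sqrt (width \<tau> s)" by (rule real_sqrt_le_mono[OF width_ge[OF s]])
    then show "1 / sqrt (width \<tau> s) \<le> sqrt (sqrt \<tau>) / sqrt s"
      using s \<tau> width_pos[of s] by (simp add: real_sqrt_divide field_simps)
  qed (use H \<tau> two_le_sqrt_2pi width_pos[of s] in auto)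
  finally show ?thesis by simp
qed

text \<open>For wide packets regularity of \<open>c\<close> does not help; its L1 norm is paired
  with the supremum of \<open>|v|^4\<close>, at most \<open>\<tau> / (4 * width^2)\<close>, which
  decays like \<open>1 / s^2\<close>.\<close>

lemma gaussian_average_far:
  assumes c: "integrable lborel c" and s: "0 < s"
  shows "cmod (LINT x|lborel. c x * complex_of_real (mass \<tau> s * normal_density x0 (width \<tau> s) x)) \<le> \<tau>\<^sup>2 * L1_norm c / 4 * (1 / s\<^sup>2)"
proof -
  let ?g = "\<lambda>x. mass \<tau> s * normal_density x0 (width \<tau> s) x"
  have g0: "0 \<le> ?g x" for x using mass_pos[of s] by (simp add: normal_density_nonneg)
  have g: "?g x \<le> \<tau>\<^sup>2 / 4 * (1 / s\<^sup>2)" for x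
  proof -
    have "?g x = ((cmod (gpacket_fun \<tau> x0 s x))\<^sup>2)\<^sup>2" by (simp only: cmod_gpacket_fun_power4)
    also have "\<dots> \<le> (sqrt \<tau> / (2 * width \<tau> s) * 1)\<^sup>2"
      unfolding cmod_gpacket_fun using \<tau> width_pos[of s] by (intro power_mono mult_left_mono) auto
    also have "\<dots> = \<tau> / (4 * (width \<tau> s)\<^sup>2)" using \<tau> by (simp add: power_divide power_mult_distrib)
    also have "\<dots> \<le> \<tau> / (4 * (s / sqrt \<tau>)\<^sup>2)"
      using \<tau> s width_ge[OF s] width_pos[of s] by (intro divide_left_mono mult_left_mono power_mono) auto
    also have "\<dots> = \<tau>\<^sup>2 / 4 * (1 / s\<^sup>2)" using \<tau> by (simp add: power_divide power2_eq_square)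
    finally show ?thesis .
  qed
  have "cmod (LINT x|lborel. c x * complex_of_real (?g x)) \<le> (LINT x|lborel. cmod (c x * complex_of_real (?g x)))"
    by (rule integral_norm_bound)
  also have "\<dots> \<le> (LINT x|lborel. \<tau>\<^sup>2 / 4 * (1 / s\<^sup>2) * cmod (c x))"
  proof (rule integral_mono)
    have "integrable lborel (\<lambda>x. complex_of_real (?g x) * c x)"
      by (rule integrable_mult_bounded[OF _ _ c, of _ "\<tau>\<^sup>2 / 4 * (1 / s\<^sup>2)"]) (measurable, use g g0 in \<open>simp del: of_real_mult\<close>)
    then show "integrable lborel (\<lambda>x. cmod (c x * complex_of_real (?g x)))" by (simp only: mult.commute integrable_norm)
    fix x
    have "cmod (c x * complex_of_real (?g x)) = ?g x * cmod (c x)"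
      unfolding norm_mult norm_of_real abs_of_nonneg[OF g0] by (rule mult.commute)
    also have "\<dots> \<le> \<tau>\<^sup>2 / 4 * (1 / s\<^sup>2) * cmod (c x)" by (rule mult_right_mono[OF g]) simp
    finally show "cmod (c x * complex_of_real (?g x)) \<le> \<tau>\<^sup>2 / 4 * (1 / s\<^sup>2) * cmod (c x)" .
  qed (use c in simp)
  also have "\<dots> = \<tau>\<^sup>2 / 4 * (1 / s\<^sup>2) * L1_norm c" unfolding L1_norm_def by (rule integral_mult_right_zero)
  finally show ?thesis by (simp add: mult_ac)
qed

lemma mass_measurable [measurable]: "mass \<tau> \<in> borel_measurable borel"
  unfolding mass_def width_def by measurable

text \<open>For \<open>\<tau> < s < sqrt \<tau>\<close> the width is at most
  \<open>2 * s / sqrt \<tau>\<close>, so the mass is at least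
  \<open>\<tau> * sqrt \<tau> / (4 * s)\<close>. The integral of \<open>1 / s\<close> over this
  range is \<open>ln (1 / \<tau>) / 2\<close>, which accounts for the 8.\<close>

lemma mass_integral:
  assumes \<tau>1: "\<tau> < 1"
  shows "integrable lborel (\<lambda>s. indicator {0<..<sqrt \<tau>} s * mass \<tau> s)"
    "\<tau> * sqrt \<tau> * ln (1 / \<tau>) / 8 \<le> (LINT s|lborel. indicator {0<..<sqrt \<tau>} s * mass \<tau> s)"
proof -
  let ?K = "\<tau> * sqrt (2 * pi) / (2 * sqrt \<tau>)"
  have b: "mass \<tau> s \<le> ?K" for s
    unfolding mass_def using \<tau> width_ge'[of s] width_pos[of s] by (intro divide_left_mono) auto
  have iK: "integrable lborel (\<lambda>s. ?K * indicator {0..sqrt \<tau>} s)" by (intro integrable_mult_right integrable_indicator_Icc)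
  show i: "integrable lborel (\<lambda>s. indicator {0<..<sqrt \<tau>} s * mass \<tau> s)"
  proof (rule Bochner_Integration.integrable_bound[OF iK])
    have "norm (indicator {0<..<sqrt \<tau>} s * mass \<tau> s) \<le> norm (?K * indicator {0..sqrt \<tau>} s)" for s
      using b[of s] mass_pos[of s] by (auto simp: indicator_def abs_of_pos simp del: abs_divide abs_mult)
    then show "AE s in lborel. norm (indicator {0<..<sqrt \<tau>} s * mass \<tau> s) \<le> norm (?K * indicator {0..sqrt \<tau>} s)" by simp
  qed measurable
  have st: "\<tau> < sqrt \<tau>"
  proof -
    have "\<tau> * \<tau> < \<tau> * 1" using \<tau> \<tau>1 by (intro mult_strict_left_mono)
    then have "\<tau>\<^sup>2 < \<tau>" by (simp add: power2_eq_square)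
    then show ?thesis by (rule real_less_rsqrt)
  qed
  have "\<tau> * sqrt \<tau> * ln (1 / \<tau>) / 8 = \<tau> * sqrt \<tau> / 4 * (ln (sqrt \<tau>) - ln \<tau>)"
    using \<tau> by (simp add: ln_sqrt ln_div)
  also have "\<dots> = (LINT s|lborel. \<tau> * sqrt \<tau> / 4 * (indicator {\<tau><..<sqrt \<tau>} s * (1 / s)))"
    by (simp only: integral_mult_right_zero integral_inverse(2)[OF \<tau> st])
  also have "\<dots> \<le> (LINT s|lborel. indicator {0<..<sqrt \<tau>} s * mass \<tau> s)"
  proof (rule integral_mono[OF _ i])
    show "integrable lborel (\<lambda>s. \<tau> * sqrt \<tau> / 4 * (indicator {\<tau><..<sqrt \<tau>} s * (1 / s)))"
      by (intro integrable_mult_right integral_inverse(1)[OF \<tau> st])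
    show "\<tau> * sqrt \<tau> / 4 * (indicator {\<tau><..<sqrt \<tau>} s * (1 / s)) \<le> indicator {0<..<sqrt \<tau>} s * mass \<tau> s" for s
    proof (cases "s \<in> {\<tau><..<sqrt \<tau>}")
      case True
      then have s: "\<tau> \<le> s" "0 < s" "s \<in> {0<..<sqrt \<tau>}" using \<tau> by auto
      have "\<tau> * sqrt \<tau> / 4 * (1 / s) = \<tau> * 2 / (4 * (2 * s / sqrt \<tau>))" using s \<tau> by (simp add: field_simps)
      also have "\<dots> \<le> \<tau> * sqrt (2 * pi) / (4 * (2 * s / sqrt \<tau>))"
        using s \<tau> two_le_sqrt_2pi by (intro divide_right_mono mult_left_mono) auto
      also have "\<dots> \<le> mass \<tau> s"
        unfolding mass_def using s \<tau> width_pos[of s] width_le[OF s(1)] by (intro divide_left_mono mult_left_mono mult_pos_pos) auto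
      finally show ?thesis using True s by simp
    next
      case False
      then show ?thesis using mass_pos[of s] by (simp add: indicator_def)
    qed
  qed
  finally show "\<tau> * sqrt \<tau> * ln (1 / \<tau>) / 8 \<le> (LINT s|lborel. indicator {0<..<sqrt \<tau>} s * mass \<tau> s)" .
qed

text \<open>\<open>P\<close> will be the real part or minus the imaginary part, the directions that
  one pairing can see. The cut at \<open>sqrt \<tau>\<close>, where the width is of order one, makes
  the near error and the far error both of order \<open>\<tau> * sqrt \<tau>\<close>, smaller than
  the main term by the logarithm.\<close>

lemma gaussian_average_log_bound:
  fixes P :: "complex \<Rightarrow> real"
  assumes \<tau>1: "\<tau> < 1" and P: "bounded_linear P" "\<And>z. \<bar>P z\<bar> \<le> cmod z"
    and c: "AE x in lborel. c x = c' x" "integrable lborel c" "c' \<in> borel_measurable borel"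
    "\<And>x. cmod (c' x) \<le> B" "\<And>x y. cmod (c' x - c' y) \<le> H * sqrt \<bar>x - y\<bar>" and H: "0 \<le> H"
    and g: "g = (\<lambda>s. LINT x|lborel. c x * complex_of_real (mass \<tau> s * normal_density x0 (width \<tau> s) x))"
    and ig: "integrable lborel (\<lambda>s. indicator {0<..} s * P (g s))"
  shows "\<bar>P (c' x0)\<bar> * (\<tau> * sqrt \<tau> * ln (1 / \<tau>) / 8)
    \<le> \<bar>LINT s|lborel. indicator {0<..} s * P (g s)\<bar> + (4 * H + L1_norm c) * (\<tau> * sqrt \<tau>)"
proof -
  define \<sigma> where "\<sigma> = sqrt \<tau>"
  have \<sigma>: "\<sigma> > 0" "\<sigma> * \<sigma> = \<tau>" using \<tau> by (auto simp: \<sigma>_def)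
  have cm: "c \<in> borel_measurable borel" using borel_measurable_integrable[OF c(2)] by simp
  let ?m = "\<lambda>s. indicator {0<..<\<sigma>} s * mass \<tau> s"
  note im = mass_integral(1)[OF \<tau>1, folded \<sigma>_def]
  let ?e = "\<lambda>s. 2 * H * \<tau> * sqrt \<sigma> * (indicator {0<..<\<sigma>} s * (1 / sqrt s))"
  let ?f = "\<lambda>s. \<tau>\<^sup>2 * L1_norm c / 4 * (indicator {\<sigma><..} s * (1 / s\<^sup>2))"
  have ie: "integrable lborel ?e" by (rule integrable_mult_right[OF integral_inverse_sqrt(1)[OF \<sigma>(1)]])
  have ve: "integral\<^sup>L lborel ?e = 4 * H * (\<tau> * \<sigma>)"
    unfolding integral_mult_right_zero integral_inverse_sqrt(2)[OF \<sigma>(1)] using \<sigma>(1) by simp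
  have if_: "integrable lborel ?f" by (rule integrable_mult_right[OF integral_inverse_square_tail(1)[OF \<sigma>(1)]])
  have vf: "integral\<^sup>L lborel ?f = L1_norm c / 4 * (\<tau> * \<sigma>)"
    unfolding integral_mult_right_zero integral_inverse_square_tail(2)[OF \<sigma>(1)]
    using \<sigma> by (simp add: power2_eq_square field_simps)
  have Pr: "P (z * complex_of_real r) = P z * r" for z r
    using linear_simps(5)[OF P(1), of r z] by (simp add: scaleR_conv_of_real mult.commute)
  have diff: "AE s in lborel. \<bar>indicator {0<..} s * P (g s) - P (c' x0) * ?m s\<bar> \<le> ?e s + ?f s"
    using AE_neq[of \<sigma>]
  proof eventually_elim
    case (elim s)
    consider "s \<le> 0" | "0 < s" "s < \<sigma>" | "\<sigma> < s" using elim by linarith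
    then show ?case
    proof cases
      case 1
      then show ?thesis using \<sigma>(1) by simp
    next
      case 2
      have "\<bar>P (g s) - P (c' x0) * mass \<tau> s\<bar> = \<bar>P (g s - c' x0 * complex_of_real (mass \<tau> s))\<bar>"
        by (simp only: linear_simps(2)[OF P(1)] Pr)
      also have "\<dots> \<le> cmod (g s - c' x0 * complex_of_real (mass \<tau> s))" by (rule P(2))
      also have "\<dots> \<le> 2 * H * \<tau> * sqrt \<sigma> * (1 / sqrt s)"
        unfolding g \<sigma>_def by (rule gaussian_average_near[OF c(1) cm c(3-5) H 2(1)])
      finally show ?thesis using 2 by simp
    next
      case 3
      then have s: "0 < s" using \<sigma> by simp
      have "\<bar>P (g s)\<bar> \<le> cmod (g s)" by (rule P(2))
      also have "\<dots> \<le> \<tau>\<^sup>2 * L1_norm c / 4 * (1 / s\<^sup>2)" unfolding g by (rule gaussian_average_far[OF c(2) s])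
      finally show ?thesis using 3 s by simp
    qed
  qed
  have iPm: "integrable lborel (\<lambda>s. P (c' x0) * ?m s)" by (rule integrable_mult_right[OF im])
  have "\<bar>(LINT s|lborel. indicator {0<..} s * P (g s)) - P (c' x0) * integral\<^sup>L lborel ?m\<bar>
      = \<bar>LINT s|lborel. indicator {0<..} s * P (g s) - P (c' x0) * ?m s\<bar>"
    unfolding Bochner_Integration.integral_diff[OF ig iPm] integral_mult_right_zero ..
  also have "\<dots> \<le> (LINT s|lborel. \<bar>indicator {0<..} s * P (g s) - P (c' x0) * ?m s\<bar>)" by (rule integral_abs_bound)
  also have "\<dots> \<le> (LINT s|lborel. ?e s + ?f s)"
    by (rule integral_mono_AE[OF integrable_abs[OF Bochner_Integration.integrable_diff[OF ig iPm]] Bochner_Integration.integrable_add[OF ie if_] diff])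
  also have "\<dots> = 4 * H * (\<tau> * \<sigma>) + L1_norm c / 4 * (\<tau> * \<sigma>)"
    unfolding Bochner_Integration.integral_add[OF ie if_] ve vf ..
  also have "\<dots> \<le> (4 * H + L1_norm c) * (\<tau> * \<sigma>)"
    using \<tau> \<sigma>(1) unfolding distrib_right by (intro add_left_mono mult_right_mono) auto
  finally have 1: "\<bar>P (c' x0) * integral\<^sup>L lborel ?m\<bar> \<le> \<bar>LINT s|lborel. indicator {0<..} s * P (g s)\<bar> + (4 * H + L1_norm c) * (\<tau> * \<sigma>)"
    by linarith
  have 2: "\<tau> * \<sigma> * ln (1 / \<tau>) / 8 \<le> integral\<^sup>L lborel ?m"
    using mass_integral(2)[OF \<tau>1] unfolding \<sigma>_def .
  have "\<bar>P (c' x0)\<bar> * (\<tau> * \<sigma> * ln (1 / \<tau>) / 8) \<le> \<bar>P (c' x0)\<bar> * integral\<^sup>L lborel ?m"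
    by (rule mult_left_mono[OF 2]) simp
  also have "\<dots> = \<bar>P (c' x0) * integral\<^sup>L lborel ?m\<bar>"
    unfolding abs_mult by (simp add: integral_nonneg_AE mass_pos less_imp_le abs_of_nonneg)
  finally show ?thesis using 1 unfolding \<sigma>_def by linarith
qed

end

section \<open>The stability estimate\<close>

lemma norm_le_scattering_dist:
  assumes "scattering_dist \<eta> a b = ennreal D" "0 \<le> D" "norm \<phi> < \<eta>" "\<phi> \<noteq> 0"
  shows "norm (scattering_map a \<phi> - scattering_map b \<phi>) \<le> D * norm \<phi>"
proof -
  have "ennreal (norm (scattering_map a \<phi> - scattering_map b \<phi>) / norm \<phi>) \<le> ennreal D"
    unfolding assms(1)[symmetric] scattering_dist_def using assms(3,4) by (intro SUP_upper) auto
  then have "norm (scattering_map a \<phi> - scattering_map b \<phi>) / norm \<phi> \<le> D"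
    using assms(2) by (simp add: ennreal_le_iff)
  then show ?thesis using assms(4) by (simp add: pos_divide_le_eq)
qed

text \<open>\<open>221184 = 768 * 288\<close>: the Born error with \<open>\<kappa>\<close> inserted,
  divided by \<open>\<tau> * sqrt \<tau>\<close>.\<close>

definition born_const :: "real \<Rightarrow> real" where
  "born_const A = 221184 * pi\<^sup>2 * A\<^sup>2"

text \<open>The sum collects the errors in units of \<open>\<tau> * sqrt \<tau>\<close>: 2 from the
  distance of the maps, two Born errors, \<open>4 * H\<close> with
  \<open>H = 4 * (A\<^sub>H + B\<^sub>H)\<close>, and the L1 norm. The factor 16 undoes the 8 of
  \<open>mass_integral\<close> and adds real and imaginary parts.\<close>

definition log_const :: "real \<Rightarrow> real \<Rightarrow> real \<Rightarrow> real \<Rightarrow> real" where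
  "log_const A\<^sub>1 A\<^sub>H B\<^sub>1 B\<^sub>H = 16 * (2 + born_const A\<^sub>1 + born_const B\<^sub>1 + 16 * (A\<^sub>H + B\<^sub>H) + (A\<^sub>1 + B\<^sub>1))"

lemma L1_H1_D:
  assumes "a \<in> L1_H1"
  shows "integrable lborel a" "lsq a" "a \<in> borel_measurable borel" "AE x in lborel. cmod (a x) \<le> 2 * H1_norm a"
proof -
  show "integrable lborel a" "lsq a" using assms by (auto simp: L1_H1_def in_H1_def)
  then show "a \<in> borel_measurable borel" by (simp add: lsq_def)
  obtain a' where "AE x in lborel. a x = a' x" "\<And>x. cmod (a' x) \<le> 2 * H1_norm a"
    by (rule H1_holder_representative[OF assms]) blast
  then show "AE x in lborel. cmod (a x) \<le> 2 * H1_norm a" by (auto elim!: eventually_mono)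
qed

lemma H1_norm_nonneg: "0 \<le> H1_norm a"
  by (simp add: H1_norm_def)

text \<open>The maps are tested on the packet at an arbitrary \<open>x0\<close>, so the bound holds
  everywhere for the continuous representative of \<open>a - b\<close>. The condition
  \<open>4 * \<tau> \<le> \<eta>^4\<close> puts the packet in the ball, as its norm has fourth power
  \<open>pi * \<tau>\<close>; \<open>D \<le> \<tau>\<close> brings the contribution of the maps down
  to the size of the other errors.\<close>

lemma scattering_dist_log_bound:
  assumes a: "a \<in> L1_H1" and b: "b \<in> L1_H1"
    and \<tau>: "0 < \<tau>" "\<tau> < 1" "576 * pi * L1_norm a * sqrt \<tau> \<le> 1" "576 * pi * L1_norm b * sqrt \<tau> \<le> 1"
    and \<eta>: "0 < \<eta>" "4 * \<tau> \<le> \<eta> ^ 4"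
    and D: "scattering_dist \<eta> a b = ennreal D" "0 \<le> D" "D \<le> \<tau>"
  shows "AE x in lborel. cmod (a x - b x) * ln (1 / \<tau>)
    \<le> log_const (L1_norm a) (H1_norm a) (L1_norm b) (H1_norm b)"
proof -
  obtain a' where a': "AE x in lborel. a x = a' x" "a' \<in> borel_measurable borel"
    "\<And>x. cmod (a' x) \<le> 2 * H1_norm a" "\<And>x y. cmod (a' x - a' y) \<le> 4 * H1_norm a * sqrt \<bar>x - y\<bar>"
    by (rule H1_holder_representative[OF a]) (rule that)
  obtain b' where b': "AE x in lborel. b x = b' x" "b' \<in> borel_measurable borel"
    "\<And>x. cmod (b' x) \<le> 2 * H1_norm b" "\<And>x y. cmod (b' x - b' y) \<le> 4 * H1_norm b * sqrt \<bar>x - y\<bar>"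
    by (rule H1_holder_representative[OF b]) (rule that)
  define H where "H = 4 * (H1_norm a + H1_norm b)"
  have H: "0 \<le> H" using H1_norm_nonneg[of a] H1_norm_nonneg[of b] by (simp add: H_def)
  let ?c = "\<lambda>x. a x - b x" and ?c' = "\<lambda>x. a' x - b' x"
  have ic: "integrable lborel ?c" using L1_H1_D(1)[OF a] L1_H1_D(1)[OF b] by simp
  have Lc: "L1_norm ?c \<le> L1_norm a + L1_norm b"
  proof -
    have "L1_norm ?c \<le> (LINT x|lborel. cmod (a x) + cmod (b x))"
      unfolding L1_norm_def using ic L1_H1_D(1)[OF a] L1_H1_D(1)[OF b]
      by (intro integral_mono) (auto intro: norm_triangle_ineq4)
    then show ?thesis using L1_H1_D(1)[OF a] L1_H1_D(1)[OF b] by (simp add: L1_norm_def)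
  qed
  have c': "AE x in lborel. ?c x = ?c' x" using a'(1) b'(1) by eventually_elim simp
  have c'_meas: "?c' \<in> borel_measurable borel" using a'(2) b'(2) by measurable
  have c'_bound: "cmod (?c' x) \<le> 2 * H1_norm a + 2 * H1_norm b" for x
    using norm_triangle_ineq4[of "a' x" "b' x"] a'(3)[of x] b'(3)[of x] by linarith
  have c'_holder: "cmod (?c' x - ?c' y) \<le> H * sqrt \<bar>x - y\<bar>" for x y
  proof -
    have eq: "?c' x - ?c' y = (a' x - a' y) - (b' x - b' y)" by simp
    have "cmod (?c' x - ?c' y) \<le> cmod (a' x - a' y) + cmod (b' x - b' y)"
      unfolding eq by (rule norm_triangle_ineq4)
    also have "\<dots> \<le> 4 * H1_norm a * sqrt \<bar>x - y\<bar> + 4 * H1_norm b * sqrt \<bar>x - y\<bar>" by (intro add_mono a'(4) b'(4))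
    finally show ?thesis by (simp add: H_def algebra_simps)
  qed
  have main: "cmod (?c' x0) * ln (1 / \<tau>) \<le> log_const (L1_norm a) (H1_norm a) (L1_norm b) (H1_norm b)" for x0
  proof -
    define \<phi> where "\<phi> = gpacket \<tau> x0"
    interpret A: small_data a "2 * H1_norm a" \<tau> \<phi>
      by unfold_locales (use L1_H1_D[OF a] \<tau> gpacket_linf[OF \<tau>(1)] in \<open>auto simp: \<phi>_def\<close>)
    interpret B: small_data b "2 * H1_norm b" \<tau> \<phi>
      by unfold_locales (use L1_H1_D[OF b] \<tau> gpacket_linf[OF \<tau>(1)] in \<open>auto simp: \<phi>_def\<close>)
    have n\<phi>: "(norm \<phi>)\<^sup>2 = sqrt (pi * \<tau>)" unfolding \<phi>_def by (rule norm_gpacket[OF \<tau>(1)])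
    have \<phi>0: "\<phi> \<noteq> 0"
    proof
      assume "\<phi> = 0"
      then have "sqrt (pi * \<tau>) = 0" using n\<phi> by simp
      then show False using \<tau>(1) by simp
    qed
    have \<phi>\<eta>: "norm \<phi> < \<eta>"
    proof -
      have "pi * \<tau> < 4 * \<tau>" using pi_less_4 \<tau>(1) by (intro mult_strict_right_mono)
      then have "pi * \<tau> < (\<eta>\<^sup>2)\<^sup>2" using \<eta>(2) by simp
      then have "(norm \<phi>)\<^sup>2 < \<eta>\<^sup>2" unfolding n\<phi> by (intro real_less_lsqrt) auto
      then show ?thesis by (rule power_less_imp_less_base) (use \<eta>(1) in simp)
    qed
    have n\<phi>2: "(norm \<phi>)\<^sup>2 \<le> 2 * sqrt \<tau>"
    proof -
      have "sqrt (pi * \<tau>) \<le> sqrt (4 * \<tau>)" using pi_less_4 \<tau>(1) by (intro real_sqrt_le_mono mult_right_mono) auto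
      then show ?thesis unfolding n\<phi> by (simp add: real_sqrt_mult)
    qed
    have pair: "\<bar>inner (scattering_map a \<phi> - scattering_map b \<phi>) (scaleC_L2 e \<phi>)\<bar> \<le> 2 * (\<tau> * sqrt \<tau>)"
      if "cmod e = 1" for e
    proof -
      have "\<bar>inner (scattering_map a \<phi> - scattering_map b \<phi>) (scaleC_L2 e \<phi>)\<bar>
          \<le> norm (scattering_map a \<phi> - scattering_map b \<phi>) * norm \<phi>"
        using Cauchy_Schwarz_ineq2[of "scattering_map a \<phi> - scattering_map b \<phi>" "scaleC_L2 e \<phi>"] that by simp
      also have "\<dots> \<le> D * norm \<phi> * norm \<phi>"
        by (intro mult_right_mono norm_le_scattering_dist[OF D(1,2) \<phi>\<eta> \<phi>0]) simp
      also have "\<dots> = D * (norm \<phi>)\<^sup>2" by (simp add: power2_eq_square)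
      also have "\<dots> \<le> \<tau> * (2 * sqrt \<tau>)" using D \<tau>(1) by (intro mult_mono n\<phi>2) auto
      finally show ?thesis by simp
    qed
    define g where "g = (\<lambda>s. LINT x|lborel. ?c x * complex_of_real (mass \<tau> s * normal_density x0 (width \<tau> s) x))"
    have born: "768 * (288 * pi * L1_norm f * sqrt \<tau>) * pi * L1_norm f * \<tau> = born_const (L1_norm f) * (\<tau> * sqrt \<tau>)" for f
      by (simp add: born_const_def power2_eq_square)
    let ?t = "\<tau> * sqrt \<tau>" and ?K = "2 + born_const (L1_norm a) + born_const (L1_norm b)"
    have gdiff: "Re (cnj e * g s) = Re (cnj e * (LINT x|lborel. a x * complex_of_real (mass \<tau> s * normal_density x0 (width \<tau> s) x)))
        - Re (cnj e * (LINT x|lborel. b x * complex_of_real (mass \<tau> s * normal_density x0 (width \<tau> s) x)))" for e s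
      unfolding g_def left_diff_distrib
        Bochner_Integration.integral_diff[OF inner_cubic_gpacket(2)[OF \<tau>(1) L1_H1_D(1,2)[OF a]] inner_cubic_gpacket(2)[OF \<tau>(1) L1_H1_D(1,2)[OF b]]]
      by (simp only: right_diff_distrib minus_complex.sel)
    have est: "integrable lborel (\<lambda>s. indicator {0<..} s * Re (cnj (- \<i> * e) * g s)) \<and>
        \<bar>LINT s|lborel. indicator {0<..} s * Re (cnj (- \<i> * e) * g s)\<bar> \<le> ?K * ?t" if e: "cmod e = 1" for e
    proof -
      note A = A.born_approximation[OF e, unfolded \<phi>_def inner_cubic_gpacket(1)[OF \<tau>(1) L1_H1_D(1,2)[OF a]], folded \<phi>_def]
      note B = B.born_approximation[OF e, unfolded \<phi>_def inner_cubic_gpacket(1)[OF \<tau>(1) L1_H1_D(1,2)[OF b]], folded \<phi>_def]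
      have i: "integrable lborel (\<lambda>s. indicator {0<..} s * Re (cnj (- \<i> * e) * g s))"
        unfolding gdiff right_diff_distrib by (rule Bochner_Integration.integrable_diff[OF A(2) B(2)])
      have v: "(LINT s|lborel. indicator {0<..} s * Re (cnj (- \<i> * e) * g s))
        = (LINT s|lborel. indicator {0<..} s * Re (cnj (- \<i> * e) * (LINT x|lborel. a x * complex_of_real (mass \<tau> s * normal_density x0 (width \<tau> s) x))))
        - (LINT s|lborel. indicator {0<..} s * Re (cnj (- \<i> * e) * (LINT x|lborel. b x * complex_of_real (mass \<tau> s * normal_density x0 (width \<tau> s) x))))"
        unfolding gdiff right_diff_distrib by (rule Bochner_Integration.integral_diff[OF A(2) B(2)])
      have "inner (scattering_map a \<phi> - scattering_map b \<phi>) (scaleC_L2 e \<phi>)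
          = inner (scattering_map a \<phi> - \<phi>) (scaleC_L2 e \<phi>) - inner (scattering_map b \<phi> - \<phi>) (scaleC_L2 e \<phi>)"
        by (simp add: inner_diff_left)
      then have "\<bar>LINT s|lborel. indicator {0<..} s * Re (cnj (- \<i> * e) * g s)\<bar>
          \<le> 2 * ?t + born_const (L1_norm a) * ?t + born_const (L1_norm b) * ?t"
        using A(1)[unfolded born] B(1)[unfolded born] pair[OF e] unfolding v by linarith
      also have "\<dots> = ?K * ?t" by (simp add: distrib_right)
      finally show ?thesis using i by blast
    qed
    have P: "\<bar>P (?c' x0)\<bar> * ln (1 / \<tau>) \<le> log_const (L1_norm a) (H1_norm a) (L1_norm b) (H1_norm b) / 2"
      if P: "bounded_linear P" "\<And>z. \<bar>P z\<bar> \<le> cmod z" and e: "cmod e = 1" "\<And>z. Re (cnj (- \<i> * e) * z) = P z" for P e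
    proof -
      have "\<bar>P (?c' x0)\<bar> * (?t * ln (1 / \<tau>) / 8) \<le> \<bar>LINT s|lborel. indicator {0<..} s * P (g s)\<bar> + (4 * H + L1_norm ?c) * ?t"
        by (rule gaussian_average_log_bound[OF \<tau>(1,2) P c' ic c'_meas c'_bound c'_holder H g_def])
           (use est[OF e(1)] in \<open>simp only: e(2)\<close>)
      also have "\<dots> \<le> ?K * ?t + (4 * H + (L1_norm a + L1_norm b)) * ?t"
      proof (rule add_mono)
        show "\<bar>LINT s|lborel. indicator {0<..} s * P (g s)\<bar> \<le> ?K * ?t" using est[OF e(1)] by (simp only: e(2))
        show "(4 * H + L1_norm ?c) * ?t \<le> (4 * H + (L1_norm a + L1_norm b)) * ?t"
          using \<tau>(1) by (intro mult_right_mono add_left_mono Lc) simp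
      qed
      also have "\<dots> = (log_const (L1_norm a) (H1_norm a) (L1_norm b) (H1_norm b) / 16) * ?t"
        by (simp add: log_const_def H_def algebra_simps)
      finally have "(\<bar>P (?c' x0)\<bar> * ln (1 / \<tau>) / 8) * ?t \<le> (log_const (L1_norm a) (H1_norm a) (L1_norm b) (H1_norm b) / 16) * ?t"
        by (simp add: mult_ac)
      then have "\<bar>P (?c' x0)\<bar> * ln (1 / \<tau>) / 8 \<le> log_const (L1_norm a) (H1_norm a) (L1_norm b) (H1_norm b) / 16"
        by (rule mult_right_le_imp_le) (use \<tau>(1) in simp)
      then show ?thesis by linarith
    qed
    \<comment> \<open>The factor \<open>cnj (- \<i> * e)\<close> is 1 for \<open>e = \<i>\<close>
      and \<open>\<i>\<close> for \<open>e = 1\<close>; these select the real part and minus the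
      imaginary part.\<close>
    have "\<bar>Re (?c' x0)\<bar> * ln (1 / \<tau>) \<le> log_const (L1_norm a) (H1_norm a) (L1_norm b) (H1_norm b) / 2"
      by (rule P[OF bounded_linear_Re abs_Re_le_cmod, of \<i>]) simp_all
    moreover have "\<bar>- Im (?c' x0)\<bar> * ln (1 / \<tau>) \<le> log_const (L1_norm a) (H1_norm a) (L1_norm b) (H1_norm b) / 2"
      by (rule P[OF bounded_linear_minus[OF bounded_linear_Im], of 1]) (simp_all add: abs_Im_le_cmod)
    moreover have "cmod (?c' x0) * ln (1 / \<tau>) \<le> (\<bar>Re (?c' x0)\<bar> + \<bar>- Im (?c' x0)\<bar>) * ln (1 / \<tau>)"
      using cmod_le[of "?c' x0"] \<tau>(1,2) by (intro mult_right_mono) auto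
    ultimately show ?thesis unfolding distrib_right by linarith
  qed
  show ?thesis using c' by eventually_elim (simp only: main)
qed

theorem theorem1p3:
  fixes A\<^sub>1 A\<^sub>H B\<^sub>1 B\<^sub>H :: real
  shows "\<exists>\<eta>\<^sub>0>0. \<exists>C>0. \<forall>\<eta>. 0 < \<eta> \<and> \<eta> \<le> \<eta>\<^sub>0 \<longrightarrow>
    (\<exists>\<delta>>0. \<forall>a\<in>L1_H1. \<forall>b\<in>L1_H1.
      L1_norm a = A\<^sub>1 \<and> H1_norm a = A\<^sub>H \<and> L1_norm b = B\<^sub>1 \<and> H1_norm b = B\<^sub>H \<and>
      scattering_dist \<eta> a b \<le> ennreal \<delta> \<longrightarrow>
      Linf_norm (\<lambda>x. a x - b x) \<le>
        ennreal (if scattering_dist \<eta> a b = 0 then 0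
                 else C * inverse \<bar>ln (enn2real (scattering_dist \<eta> a b) /
                   (1 + (L1_H1_norm a)\<^sup>2 + (L1_H1_norm b)\<^sup>2))\<bar>))"
proof -
  \<comment> \<open>The four norms are fixed before the constants are chosen, so \<open>C\<close>
    can depend on nothing else about \<open>a\<close> and \<open>b\<close>. The absolute values here
    and in \<open>R\<close> cover arbitrary real parameters, including negative ones that no norm
    attains.\<close>
  define K where "K = \<bar>log_const A\<^sub>1 A\<^sub>H B\<^sub>1 B\<^sub>H\<bar>"
  define N where "N = 1 + (A\<^sub>1 + A\<^sub>H)\<^sup>2 + (B\<^sub>1 + B\<^sub>H)\<^sup>2"
  have N: "1 \<le> N" by (simp add: N_def)
  \<comment> \<open>The factor \<open>1 + ln N / ln 2\<close> absorbs the normalization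
    \<open>N\<close> inside the logarithm; the summand 1 keeps \<open>C\<close> positive if
    \<open>K = 0\<close>.\<close>
  define C where "C = K * (1 + ln N / ln 2) + 1"
  have C: "C > 0" using N by (simp add: C_def K_def add_nonneg_pos)
  define R where "R = 576 * pi * (\<bar>A\<^sub>1\<bar> + \<bar>B\<^sub>1\<bar> + 1)"
  have R: "R > 0" by (simp add: R_def add_nonneg_pos)
  have main: "\<exists>\<delta>>0. \<forall>a\<in>L1_H1. \<forall>b\<in>L1_H1.
      L1_norm a = A\<^sub>1 \<and> H1_norm a = A\<^sub>H \<and> L1_norm b = B\<^sub>1 \<and> H1_norm b = B\<^sub>H \<and>
      scattering_dist \<eta> a b \<le> ennreal \<delta> \<longrightarrow>
      Linf_norm (\<lambda>x. a x - b x) \<le>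
        ennreal (if scattering_dist \<eta> a b = 0 then 0
                 else C * inverse \<bar>ln (enn2real (scattering_dist \<eta> a b) /
                   (1 + (L1_H1_norm a)\<^sup>2 + (L1_H1_norm b)\<^sup>2))\<bar>)"
    if \<eta>: "0 < \<eta>" for \<eta>
  proof -
    \<comment> \<open>The three bounds give \<open>ln (1 / D) \<ge> ln 2\<close>, the contraction
      condition \<open>R * sqrt \<tau> \<le> 1\<close>, and packets inside the ball of radius
      \<open>\<eta>\<close>.\<close>
    define \<delta> where "\<delta> = min (1 / 2) (min (1 / R\<^sup>2) (\<eta> ^ 4 / 4))"
    have \<delta>: "\<delta> > 0" using \<eta> R by (simp add: \<delta>_def)
    show ?thesis
    proof (intro exI[of _ \<delta>] conjI ballI impI)
      fix a b assume a: "a \<in> L1_H1" and b: "b \<in> L1_H1"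
      assume "L1_norm a = A\<^sub>1 \<and> H1_norm a = A\<^sub>H \<and> L1_norm b = B\<^sub>1 \<and> H1_norm b = B\<^sub>H \<and>
        scattering_dist \<eta> a b \<le> ennreal \<delta>"
      then have norms: "L1_norm a = A\<^sub>1" "H1_norm a = A\<^sub>H" "L1_norm b = B\<^sub>1" "H1_norm b = B\<^sub>H"
        and le: "scattering_dist \<eta> a b \<le> ennreal \<delta>" by auto
      define D where "D = enn2real (scattering_dist \<eta> a b)"
      have D: "scattering_dist \<eta> a b = ennreal D" "0 \<le> D" "D \<le> \<delta>"
      proof -
        have "scattering_dist \<eta> a b < \<infinity>" using le by (rule le_less_trans) simp
        then show "scattering_dist \<eta> a b = ennreal D" by (simp add: D_def)
        show "0 \<le> D" by (simp add: D_def)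
        show "D \<le> \<delta>" unfolding D_def using le \<delta> by (intro enn2real_leI) auto
      qed
      have bound: "AE x in lborel. cmod (a x - b x) \<le> K / ln (1 / \<tau>)" if \<tau>: "0 < \<tau>" "\<tau> \<le> \<delta>" "D \<le> \<tau>" for \<tau>
      proof -
        have t1: "\<tau> < 1" and t2: "4 * \<tau> \<le> \<eta> ^ 4" and t3: "\<tau> \<le> 1 / R\<^sup>2" using \<tau>(2) by (auto simp: \<delta>_def)
        have "sqrt \<tau> \<le> 1 / R" by (rule real_le_lsqrt) (use t3 R \<tau>(1) in \<open>auto simp: power_divide\<close>)
        then have sR: "R * sqrt \<tau> \<le> 1" using R by (simp add: pos_le_divide_eq mult.commute)
        have small: "576 * pi * x * sqrt \<tau> \<le> 1" if "x \<le> \<bar>A\<^sub>1\<bar> + \<bar>B\<^sub>1\<bar> + 1" for x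
        proof -
          have "576 * pi * x * sqrt \<tau> \<le> R * sqrt \<tau>" unfolding R_def using that \<tau>(1) by (intro mult_right_mono mult_left_mono) auto
          with sR show ?thesis by simp
        qed
        have s1: "576 * pi * L1_norm a * sqrt \<tau> \<le> 1" "576 * pi * L1_norm b * sqrt \<tau> \<le> 1"
          by (rule small, simp add: norms)+
        have l: "ln (1 / \<tau>) > 0" using \<tau>(1) t1 by simp
        have "AE x in lborel. cmod (a x - b x) * ln (1 / \<tau>) \<le> log_const A\<^sub>1 A\<^sub>H B\<^sub>1 B\<^sub>H"
          using scattering_dist_log_bound[OF a b \<tau>(1) t1 s1 \<eta> t2 D(1,2) \<tau>(3)] by (simp only: norms)
        then show ?thesis
        proof eventually_elim
          case (elim x)
          then have "cmod (a x - b x) * ln (1 / \<tau>) \<le> K" unfolding K_def by linarith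
          then show ?case using l by (simp only: pos_le_divide_eq)
        qed
      qed
      have meas: "(\<lambda>x. ennreal (cmod (a x - b x))) \<in> borel_measurable lborel"
        using L1_H1_D(3)[OF a] L1_H1_D(3)[OF b] by measurable
      have Linf: "Linf_norm (\<lambda>x. a x - b x) \<le> ennreal r" if "AE x in lborel. cmod (a x - b x) \<le> r" for r
        unfolding Linf_norm_def
        by (rule esssup_I[OF meas]) (use that in \<open>auto elim!: eventually_mono intro: ennreal_leI\<close>)
      show "Linf_norm (\<lambda>x. a x - b x) \<le>
        ennreal (if scattering_dist \<eta> a b = 0 then 0
                 else C * inverse \<bar>ln (enn2real (scattering_dist \<eta> a b) /
                   (1 + (L1_H1_norm a)\<^sup>2 + (L1_H1_norm b)\<^sup>2))\<bar>)"
      proof (cases "D = 0")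
        case True
        \<comment> \<open>For equal maps every \<open>\<tau> \<le> \<delta>\<close> is admissible. A
          sequence tending to 0 keeps the exceptional null sets countable in number, and the
          logarithm drives the bound to 0.\<close>
        have "AE x in lborel. cmod (a x - b x) \<le> K / ln (1 / (\<delta> / real (Suc n)))" for n
        proof (rule bound)
          show "\<delta> / real (Suc n) \<le> \<delta>" using \<delta> by (simp add: divide_le_eq mult_left_mono)
        qed (use \<delta> True in auto)
        then have "AE x in lborel. \<forall>n. cmod (a x - b x) \<le> K / ln (1 / (\<delta> / real (Suc n)))"
          unfolding AE_all_countable by (rule allI)
        then have "AE x in lborel. cmod (a x - b x) \<le> 0"
        proof eventually_elim
          case (elim x)
          have "(\<lambda>n. K / ln (1 / (\<delta> / real (Suc n)))) \<longlonglongrightarrow> 0" using \<delta> by real_asymp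
          then show ?case by (rule LIMSEQ_le_const) (use elim in auto)
        qed
        then show ?thesis using Linf[of 0] True D(1) by simp
      next
        case False
        then have D0: "D > 0" using D(2) by simp
        have D2: "D \<le> 1 / 2" using D(3) by (simp add: \<delta>_def)
        have l2: "ln 2 \<le> ln (1 / D)" using D0 D2 by (subst ln_le_cancel_iff) (auto simp: field_simps)
        have l2': "0 < ln (2::real)" by simp
        have lN: "0 \<le> ln N" using N by simp
        have eq: "\<bar>ln (D / N)\<bar> = ln N + ln (1 / D)"
        proof -
          have "ln (D / N) = - (ln N + ln (1 / D))" using D0 N by (simp add: ln_div)
          then show ?thesis using lN l2 l2' by linarith
        qed
        have l3: "0 < ln (1 / D)" using l2 l2' by linarith
        have q: "0 < \<bar>ln (D / N)\<bar>" using eq lN l3 by linarith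
        \<comment> \<open>Since \<open>D \<le> 1 / 2\<close>, the constant \<open>ln N\<close> is
          dominated by a multiple of \<open>ln (1 / D)\<close>. This compares the normalized
          logarithm in the theorem with the one obtained from the choice
          \<open>\<tau> = D\<close>.\<close>
        have "ln N \<le> ln N / ln 2 * ln (1 / D)"
        proof -
          have "ln N = ln N / ln 2 * ln 2" by simp
          also have "\<dots> \<le> ln N / ln 2 * ln (1 / D)" using lN l2 l2' by (intro mult_left_mono) auto
          finally show ?thesis .
        qed
        then have "\<bar>ln (D / N)\<bar> \<le> (1 + ln N / ln 2) * ln (1 / D)" unfolding eq by (simp add: distrib_right)
        then have "K * \<bar>ln (D / N)\<bar> \<le> K * ((1 + ln N / ln 2) * ln (1 / D))" by (rule mult_left_mono) (simp add: K_def)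
        also have "\<dots> = (C - 1) * ln (1 / D)" unfolding C_def by simp
        also have "\<dots> \<le> C * ln (1 / D)" by (rule mult_right_mono) (use l3 in auto)
        finally have "K / ln (1 / D) \<le> C / \<bar>ln (D / N)\<bar>"
          using l3 q by (simp only: pos_divide_le_eq pos_le_divide_eq times_divide_eq_left)
        then have "AE x in lborel. cmod (a x - b x) \<le> C / \<bar>ln (D / N)\<bar>"
          using bound[OF D0 D(3) order_refl] by (auto elim!: eventually_mono)
        then have "Linf_norm (\<lambda>x. a x - b x) \<le> ennreal (C / \<bar>ln (D / N)\<bar>)" by (rule Linf)
        moreover have "1 + (L1_H1_norm a)\<^sup>2 + (L1_H1_norm b)\<^sup>2 = N" by (simp add: N_def L1_H1_norm_def norms)
        moreover have "scattering_dist \<eta> a b \<noteq> 0" using D(1) D0 by simp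
        ultimately show ?thesis by (simp only: if_False D_def[symmetric] divide_inverse[of C, symmetric])
      qed
    qed (rule \<delta>)
  qed
  show ?thesis
  \<comment> \<open>The dependence on \<open>\<eta>\<close> is carried by \<open>\<delta>\<close>
    alone, so the threshold can be taken as 1.\<close>
  proof (rule exI[of _ 1], rule conjI[OF zero_less_one], rule exI[of _ C], rule conjI[OF C], rule allI, rule impI)
    fix \<eta> :: real assume "0 < \<eta> \<and> \<eta> \<le> 1"
    then have "0 < \<eta>" ..
    from main[OF this] show "\<exists>\<delta>>0. \<forall>a\<in>L1_H1. \<forall>b\<in>L1_H1.
      L1_norm a = A\<^sub>1 \<and> H1_norm a = A\<^sub>H \<and> L1_norm b = B\<^sub>1 \<and> H1_norm b = B\<^sub>H \<and>
      scattering_dist \<eta> a b \<le> ennreal \<delta> \<longrightarrow>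
      Linf_norm (\<lambda>x. a x - b x) \<le>
        ennreal (if scattering_dist \<eta> a b = 0 then 0
                 else C * inverse \<bar>ln (enn2real (scattering_dist \<eta> a b) /
                   (1 + (L1_H1_norm a)\<^sup>2 + (L1_H1_norm b)\<^sup>2))\<bar>)" .
  qed
qed

end
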